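(* Let $M$ be a regular analytic surface in the Minkowski space $\mathbb R^3_1$. (1) Let ${\rm p}\in M$ be a spacelike or timelike umbilic point. Then $m_u({\rm p})=1$ if, and only if, the discriminant of the binary differential equation of the lines of principal curvature (which is the $LPL$ when ${\rm p}$ is a timelike umbilic) has a Morse singularity at ${\rm p}$. (2) Let ${\rm p}\in M$ be a lightlike umbilic point. Then $m_u({\rm p})=1$ if, and only if, the locus of degeneracy $LD$ of the metric has a Morse singularity at ${\rm p}$.
   Context: $\mathbb R^3_1$ is $\mathbb R^3$ with the pseudo-scalar product $\langle u,v\rangle=u_0v_0+u_1v_1-u_2v_2$; $\langle u\times v,w\rangle=\det(u,v,w)$. For a local parametrisation $\mathbf x(u,v)$ of $M$, put $E=\langle \mathbf x_u,\mathbf x_u\rangle$, $F=\langle \mathbf x_u,\mathbf x_v\rangle$, $G=\langle \mathbf x_v,\mathbf x_v\rangle$, $\bar l=\langle \mathbf x_u\times \mathbf x_v,\mathbf x_{uu}\rangle$, $\bar m=\langle \mathbf x_u\times \mathbf x_v,\mathbf x_{uv}\rangle$, $\bar n=\langle \mathbf x_u\times \mathbf x_v,\mathbf x_{vv}\rangle$, $\mathfrak a=F\bar n-G\bar m$, $\mathfrak b=E\bar n-G\bar l$, $\mathfrak c=E\bar m-F\bar l$. The lines of principal curvature are the solutions of $\mathfrak a\,dv^2+\mathfrak b\,du\,dv+\mathfrak c\,du^2=0$; its discriminant is the zero set of $\mathfrak b^2-4\mathfrak a\mathfrak c$, called the Lightlike Principal Locus ($LPL$) in the Lorentzian region. The locus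 of degeneracy $LD$ is the zero set of $F^2-EG$; the metric is Riemannian (resp. Lorentzian) where $F^2-EG<0$ (resp. $>0$). A point ${\rm p}=\mathbf x(q)$ is an umbilic point if $\mathfrak a(q)=\mathfrak b(q)=\mathfrak c(q)=0$; it is spacelike, timelike or lightlike according as the metric at ${\rm p}$ is Riemannian, Lorentzian or degenerate. The discriminant (resp. $LD$) has a Morse singularity at ${\rm p}$ if the function $\mathfrak b^2-4\mathfrak a\mathfrak c$ (resp. $F^2-EG$) has a nondegenerate critical point at $q$. Multiplicity: with $\mathcal O_2$ the ring of germs (at $q$) of holomorphic functions in two variables and $m(h,k)=\dim_{\mathbb C}\mathcal O_2/\langle h,k\rangle$ (real analytic germs complexified), $m_u({\rm p})=m(\mathfrak b,\mathfrak c)$ if $E(q)\neq0$, $m(\mathfrak a,\mathfrak c)$ if $F(q)\ne 0$, $m(\mathfrak a,\mathfrak b)$ if $G(q)\neq 0$ (at least one of these holds). *)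

theory Defs
  imports
    "HOL-Analysis.Analysis"
    "HOL-Algebra.Embedded_Algebras"
    "HOL-Algebra.QuotRing"
    "HOL-Library.Extended_Nat"
begin

section \<open>Analytic functions of two variables\<close>

text \<open>
  \<open>f\<close> is the sum of a (necessarily absolutely) convergent double power series on a polydisc
  around \<open>p\<close>. For \<open>'k = real\<close> this is real analyticity at \<open>p\<close>, for \<open>'k = complex\<close> it says that
  \<open>f\<close> is holomorphic on a neighbourhood of \<open>p\<close>.
\<close>

definition analytic2_at :: "('k \<times> 'k \<Rightarrow> 'k::real_normed_field) \<Rightarrow> 'k \<times> 'k \<Rightarrow> bool" where
  "analytic2_at f p \<longleftrightarrow>
     (\<exists>c :: nat \<Rightarrow> nat \<Rightarrow> 'k. \<exists>r>0. \<forall>s t. norm s < r \<and> norm t < r \<longrightarrow>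
        ((\<lambda>(i, j). c i j * s ^ i * t ^ j) has_sum f (fst p + s, snd p + t)) UNIV)"

definition partial_u :: "(real \<times> real \<Rightarrow> 'a::real_normed_vector) \<Rightarrow> real \<times> real \<Rightarrow> 'a" where
  "partial_u f p = vector_derivative (\<lambda>s. f (s, snd p)) (at (fst p))"

definition partial_v :: "(real \<times> real \<Rightarrow> 'a::real_normed_vector) \<Rightarrow> real \<times> real \<Rightarrow> 'a" where
  "partial_v f p = vector_derivative (\<lambda>t. f (fst p, t)) (at (snd p))"


section \<open>Surfaces in Minkowski 3-space\<close>

text \<open>The timelike coordinate is the last one, \<open>u $ 3\<close>.\<close>

definition mink :: "real^3 \<Rightarrow> real^3 \<Rightarrow> real" where
  "mink u v = u $ 1 * v $ 1 + u $ 2 * v $ 2 - u $ 3 * v $ 3"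

definition mink_cross :: "real^3 \<Rightarrow> real^3 \<Rightarrow> real^3" where
  "mink_cross u v =
     vector [u $ 2 * v $ 3 - u $ 3 * v $ 2,
             u $ 3 * v $ 1 - u $ 1 * v $ 3,
             - (u $ 1 * v $ 2 - u $ 2 * v $ 1)]"

text \<open>The pseudo-scalar product is nondegenerate, so this property determines the cross product.\<close>

lemma mink_mink_cross: "mink (mink_cross u v) w = det (vector [u, v, w])"
  by (simp add: mink_def mink_cross_def det_3 algebra_simps)

definition local_parametrisation ::
    "(real^3) set \<Rightarrow> (real \<times> real) set \<Rightarrow> (real \<times> real \<Rightarrow> real^3) \<Rightarrow> bool" where
  "local_parametrisation M U x \<longleftrightarrow>
     open U \<and> x ` U \<subseteq> M \<and> openin (top_of_set M) (x ` U) \<and>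
     (\<exists>g. homeomorphism U (x ` U) x g) \<and>
     (\<forall>p\<in>U. \<forall>i. analytic2_at (\<lambda>z. x z $ i) p) \<and>
     (\<forall>p\<in>U. \<forall>\<alpha> \<beta>. \<alpha> *\<^sub>R partial_u x p + \<beta> *\<^sub>R partial_v x p = 0 \<longrightarrow> \<alpha> = 0 \<and> \<beta> = 0)"

definition regular_analytic_surface :: "(real^3) set \<Rightarrow> bool" where
  "regular_analytic_surface M \<longleftrightarrow>
     (\<forall>p\<in>M. \<exists>U x. local_parametrisation M U x \<and> p \<in> x ` U)"

definition coeff_E :: "(real \<times> real \<Rightarrow> real^3) \<Rightarrow> real \<times> real \<Rightarrow> real" where
  "coeff_E x p = mink (partial_u x p) (partial_u x p)"

definition coeff_F :: "(real \<times> real \<Rightarrow> real^3) \<Rightarrow> real \<times> real \<Rightarrow> real" where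
  "coeff_F x p = mink (partial_u x p) (partial_v x p)"

definition coeff_G :: "(real \<times> real \<Rightarrow> real^3) \<Rightarrow> real \<times> real \<Rightarrow> real" where
  "coeff_G x p = mink (partial_v x p) (partial_v x p)"

definition coeff_l :: "(real \<times> real \<Rightarrow> real^3) \<Rightarrow> real \<times> real \<Rightarrow> real" where
  "coeff_l x p = mink (mink_cross (partial_u x p) (partial_v x p)) (partial_u (partial_u x) p)"

definition coeff_m :: "(real \<times> real \<Rightarrow> real^3) \<Rightarrow> real \<times> real \<Rightarrow> real" where
  "coeff_m x p = mink (mink_cross (partial_u x p) (partial_v x p)) (partial_v (partial_u x) p)"

definition coeff_n :: "(real \<times> real \<Rightarrow> real^3) \<Rightarrow> real \<times> real \<Rightarrow> real" where
  "coeff_n x p = mink (mink_cross (partial_u x p) (partial_v x p)) (partial_v (partial_v x) p)"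

text \<open>
  The lines of principal curvature are the solutions of \<open>a dv\<^sup>2 + b du dv + c du\<^sup>2 = 0\<close> with
  the following coefficients.
\<close>

definition bde_a :: "(real \<times> real \<Rightarrow> real^3) \<Rightarrow> real \<times> real \<Rightarrow> real" where
  "bde_a x p = coeff_F x p * coeff_n x p - coeff_G x p * coeff_m x p"

definition bde_b :: "(real \<times> real \<Rightarrow> real^3) \<Rightarrow> real \<times> real \<Rightarrow> real" where
  "bde_b x p = coeff_E x p * coeff_n x p - coeff_G x p * coeff_l x p"

definition bde_c :: "(real \<times> real \<Rightarrow> real^3) \<Rightarrow> real \<times> real \<Rightarrow> real" where
  "bde_c x p = coeff_E x p * coeff_m x p - coeff_F x p * coeff_l x p"

text \<open>
  The discriminant of the equation is the zero set of \<open>discriminant_fun x\<close> (the \<open>LPL\<close> is its part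
  in the Lorentzian region), and the locus of degeneracy \<open>LD\<close> is the zero set of \<open>LD_fun x\<close>.
\<close>

definition discriminant_fun :: "(real \<times> real \<Rightarrow> real^3) \<Rightarrow> real \<times> real \<Rightarrow> real" where
  "discriminant_fun x p = (bde_b x p)\<^sup>2 - 4 * bde_a x p * bde_c x p"

definition LD_fun :: "(real \<times> real \<Rightarrow> real^3) \<Rightarrow> real \<times> real \<Rightarrow> real" where
  "LD_fun x p = (coeff_F x p)\<^sup>2 - coeff_E x p * coeff_G x p"

definition umbilic :: "(real \<times> real \<Rightarrow> real^3) \<Rightarrow> real \<times> real \<Rightarrow> bool" where
  "umbilic x q \<longleftrightarrow> bde_a x q = 0 \<and> bde_b x q = 0 \<and> bde_c x q = 0"

definition spacelike_umbilic :: "(real \<times> real \<Rightarrow> real^3) \<Rightarrow> real \<times> real \<Rightarrow> bool" where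
  "spacelike_umbilic x q \<longleftrightarrow> umbilic x q \<and> LD_fun x q < 0"

definition timelike_umbilic :: "(real \<times> real \<Rightarrow> real^3) \<Rightarrow> real \<times> real \<Rightarrow> bool" where
  "timelike_umbilic x q \<longleftrightarrow> umbilic x q \<and> LD_fun x q > 0"

definition lightlike_umbilic :: "(real \<times> real \<Rightarrow> real^3) \<Rightarrow> real \<times> real \<Rightarrow> bool" where
  "lightlike_umbilic x q \<longleftrightarrow> umbilic x q \<and> LD_fun x q = 0"

text \<open>For \<open>f\<close> analytic near \<open>q\<close>: \<open>q\<close> is a nondegenerate critical point of \<open>f\<close>.\<close>

definition morse_singularity :: "(real \<times> real \<Rightarrow> real) \<Rightarrow> real \<times> real \<Rightarrow> bool" where
  "morse_singularity f q \<longleftrightarrow>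
     partial_u f q = 0 \<and> partial_v f q = 0 \<and>
     det (vector [vector [partial_u (partial_u f) q, partial_v (partial_u f) q],
                  vector [partial_u (partial_v f) q, partial_v (partial_v f) q]] :: real^2^2) \<noteq> 0"


section \<open>Multiplicity\<close>

definition germ :: "complex \<times> complex \<Rightarrow> (complex \<times> complex \<Rightarrow> complex) \<Rightarrow>
    (complex \<times> complex \<Rightarrow> complex) set" where
  "germ Q f = {g. \<forall>\<^sub>F z in nhds Q. g z = f z}"

text \<open>The ring of germs at \<open>Q\<close> of holomorphic functions, a germ being an equivalence class.\<close>

definition germ_ring :: "complex \<times> complex \<Rightarrow> (complex \<times> complex \<Rightarrow> complex) set ring" where
  "germ_ring Q =
     \<lparr>carrier = germ Q ` {f. analytic2_at f Q},
      mult = (\<lambda>A B. {h. \<exists>f\<in>A. \<exists>g\<in>B. \<forall>\<^sub>F z in nhds Q. h z = f z * g z}),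
      one = germ Q (\<lambda>_. 1),
      zero = germ Q (\<lambda>_. 0),
      add = (\<lambda>A B. {h. \<exists>f\<in>A. \<exists>g\<in>B. \<forall>\<^sub>F z in nhds Q. h z = f z + g z})\<rparr>"

text \<open>
  The dimension over \<open>\<complex>\<close> of the quotient of the germ ring by the ideal generated by \<open>h\<close> and \<open>k\<close>;
  \<open>\<complex>\<close> sits in the quotient as the set of classes of constant germs.
\<close>

definition germ_multiplicity :: "complex \<times> complex \<Rightarrow>
    (complex \<times> complex \<Rightarrow> complex) set \<Rightarrow> (complex \<times> complex \<Rightarrow> complex) set \<Rightarrow> enat" where
  "germ_multiplicity Q h k =
     (let R = germ_ring Q;
          I = Idl\<^bsub>R\<^esub> {h, k};
          A = R Quot I;
          C = range (\<lambda>c. I +>\<^bsub>R\<^esub> germ Q (\<lambda>_. c))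
      in if ring.finite_dimension A C (carrier A)
         then enat (ring.dim A C (carrier A)) else \<infinity>)"

definition complex_point :: "real \<times> real \<Rightarrow> complex \<times> complex" where
  "complex_point p = (complex_of_real (fst p), complex_of_real (snd p))"

text \<open>The complexified germ: the unique holomorphic germ that restricts to \<open>f\<close> on real points.\<close>

definition complexify :: "(real \<times> real \<Rightarrow> real) \<Rightarrow> real \<times> real \<Rightarrow>
    (complex \<times> complex \<Rightarrow> complex) set" where
  "complexify f q =
     (THE A. A \<in> carrier (germ_ring (complex_point q)) \<and>
        (\<exists>H\<in>A. \<forall>\<^sub>F p in nhds q. H (complex_point p) = complex_of_real (f p)))"

definition multiplicity2 ::
    "(real \<times> real \<Rightarrow> real) \<Rightarrow> (real \<times> real \<Rightarrow> real) \<Rightarrow> real \<times> real \<Rightarrow> enat" where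
  "multiplicity2 h k q = germ_multiplicity (complex_point q) (complexify h q) (complexify k q)"

text \<open>
  The conditions on \<open>E, F, G\<close> overlap; the description is well defined because the respective
  ideals agree, by \<open>E a - F b + G c = 0\<close>.
\<close>

definition umbilic_multiplicity :: "(real \<times> real \<Rightarrow> real^3) \<Rightarrow> real \<times> real \<Rightarrow> enat" where
  "umbilic_multiplicity x q =
     (THE m. (coeff_E x q \<noteq> 0 \<longrightarrow> m = multiplicity2 (bde_b x) (bde_c x) q) \<and>
             (coeff_F x q \<noteq> 0 \<longrightarrow> m = multiplicity2 (bde_a x) (bde_c x) q) \<and>
             (coeff_G x q \<noteq> 0 \<longrightarrow> m = multiplicity2 (bde_a x) (bde_b x) q))"

end

theory Submission
  imports Defs "HOL-Complex_Analysis.Cauchy_Integral_Formula"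
begin

text \<open>
  Write \<open>a, b, c\<close> for the coefficients of the equation of the lines of principal curvature. They satisfy
  \<open>E a - F b + G c = 0\<close>.

  Two germs that vanish at a point have multiplicity one exactly when they generate the maximal ideal,
  and this is the case exactly when their linear parts are independent
  (\<open>multiplicity2_eq_1_iff_Jacobian\<close>). Thus \<open>m\<^sub>u = 1\<close> means that a Jacobian determinant of two of the
  functions \<open>a, b, c\<close> is nonzero at the umbilic point. Both parts of the theorem compare this Jacobian
  with a Hessian determinant.

  Suppose the metric is nondegenerate at the umbilic point. Differentiating the relation above shows
  that the derivatives of \<open>(a, b, c)\<close> in the two directions are orthogonal to \<open>(E, -F, G)\<close>. So the three
  Jacobians are \<open>\<tau> E, \<tau> F, \<tau> G\<close> with a common factor \<open>\<tau>\<close>, and the Hessian determinant of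
  \<open>b\<^sup>2 - 4 a c\<close> is \<open>16 \<tau>\<^sup>2 (E G - F\<^sup>2)\<close> (\<open>nondegenerate_umbilic_Hessian\<close>).

  Suppose the metric is degenerate there. With \<open>N = x\<^sub>u \<times> x\<^sub>v\<close> one has
  \<open>\<delta> = F\<^sup>2 - E G = \<langle>N, N\<rangle>\<close>. Fix a vector \<open>e\<close> with \<open>D = \<langle>N, e\<rangle> \<noteq> 0\<close>; by Cramer's rule
  \<open>D N = A x\<^sub>u + B x\<^sub>v + \<delta> e\<close>. Pairing with \<open>x\<^sub>u\<close> and \<open>x\<^sub>v\<close> shows that the first fundamental form
  annihilates \<open>(A, B)\<close> up to multiples of \<open>\<delta>\<close>. Pairing with the derivatives of \<open>N\<close> shows that the
  gradient of \<open>\<delta>\<close> is \<open>- 2 / D\<close> times the second fundamental form applied to \<open>(A, B)\<close>, again up to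
  multiples of \<open>\<delta>\<close> (\<open>LD_fun_partial_u\<close>, \<open>LD_fun_partial_v\<close>). At an umbilic point the second form is
  \<open>k\<close> times the first. So \<open>\<delta>\<close> has a critical point there, and its Hessian matrix is \<open>- 2 / D\<close> times the
  derivative of the second form minus \<open>k\<close> times the first, applied to \<open>(A, B)\<close>. Since \<open>(A, B)\<close> is
  proportional to \<open>(-F, E)\<close> and to \<open>(-G, F)\<close>, one of which is nonzero, this expresses the Hessian through the derivatives of \<open>a, b, c\<close>, and its
  determinant is a nonzero multiple of the Jacobian (\<open>lightlike_umbilic_Hessian\<close>).

  The analysis behind these arguments is that of convergent double power series: they form a ring in
  which nonvanishing germs are units, they can be divided by the coordinates and differentiated
  termwise, and a holomorphic germ is determined by its values at real points. The last fact makes it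
  possible to carry identities between real analytic functions over to their complexifications.
\<close>

section \<open>Double power series\<close>

text \<open>
  The bound on the coefficients is part of the definition because it makes every series below
  absolutely convergent by comparison with a geometric series. It follows from convergence at a
  single point, so that it does not restrict the functions (\<open>analytic2_at_iff_expansion\<close>).
\<close>

definition expansion :: "(nat \<Rightarrow> nat \<Rightarrow> 'k) \<Rightarrow> real \<Rightarrow> ('k \<times> 'k \<Rightarrow> 'k::real_normed_field) \<Rightarrow> 'k \<times> 'k \<Rightarrow> bool" where
  "expansion c r f p \<longleftrightarrow> r > 0 \<and> (\<exists>C. \<forall>i j. norm (c i j) * r ^ (i + j) \<le> C) \<and>
     (\<forall>s t. norm s < r \<and> norm t < r \<longrightarrow>
        ((\<lambda>(i, j). c i j * s ^ i * t ^ j) has_sum f (fst p + s, snd p + t)) UNIV)"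

lemma geometric_has_sum:
  fixes x :: real assumes "0 \<le> x" "x < 1"
  shows "((\<lambda>i::nat. x ^ i) has_sum (1 / (1 - x))) UNIV"
  using assms by (intro sums_nonneg_imp_has_sum geometric_sums) auto

lemma geometric2_has_sum:
  fixes x y :: real assumes "0 \<le> x" "x < 1" "0 \<le> y" "y < 1"
  shows "((\<lambda>(i::nat, j::nat). x ^ i * y ^ j) has_sum (1 / (1 - x) * (1 / (1 - y)))) UNIV"
proof -
  let ?f = "\<lambda>(i::nat, j::nat). x ^ i * y ^ j"
  have 1: "((\<lambda>j. ?f (i, j)) has_sum (x ^ i * (1 / (1 - y)))) UNIV" for i
    using has_sum_cmult_right[OF geometric_has_sum[OF assms(3,4)]] by simp
  have 2: "((\<lambda>i. x ^ i * (1 / (1 - y))) has_sum (1 / (1 - x) * (1 / (1 - y)))) UNIV"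
    by (rule has_sum_cmult_left[OF geometric_has_sum[OF assms(1,2)]])
  have "?f summable_on Sigma UNIV (\<lambda>_. UNIV)"
    by (rule summable_on_SigmaI[OF 1 has_sum_imp_summable[OF 2]]) (use assms in auto)
  from has_sum_SigmaI[OF 1 2 this] show ?thesis by simp
qed

lemma monomial_bound:
  fixes c :: "nat \<Rightarrow> nat \<Rightarrow> 'k::real_normed_field"
  assumes "norm (c i j) * r ^ (i + j) \<le> C" "r > 0"
  shows "norm (c i j * s ^ i * t ^ j) \<le> C * ((norm s / r) ^ i * (norm t / r) ^ j)"
proof -
  have "norm (c i j * s ^ i * t ^ j) =
      norm (c i j) * r ^ (i + j) * ((norm s / r) ^ i * (norm t / r) ^ j)"
    using assms(2) by (simp add: norm_mult norm_power power_divide power_add)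
  also have "\<dots> \<le> C * ((norm s / r) ^ i * (norm t / r) ^ j)"
    using assms by (intro mult_right_mono) auto
  finally show ?thesis .
qed

lemma abs_summable_of_bound:
  fixes c :: "nat \<Rightarrow> nat \<Rightarrow> 'k::real_normed_field"
  assumes bd: "\<And>i j. norm (c i j) * r ^ (i + j) \<le> C" and "r > 0" "norm s < r" "norm t < r"
  shows "(\<lambda>(i, j). c i j * s ^ i * t ^ j) abs_summable_on UNIV"
    and "infsum (\<lambda>(i, j). norm (c i j * s ^ i * t ^ j)) UNIV \<le> C * (1 / (1 - norm s / r) * (1 / (1 - norm t / r)))"
proof -
  let ?g = "\<lambda>(i::nat, j::nat). C * ((norm s / r) ^ i * (norm t / r) ^ j)"
  have g: "(?g has_sum (C * (1 / (1 - norm s / r) * (1 / (1 - norm t / r))))) UNIV"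
    using has_sum_cmult_right[OF geometric2_has_sum, of "norm s / r" "norm t / r" C] assms
    by (simp add: case_prod_unfold)
  have le: "norm ((\<lambda>(i, j). c i j * s ^ i * t ^ j) z) \<le> ?g z" for z
    using monomial_bound[where c = c, OF bd[of "fst z" "snd z"] assms(2)] by (simp add: case_prod_unfold)
  show 1: "(\<lambda>(i, j). c i j * s ^ i * t ^ j) abs_summable_on UNIV"
    by (rule Infinite_Sum.abs_summable_on_comparison_test'[OF has_sum_imp_summable[OF g]]) (use le in auto)
  have "infsum (\<lambda>(i, j). norm (c i j * s ^ i * t ^ j)) UNIV \<le> infsum ?g UNIV"
    by (rule infsum_mono) (use 1 g le in \<open>auto simp: case_prod_unfold intro: has_sum_imp_summable\<close>)
  then show "infsum (\<lambda>(i, j). norm (c i j * s ^ i * t ^ j)) UNIV \<le> C * (1 / (1 - norm s / r) * (1 / (1 - norm t / r)))"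
    using infsumI[OF g] by simp
qed

text \<open>
  The partial sums over finite sets containing a large finite set \<open>F0\<close> are close to the sum, so a
  term outside \<open>F0\<close>, being a difference of two of them, has norm at most \<open>2\<close>.
\<close>

lemma has_sum_terms_bounded:
  fixes f :: "'a \<Rightarrow> 'k::real_normed_vector"
  assumes "(f has_sum S) A"
  shows "\<exists>C. \<forall>x\<in>A. norm (f x) \<le> C"
proof -
  obtain F0 where F0: "finite F0" "F0 \<subseteq> A"
    and near: "\<And>F. finite F \<Longrightarrow> F0 \<subseteq> F \<Longrightarrow> F \<subseteq> A \<Longrightarrow> dist (sum f F) S < 1"
    using assms unfolding has_sum_def tendsto_iff eventually_finite_subsets_at_top
    by (metis zero_less_one)
  have out: "norm (f x) \<le> 2" if "x \<in> A" "x \<notin> F0" for x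
  proof -
    have "f x = sum f (insert x F0) - sum f F0" using F0 that by simp
    then have "norm (f x) = dist (sum f (insert x F0)) (sum f F0)" by (simp add: dist_norm)
    also have "\<dots> \<le> dist (sum f (insert x F0)) S + dist (sum f F0) S"
      by (rule dist_triangle2)
    also have "\<dots> < 1 + 1" by (intro add_strict_mono near) (use F0 that in auto)
    finally show ?thesis by simp
  qed
  have "norm (f x) \<le> 2 + (\<Sum>y\<in>F0. norm (f y))" if "x \<in> A" for x
  proof (cases "x \<in> F0")
    case True
    then have "norm (f x) \<le> (\<Sum>y\<in>F0. norm (f y))" by (intro member_le_sum) (use F0 in auto)
    then show ?thesis by simp
  next
    case False
    then show ?thesis using out[OF that] by (meson add_increasing2 norm_ge_zero sum_nonneg)
  qed
  then show ?thesis by blast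
qed

lemma analytic2_at_iff_expansion: "analytic2_at f p \<longleftrightarrow> (\<exists>c r. expansion c r f p)"
proof
  assume "analytic2_at f p"
  then obtain c r where r: "r > 0"
    and hs: "\<And>s t. norm s < r \<Longrightarrow> norm t < r \<Longrightarrow>
       ((\<lambda>(i, j). c i j * s ^ i * t ^ j) has_sum f (fst p + s, snd p + t)) UNIV"
    unfolding analytic2_at_def by blast
  let ?h = "of_real (r / 2) :: 'a"
  have "((\<lambda>(i, j). c i j * ?h ^ i * ?h ^ j) has_sum f (fst p + ?h, snd p + ?h)) UNIV"
    by (rule hs) (use r in auto)
  from has_sum_terms_bounded[OF this] obtain C where C: "\<And>i j. norm (c i j * ?h ^ i * ?h ^ j) \<le> C"
    by auto
  have "norm (c i j) * (r / 2) ^ (i + j) \<le> C" for i j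
    using C[of i j] r by (simp add: norm_mult norm_power power_add)
  then have "expansion c (r / 2) f p" unfolding expansion_def using r by (auto intro!: hs)
  then show "\<exists>c r. expansion c r f p" by blast
qed (auto simp: expansion_def analytic2_at_def)

lemma expansion_subradius:
  assumes "expansion c r f p" "0 < r'" "r' \<le> r"
  shows "expansion c r' f p"
proof -
  obtain C where C: "\<And>i j. norm (c i j) * r ^ (i + j) \<le> C" using assms unfolding expansion_def by blast
  have "norm (c i j) * r' ^ (i + j) \<le> C" for i j
    using C[of i j] mult_left_mono[OF power_mono[of r' r "i+j"], of "norm (c i j)"] assms by simp
  with assms show ?thesis unfolding expansion_def by auto
qed

lemma expansionI:
  fixes c :: "nat \<Rightarrow> nat \<Rightarrow> 'k::{real_normed_field,banach}"
  assumes "r > 0" "\<And>i j. norm (c i j) * r ^ (i + j) \<le> C"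
    and "\<And>s t. norm s < r \<Longrightarrow> norm t < r \<Longrightarrow> infsum (\<lambda>(i, j). c i j * s ^ i * t ^ j) UNIV = f (fst p + s, snd p + t)"
  shows "expansion c r f p"
  unfolding expansion_def
proof (intro conjI allI impI)
  fix s t :: 'k assume st: "norm s < r \<and> norm t < r"
  have "(\<lambda>(i, j). c i j * s ^ i * t ^ j) summable_on UNIV"
    by (rule abs_summable_summable[OF abs_summable_of_bound(1)[OF assms(2,1)]]) (use st in auto)
  from has_sum_infsum[OF this] show "((\<lambda>(i, j). c i j * s ^ i * t ^ j) has_sum f (fst p + s, snd p + t)) UNIV"
    using assms(3) st by simp
qed (use assms in auto)

lemma expansion_cong:
  assumes "expansion c r f p" "\<And>s t. norm s < r \<Longrightarrow> norm t < r \<Longrightarrow> f (fst p + s, snd p + t) = g (fst p + s, snd p + t)"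
  shows "expansion c r g p"
  using assms unfolding expansion_def by auto

lemma nhds_prodD:
  fixes p :: "'k \<times> ('k::real_normed_field)"
  assumes "\<forall>\<^sub>F z in nhds p. P z"
  obtains r where "r > 0" "\<And>s t. norm s < r \<Longrightarrow> norm t < r \<Longrightarrow> P (fst p + s, snd p + t)"
proof -
  obtain d where d: "d > 0" "\<And>z. dist z p < d \<Longrightarrow> P z"
    using assms unfolding eventually_nhds_metric by blast
  have "P (fst p + s, snd p + t)" if "norm s < d/2" "norm t < d/2" for s t
  proof (rule d(2))
    have "dist (fst p + s, snd p + t) p = norm (s, t)"
      by (cases p) (simp add: dist_norm)
    also have "\<dots> \<le> norm s + norm t"
      by (simp add: norm_Pair sqrt_sum_squares_le_sum)
    finally show "dist (fst p + s, snd p + t) p < d" using that by simp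
  qed
  then show ?thesis using that[of "d/2"] d(1) by auto
qed

lemma nhds_prodI:
  fixes p :: "'k \<times> ('k::real_normed_field)"
  assumes "r > 0" "\<And>s t. norm s < r \<Longrightarrow> norm t < r \<Longrightarrow> P (fst p + s, snd p + t)"
  shows "\<forall>\<^sub>F z in nhds p. P z"
  unfolding eventually_nhds_metric
proof (intro exI conjI allI impI)
  fix z assume z: "dist z p < r"
  have "norm (fst z - fst p) < r" "norm (snd z - snd p) < r"
    using z dist_fst_le[of z p] dist_snd_le[of z p] by (auto simp: dist_norm)
  from assms(2)[OF this] show "P z" by simp
qed (use assms in auto)

lemma analytic2_at_cong:
  assumes "analytic2_at f p" "\<forall>\<^sub>F z in nhds p. f z = g z"
  shows "analytic2_at g p"
proof -
  obtain c r where c: "expansion c r f p" using assms(1) by (auto simp: analytic2_at_iff_expansion)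
  obtain d where d: "d > 0" "\<And>s t. norm s < d \<Longrightarrow> norm t < d \<Longrightarrow> f (fst p + s, snd p + t) = g (fst p + s, snd p + t)"
    using nhds_prodD[OF assms(2)] by blast
  have "expansion c (min r d) f p" using c d by (intro expansion_subradius[OF c]) (auto simp: expansion_def)
  then have "expansion c (min r d) g p" by (rule expansion_cong) (use d in auto)
  then show ?thesis by (auto simp: analytic2_at_iff_expansion)
qed

lemma expansion_add:
  fixes c d :: "nat \<Rightarrow> nat \<Rightarrow> 'k::{real_normed_field,banach}"
  assumes "expansion c r f p" "expansion d r g p"
  shows "expansion (\<lambda>i j. c i j + d i j) r (\<lambda>z. f z + g z) p"
proof -
  obtain C D where C: "\<And>i j. norm (c i j) * r ^ (i + j) \<le> C" and D: "\<And>i j. norm (d i j) * r ^ (i + j) \<le> D"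
    using assms unfolding expansion_def by blast
  show ?thesis
  proof (rule expansionI)
    show r: "r > 0" using assms by (simp add: expansion_def)
    show "norm (c i j + d i j) * r ^ (i + j) \<le> C + D" for i j
      using C[of i j] D[of i j] mult_right_mono[OF norm_triangle_ineq[of "c i j" "d i j"], of "r ^ (i+j)"] r
      by (simp add: algebra_simps)
    fix s t :: 'k assume "norm s < r" "norm t < r"
    then have "((\<lambda>z. (\<lambda>(i, j). c i j * s ^ i * t ^ j) z + (\<lambda>(i, j). d i j * s ^ i * t ^ j) z)
        has_sum (f (fst p + s, snd p + t) + g (fst p + s, snd p + t))) UNIV"
      by (intro has_sum_add) (use assms in \<open>auto simp: expansion_def\<close>)
    then show "infsum (\<lambda>(i, j). (c i j + d i j) * s ^ i * t ^ j) UNIV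
        = f (fst p + s, snd p + t) + g (fst p + s, snd p + t)"
      by (simp add: infsumI case_prod_unfold algebra_simps)
  qed
qed

text \<open>
  The Cauchy product: the doubly indexed family of products is absolutely summable and is
  regrouped according to the total exponents \<open>(m, n)\<close>. The conclusion does not contain a bound for
  the new coefficients, which \<open>analytic2_at_iff_expansion\<close> supplies.
\<close>

lemma expansion_mult:
  fixes c d :: "nat \<Rightarrow> nat \<Rightarrow> 'k::{real_normed_field,banach}"
  assumes "expansion c r f p" "expansion d r g p"
  shows "\<forall>s t. norm s < r \<and> norm t < r \<longrightarrow>
    ((\<lambda>(m, n). (\<Sum>(i, j)\<in>{..m} \<times> {..n}. c i j * d (m - i) (n - j)) * s ^ m * t ^ n)
      has_sum (f (fst p + s, snd p + t) * g (fst p + s, snd p + t))) UNIV"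
proof (intro allI impI)
  fix s t :: 'k assume st: "norm s < r \<and> norm t < r"
  obtain C D where C: "\<And>i j. norm (c i j) * r ^ (i + j) \<le> C" and D: "\<And>i j. norm (d i j) * r ^ (i + j) \<le> D"
    using assms unfolding expansion_def by blast
  have r: "r > 0" using assms by (simp add: expansion_def)
  define a where "a = (\<lambda>(i, j). c i j * s ^ i * t ^ j)"
  define b where "b = (\<lambda>(i, j). d i j * s ^ i * t ^ j)"
  have a: "(a has_sum f (fst p + s, snd p + t)) UNIV" and b: "(b has_sum g (fst p + s, snd p + t)) UNIV"
    using assms st unfolding expansion_def a_def b_def by auto
  have na: "(\<lambda>z. norm (a z)) summable_on UNIV"
    unfolding a_def by (rule abs_summable_of_bound(1)[OF C r]) (use st in auto)
  have nb: "(\<lambda>z. norm (b z)) summable_on UNIV"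
    unfolding b_def by (rule abs_summable_of_bound(1)[OF D r]) (use st in auto)
  have inner: "((\<lambda>w. a z * b w) has_sum (a z * g (fst p + s, snd p + t))) UNIV" for z
    by (rule has_sum_cmult_right[OF b])
  have outer: "((\<lambda>z. a z * g (fst p + s, snd p + t)) has_sum (f (fst p + s, snd p + t) * g (fst p + s, snd p + t))) UNIV"
    by (rule has_sum_cmult_left[OF a])
  have "(\<lambda>x. norm (a (fst x)) * norm (b (snd x))) summable_on Sigma UNIV (\<lambda>_. UNIV)"
  proof (rule summable_on_SigmaI)
    show "((\<lambda>y. norm (a (fst (x, y))) * norm (b (snd (x, y)))) has_sum (norm (a x) * infsum (\<lambda>z. norm (b z)) UNIV)) UNIV" for x
      using has_sum_cmult_right[OF has_sum_infsum[OF nb]] by simp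
    show "(\<lambda>x. norm (a x) * infsum (\<lambda>z. norm (b z)) UNIV) summable_on UNIV"
      by (rule summable_on_cmult_left[OF na])
  qed auto
  then have "(\<lambda>x. a (fst x) * b (snd x)) summable_on Sigma UNIV (\<lambda>_. UNIV)"
    by - (rule abs_summable_summable, simp add: norm_mult)
  then have "((\<lambda>x. a (fst x) * b (snd x)) has_sum (f (fst p + s, snd p + t) * g (fst p + s, snd p + t))) (Sigma UNIV (\<lambda>_. UNIV))"
    by (intro has_sum_SigmaI[OF _ outer]) (simp_all add: inner)
  then have tot: "((\<lambda>((i,j),(k,l)). a (i,j) * b (k,l)) has_sum (f (fst p + s, snd p + t) * g (fst p + s, snd p + t))) UNIV"
    by (simp add: case_prod_unfold)
  let ?S = "Sigma UNIV (\<lambda>z. {..fst z} \<times> {..snd z})"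
  have "((\<lambda>((m,n),(i,j)). a (i,j) * b (m - i, n - j)) has_sum (f (fst p + s, snd p + t) * g (fst p + s, snd p + t))) ?S"
    by (subst has_sum_reindex_bij_witness[where i = "\<lambda>((i,j),(k,l)). ((i+k, j+l),(i,j))" and j = "\<lambda>((m,n),(i,j)). ((i,j),(m-i,n-j))"
        and T = UNIV and h = "\<lambda>((i,j),(k,l)). a (i,j) * b (k,l)"]) (auto intro: tot)
  then have "((\<lambda>z. \<Sum>w\<in>{..fst z} \<times> {..snd z}. (\<lambda>((m,n),(i,j)). a (i,j) * b (m - i, n - j)) (z, w))
       has_sum (f (fst p + s, snd p + t) * g (fst p + s, snd p + t))) UNIV"
    by (rule has_sum_SigmaD[where f = "\<lambda>((m,n),(i,j)). a (i,j) * b (m - i, n - j)"])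
      (rule has_sum_finiteI, simp_all)
  moreover have "(\<Sum>w\<in>{..m} \<times> {..n}. (\<lambda>((m,n),(i,j)). a (i,j) * b (m - i, n - j)) ((m,n), w))
     = (\<Sum>(i, j)\<in>{..m} \<times> {..n}. c i j * d (m - i) (n - j)) * s ^ m * t ^ n" for m n
    unfolding sum_distrib_right
  proof (rule sum.cong[OF refl], clarsimp)
    fix i j assume "i \<le> m" "j \<le> n"
    then have "s ^ m = s ^ i * s ^ (m - i)" "t ^ n = t ^ j * t ^ (n - j)"
      by (simp_all flip: power_add)
    then show "a (i, j) * b (m - i, n - j) = c i j * d (m - i) (n - j) * s ^ m * t ^ n"
      by (simp add: a_def b_def)
  qed
  ultimately show "((\<lambda>(m, n). (\<Sum>(i, j)\<in>{..m} \<times> {..n}. c i j * d (m - i) (n - j)) * s ^ m * t ^ n)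
      has_sum (f (fst p + s, snd p + t) * g (fst p + s, snd p + t))) UNIV"
    by (simp add: case_prod_unfold)
qed

lemma analytic2_at_common_expansion:
  assumes "analytic2_at f p" "analytic2_at g p"
  obtains c d r where "expansion c r f p" "expansion d r g p"
proof -
  obtain c r d r' where cd: "expansion c r f p" "expansion d r' g p" using assms by (auto simp: analytic2_at_iff_expansion)
  then have "r > 0" "r' > 0" by (simp_all add: expansion_def)
  then have "expansion c (min r r') f p" "expansion d (min r r') g p"
    by (simp_all add: expansion_subradius[OF cd(1)] expansion_subradius[OF cd(2)])
  then show ?thesis by (rule that)
qed

lemma analytic2_at_add:
  fixes f g :: "'k \<times> 'k \<Rightarrow> 'k::{real_normed_field,banach}"
  assumes "analytic2_at f p" "analytic2_at g p"
  shows "analytic2_at (\<lambda>z. f z + g z) p"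
proof -
  obtain c d r where cd: "expansion c r f p" "expansion d r g p" using analytic2_at_common_expansion[OF assms] .
  from expansion_add[OF this] show ?thesis by (auto simp: analytic2_at_iff_expansion)
qed

lemma analytic2_at_mult:
  fixes f g :: "'k \<times> 'k \<Rightarrow> 'k::{real_normed_field,banach}"
  assumes "analytic2_at f p" "analytic2_at g p"
  shows "analytic2_at (\<lambda>z. f z * g z) p"
proof -
  obtain c d r where cd: "expansion c r f p" "expansion d r g p" using analytic2_at_common_expansion[OF assms] .
  have "r > 0" using cd(1) by (simp add: expansion_def)
  then show ?thesis unfolding analytic2_at_def
    by (intro exI[of _ "\<lambda>m n. \<Sum>(i, j)\<in>{..m} \<times> {..n}. c i j * d (m - i) (n - j)"] exI[of _ r] conjI) (use expansion_mult[OF cd] in simp_all)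
qed

lemma analytic2_at_finite_coeffs:
  fixes f :: "'k \<times> 'k \<Rightarrow> 'k::real_normed_field"
  assumes "finite A" "\<And>i j. (i, j) \<notin> A \<Longrightarrow> c i j = 0"
    and "\<And>s t. f (fst p + s, snd p + t) = (\<Sum>(i, j)\<in>A. c i j * s ^ i * t ^ j)"
  shows "analytic2_at f p"
  unfolding analytic2_at_def
proof (intro exI[of _ c] exI[of _ 1] conjI allI impI)
  fix s t :: 'k
  show "((\<lambda>(i, j). c i j * s ^ i * t ^ j) has_sum f (fst p + s, snd p + t)) UNIV"
  proof (rule has_sum_finite_neutralI[OF assms(1)])
    show "(\<lambda>(i, j). c i j * s ^ i * t ^ j) z = 0" if "z \<in> UNIV - A" for z
      using that assms(2)[of "fst z" "snd z"] by (simp add: case_prod_unfold)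
  qed (simp_all add: assms(3))
qed auto

lemma analytic2_at_const: "analytic2_at (\<lambda>_. k) p"
  by (rule analytic2_at_finite_coeffs[where A = "{(0,0)}" and c = "\<lambda>i j. if i = 0 \<and> j = 0 then k else 0"]) auto

lemma analytic2_at_fst: "analytic2_at fst p"
  by (rule analytic2_at_finite_coeffs[where A = "{(0,0),(1,0)}"
     and c = "\<lambda>i j. if i = 0 \<and> j = 0 then fst p else if i = 1 \<and> j = 0 then 1 else 0"]) auto

lemma analytic2_at_snd: "analytic2_at snd p"
  by (rule analytic2_at_finite_coeffs[where A = "{(0,0),(0,1)}"
     and c = "\<lambda>i j. if i = 0 \<and> j = 0 then snd p else if i = 0 \<and> j = 1 then 1 else 0"]) auto

lemma analytic2_at_uminus:
  fixes f :: "'k \<times> 'k \<Rightarrow> 'k::{real_normed_field,banach}"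
  assumes "analytic2_at f p" shows "analytic2_at (\<lambda>z. - f z) p"
  using analytic2_at_mult[OF analytic2_at_const[of "-1"] assms] by simp

lemma analytic2_at_diff:
  fixes f g :: "'k \<times> 'k \<Rightarrow> 'k::{real_normed_field,banach}"
  assumes "analytic2_at f p" "analytic2_at g p"
  shows "analytic2_at (\<lambda>z. f z - g z) p"
  using analytic2_at_add[OF assms(1) analytic2_at_uminus[OF assms(2)]] by simp

lemma analytic2_at_power:
  fixes f :: "'k \<times> 'k \<Rightarrow> 'k::{real_normed_field,banach}"
  assumes "analytic2_at f p" shows "analytic2_at (\<lambda>z. f z ^ n) p"
  by (induction n) (auto intro: analytic2_at_const analytic2_at_mult assms)

lemmas analytic2_intros = analytic2_at_add analytic2_at_mult analytic2_at_const analytic2_at_fst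
  analytic2_at_snd analytic2_at_uminus analytic2_at_diff analytic2_at_power

section \<open>Local behaviour of analytic functions\<close>

lemma expansionD:
  assumes "expansion c r f p"
  shows "r > 0"
    and "norm s < r \<Longrightarrow> norm t < r \<Longrightarrow>
      ((\<lambda>(i, j). c i j * s ^ i * t ^ j) has_sum f (fst p + s, snd p + t)) UNIV"
  using assms by (auto simp: expansion_def)

lemma analytic2_at_bounded:
  fixes f :: "'k \<times> 'k \<Rightarrow> 'k::{real_normed_field,banach}"
  assumes "analytic2_at f p"
  shows "\<exists>C. \<forall>\<^sub>F z in nhds p. norm (f z) \<le> C"
proof -
  obtain c r where c: "expansion c r f p" using assms by (auto simp: analytic2_at_iff_expansion)
  then obtain C where C: "\<And>i j. norm (c i j) * r ^ (i + j) \<le> C" and r: "r > 0"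
    unfolding expansion_def by blast
  have C0: "C \<ge> 0" using C[of 0 0] by (simp add: order_trans[OF norm_ge_zero])
  have "norm (f (fst p + s, snd p + t)) \<le> C * 4" if st: "norm s < r / 2" "norm t < r / 2" for s t
  proof -
    have st': "norm s < r" "norm t < r" using st r by linarith+
    have hs: "((\<lambda>(i, j). c i j * s ^ i * t ^ j) has_sum f (fst p + s, snd p + t)) UNIV"
      using c st' by (simp add: expansion_def)
    have summable: "(\<lambda>(i, j). c i j * s ^ i * t ^ j) abs_summable_on UNIV"
      using C r st' by (rule abs_summable_of_bound(1))
    have "norm (f (fst p + s, snd p + t)) \<le> infsum (\<lambda>(i, j). norm (c i j * s ^ i * t ^ j)) UNIV"
      using norm_infsum_bound[OF summable] infsumI[OF hs]
      by (simp add: case_prod_unfold)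
    also have "\<dots> \<le> C * (1 / (1 - norm s / r) * (1 / (1 - norm t / r)))"
      using C r st' by (rule abs_summable_of_bound(2))
    also have "\<dots> \<le> C * (2 * 2)"
      using st r by (intro mult_left_mono mult_mono C0) (auto simp: field_simps)
    finally show ?thesis by simp
  qed
  then have "\<forall>\<^sub>F z in nhds p. norm (f z) \<le> C * 4"
    by (intro nhds_prodI[of "r/2"]) (use r in simp_all)
  then show ?thesis by blast
qed

lemma expansion_center:
  fixes f :: "'k \<times> 'k \<Rightarrow> 'k::{real_normed_field,banach}"
  assumes "expansion c r f p" shows "c 0 0 = f p"
proof -
  have "((\<lambda>(i, j). c i j * 0 ^ i * 0 ^ j) has_sum f (fst p + 0, snd p + 0)) UNIV"
    using expansionD(2)[OF assms, of 0 0] expansionD(1)[OF assms] by simp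
  moreover have "((\<lambda>(i, j). c i j * 0 ^ i * 0 ^ j) has_sum c 0 0) UNIV"
    by (rule has_sum_finite_neutralI[of "{(0,0)}"]) auto
  ultimately show ?thesis by (simp add: has_sum_unique)
qed

text \<open>
  Every monomial other than the constant one is divisible by the first variable or is a power of the
  second one. Splitting the series accordingly expresses \<open>f - f p\<close> through the coordinate
  functions. This lemma replaces the Taylor formula in all that follows: continuity, first
  derivatives, and generators of the maximal ideal are read off from it.
\<close>

lemma analytic2_at_Hadamard:
  fixes f :: "'k \<times> 'k \<Rightarrow> 'k::{real_normed_field,banach}"
  assumes "analytic2_at f p"
  obtains A B where "analytic2_at A p" "analytic2_at B p"
    "\<forall>\<^sub>F z in nhds p. f z = f p + (fst z - fst p) * A z + (snd z - snd p) * B z"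
proof -
  obtain c r where c: "expansion c r f p" using assms by (auto simp: analytic2_at_iff_expansion)
  then obtain C where C: "\<And>i j. norm (c i j) * r ^ (i + j) \<le> C" and r: "r > 0"
    unfolding expansion_def by blast
  have C0: "C \<ge> 0" using C[of 0 0] by (simp add: order_trans[OF norm_ge_zero])
  define ca where "ca = (\<lambda>i j. c (Suc i) j)"
  define cb where "cb = (\<lambda>i j. if i = (0::nat) then c 0 (Suc j) else 0)"
  define A where "A = (\<lambda>z. infsum (\<lambda>(i, j). ca i j * (fst z - fst p) ^ i * (snd z - snd p) ^ j) UNIV)"
  define B where "B = (\<lambda>z. infsum (\<lambda>(i, j). cb i j * (fst z - fst p) ^ i * (snd z - snd p) ^ j) UNIV)"
  have A: "expansion ca r A p"
  proof (rule expansionI[OF r])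
    show "norm (ca i j) * r ^ (i + j) \<le> C / r" for i j
      using C[of "Suc i" j] r by (simp add: ca_def field_simps)
  qed (simp add: A_def)
  have B: "expansion cb r B p"
  proof (rule expansionI[OF r])
    show "norm (cb i j) * r ^ (i + j) \<le> C / r" for i j
      using C[of 0 "Suc j"] r C0 by (simp add: cb_def field_simps)
  qed (simp add: B_def)
  have "f (fst p + s, snd p + t) = f p + s * A (fst p + s, snd p + t) + t * B (fst p + s, snd p + t)"
    if st: "norm s < r" "norm t < r" for s t
  proof -
    let ?m = "\<lambda>(i, j). c i j * s ^ i * t ^ j"
    let ?A = "\<lambda>(i, j). s * (ca i j * s ^ i * t ^ j)"
    let ?B = "\<lambda>(i, j). t * (cb i j * s ^ i * t ^ j)"
    have a: "(?A has_sum s * A (fst p + s, snd p + t)) UNIV"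
      using has_sum_cmult_right[of "\<lambda>(i, j). ca i j * s ^ i * t ^ j"] A st
      by (simp add: expansion_def case_prod_unfold)
    have b: "(?B has_sum t * B (fst p + s, snd p + t)) UNIV"
      using has_sum_cmult_right[of "\<lambda>(i, j). cb i j * s ^ i * t ^ j"] B st
      by (simp add: expansion_def case_prod_unfold)
    have a': "(?m has_sum s * A (fst p + s, snd p + t)) {(i, j). i > 0}"
      by (subst has_sum_reindex_bij_witness[where j = "\<lambda>(i, j). (i - 1, j)" and i = "\<lambda>(i, j). (Suc i, j)"
            and T = UNIV and h = ?A])
         (use a in \<open>auto simp: ca_def gr0_conv_Suc\<close>)
    have "(?B has_sum t * B (fst p + s, snd p + t)) {(i, j). i = 0}"
      by (rule iffD1[OF has_sum_cong_neutral b]) (auto simp: cb_def)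
    then have b': "(?m has_sum t * B (fst p + s, snd p + t)) {(i, j). i = 0 \<and> j > 0}"
      by (subst has_sum_reindex_bij_witness[where j = "\<lambda>(i, j). (i, j - 1)" and i = "\<lambda>(i, j). (i, Suc j)"
            and T = "{(i, j). i = 0}" and h = ?B])
         (auto simp: cb_def gr0_conv_Suc)
    have z: "(?m has_sum f p) {(0, 0)}"
      using expansion_center[OF c] by (intro has_sum_finiteI) auto
    have "(?m has_sum (f p + s * A (fst p + s, snd p + t)) + t * B (fst p + s, snd p + t))
       (({(0,0)} \<union> {(i, j). i > 0}) \<union> {(i, j). i = 0 \<and> j > 0})"
      by (intro has_sum_Un_disjoint z a' b') auto
    moreover have "({(0,0)} \<union> {(i, j). i > 0}) \<union> {(i, j). i = 0 \<and> j > 0} = (UNIV :: (nat \<times> nat) set)"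
      by auto
    ultimately have "(?m has_sum (f p + s * A (fst p + s, snd p + t)) + t * B (fst p + s, snd p + t)) UNIV"
      by simp
    moreover have "(?m has_sum f (fst p + s, snd p + t)) UNIV" using c st by (simp add: expansion_def)
    ultimately show ?thesis using has_sum_unique by blast
  qed
  then have "\<forall>\<^sub>F z in nhds p. f z = f p + (fst z - fst p) * A z + (snd z - snd p) * B z"
    by (intro nhds_prodI[OF r]) (simp only: fst_conv snd_conv add_diff_cancel_left')
  moreover have "analytic2_at A p" "analytic2_at B p"
    using A B analytic2_at_iff_expansion by blast+
  ultimately show ?thesis by (rule that[rotated -1])
qed

lemma analytic2_at_tendsto:
  fixes f :: "'k \<times> 'k \<Rightarrow> 'k::{real_normed_field,banach}"
  assumes "analytic2_at f p"
  shows "(f \<longlongrightarrow> f p) (nhds p)"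
proof -
  obtain A B where AB: "analytic2_at A p" "analytic2_at B p"
    and eq: "\<forall>\<^sub>F z in nhds p. f z = f p + (fst z - fst p) * A z + (snd z - snd p) * B z"
    using analytic2_at_Hadamard[OF assms] .
  have bf: "Bfun A (nhds p)" "Bfun B (nhds p)"
    using analytic2_at_bounded[OF AB(1)] analytic2_at_bounded[OF AB(2)]
    by (auto intro: BfunI)
  have id: "((\<lambda>z. z) \<longlongrightarrow> p) (nhds p)" by (simp add: filterlim_def)
  have "Zfun (\<lambda>z. fst z - fst p) (nhds p)" "Zfun (\<lambda>z. snd z - snd p) (nhds p)"
    using tendsto_fst[OF id] tendsto_snd[OF id] by (simp_all add: tendsto_Zfun_iff)
  then have "Zfun (\<lambda>z. (fst z - fst p) * A z + (snd z - snd p) * B z) (nhds p)"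
    by (intro Zfun_add bounded_bilinear.Zfun_prod_Bfun[OF bounded_bilinear_mult] bf)
  then have "Zfun (\<lambda>z. f z - f p) (nhds p)"
    by (rule Zfun_ssubst[rotated]) (use eq in \<open>auto elim: eventually_mono\<close>)
  then show ?thesis by (simp add: tendsto_Zfun_iff)
qed

text \<open>
  For a fixed second variable, a double series is an ordinary power series in the first variable,
  so that theorems on power series in one variable apply.
\<close>

lemma expansion_slice:
  fixes c :: "nat \<Rightarrow> nat \<Rightarrow> 'k::{real_normed_field,banach}"
  assumes c: "expansion c r f p" and t: "norm t < r"
  obtains a where "\<And>i. ((\<lambda>j. c i j * t ^ j) has_sum a i) UNIV"
    "\<And>s. norm s < r \<Longrightarrow> ((\<lambda>i. a i * s ^ i) has_sum f (fst p + s, snd p + t)) UNIV"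
proof -
  obtain C where C: "\<And>i j. norm (c i j) * r ^ (i + j) \<le> C" and r: "r > 0"
    using c unfolding expansion_def by blast
  define a where "a i = infsum (\<lambda>j. c i j * t ^ j) UNIV" for i
  have a: "((\<lambda>j. c i j * t ^ j) has_sum a i) UNIV" for i
  proof -
    have g: "(\<lambda>j. C / r ^ i * (norm t / r) ^ j) summable_on UNIV"
      by (rule summable_on_cmult_right, rule has_sum_imp_summable, rule geometric_has_sum) (use t r in auto)
    have "norm (c i j * t ^ j) \<le> C / r ^ i * (norm t / r) ^ j" for j
    proof -
      have "norm (c i j * t ^ j) = norm (c i j) * r ^ (i + j) / r ^ i * (norm t / r) ^ j"
        using r by (simp add: norm_mult norm_power power_divide power_add)
      also have "\<dots> \<le> C / r ^ i * (norm t / r) ^ j"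
        using C r by (intro mult_right_mono divide_right_mono) auto
      finally show ?thesis .
    qed
    then have "(\<lambda>j. norm (c i j * t ^ j)) summable_on UNIV"
      by (intro Infinite_Sum.abs_summable_on_comparison_test'[OF g]) auto
    then show ?thesis unfolding a_def by (intro has_sum_infsum) (rule abs_summable_summable)
  qed
  moreover have "((\<lambda>i. a i * s ^ i) has_sum f (fst p + s, snd p + t)) UNIV" if "norm s < r" for s
  proof (rule has_sum_SigmaD[where f = "\<lambda>(i, j). c i j * s ^ i * t ^ j"])
    show "((\<lambda>(i, j). c i j * s ^ i * t ^ j) has_sum f (fst p + s, snd p + t)) (Sigma UNIV (\<lambda>_. UNIV))"
      using c t that by (simp add: expansion_def)
    show "((\<lambda>y. (\<lambda>(i, j). c i j * s ^ i * t ^ j) (x, y)) has_sum a x * s ^ x) UNIV" for x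
      using has_sum_cmult_left[OF a[of x], of "s ^ x"] by (simp add: mult_ac)
  qed
  ultimately show ?thesis by (rule that)
qed

lemma powser_eq_0_on_reals:
  fixes a :: "nat \<Rightarrow> complex"
  assumes r: "r > 0" and sm: "\<And>s::real. \<bar>s\<bar> < r \<Longrightarrow> ((\<lambda>n. a n * of_real s ^ n) has_sum 0) UNIV"
  shows "a m = 0"
proof -
  have sm': "\<And>s::real. \<bar>s\<bar> < r \<Longrightarrow> (\<lambda>n. a n * of_real s ^ n) sums 0"
    by (intro has_sum_imp_sums sm)
  define f where "f z = (\<Sum>n. a n * z ^ n)" for z
  have f: "(\<lambda>n. a n * (z - 0) ^ n) sums f z" if "norm (z - 0) < r / 2" for z
  proof -
    have "summable (\<lambda>n. a n * of_real (r / 2) ^ n)" using sm'[of "r / 2"] r by (auto simp: sums_iff)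
    from powser_inside[OF this, of z] that r show ?thesis by (simp add: f_def summable_sums)
  qed
  have freal: "f (of_real s) = 0" if "\<bar>s\<bar> < r" for s
    using sm'[OF that] by (simp add: f_def sums_iff)
  have a0: "a 0 = 0"
    using sums_unique2[OF _ powser_sums_zero[of a]] sm'[of 0] r by fastforce
  show ?thesis
  proof (rule ccontr)
    assume m: "a m \<noteq> 0"
    with a0 have "m > 0" by (cases m) auto
    obtain s where s: "s > 0" "\<And>z. z \<in> cball 0 s - {0} \<Longrightarrow> f z \<noteq> 0"
    proof (rule powser_0_nonzero[of "r/2" 0 a f m])
      show "0 < r / 2" using r by simp
      show "f 0 = 0" using freal[of 0] r by simp
    qed (use f m \<open>m > 0\<close> in auto)
    define h where "h = min s (r / 2)"
    have "h > 0" "h < r" "h \<le> s" using s r by (auto simp: h_def)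
    then show False using s(2)[of "of_real h"] freal[of h] by (auto simp: dist_norm)
  qed
qed

text \<open>
  The real points form a set of uniqueness for holomorphic germs: if the series vanishes at all
  real points, then each slice with real second variable has zero coefficients, and these
  coefficients are themselves power series that vanish on the reals.
\<close>

lemma analytic2_at_identity:
  fixes H :: "complex \<times> complex \<Rightarrow> complex"
  assumes H: "analytic2_at H (complex_point q)"
    and 0: "\<forall>\<^sub>F p in nhds q. H (complex_point p) = 0"
  shows "\<forall>\<^sub>F z in nhds (complex_point q). H z = 0"
proof -
  obtain c r where c: "expansion c r H (complex_point q)" using H by (auto simp: analytic2_at_iff_expansion)
  obtain d where d: "d > 0" "\<And>s t. norm s < d \<Longrightarrow> norm t < d \<Longrightarrow> H (complex_point (fst q + s, snd q + t)) = 0"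
    using nhds_prodD[OF 0] by metis
  define e where "e = min r d"
  have e: "e > 0" "e \<le> r" "e \<le> d" using c d by (auto simp: e_def expansion_def)
  have c0: "c i j = 0" for i j
  proof (rule powser_eq_0_on_reals[OF e(1), where a = "c i"])
    fix t :: real assume t: "\<bar>t\<bar> < e"
    then have "norm (complex_of_real t) < r" using e by simp
    from expansion_slice[OF c this] obtain a where
      a: "\<And>i. ((\<lambda>j. c i j * of_real t ^ j) has_sum a i) UNIV" and
      as: "\<And>s. norm s < r \<Longrightarrow> ((\<lambda>i. a i * s ^ i) has_sum H (fst (complex_point q) + s, snd (complex_point q) + of_real t)) UNIV"
      by blast
    have "a i = 0"
    proof (rule powser_eq_0_on_reals[OF e(1), where a = a])
      fix s :: real assume s: "\<bar>s\<bar> < e"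
      have "H (fst (complex_point q) + of_real s, snd (complex_point q) + of_real t) = 0"
        using d(2)[of s t] s t e by (simp add: complex_point_def)
      then show "((\<lambda>i. a i * of_real s ^ i) has_sum 0) UNIV" using as[of "of_real s"] s e by simp
    qed
    then show "((\<lambda>j. c i j * of_real t ^ j) has_sum 0) UNIV" using a[of i] by simp
  qed
  have "r > 0" using c by (simp add: expansion_def)
  then show ?thesis
  proof (rule nhds_prodI)
    fix s t :: complex assume "norm s < r" "norm t < r"
    then have "((\<lambda>(i, j). c i j * s ^ i * t ^ j) has_sum H (fst (complex_point q) + s, snd (complex_point q) + t)) UNIV"
      using c by (simp add: expansion_def)
    then show "H (fst (complex_point q) + s, snd (complex_point q) + t) = 0"
      by (simp add: c0 case_prod_unfold has_sum_unique[OF _ has_sum_0_simp])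
  qed
qed

text \<open>
  The Taylor coefficients of the real function serve as complex coefficients.
\<close>

lemma complexification_exists:
  fixes f :: "real \<times> real \<Rightarrow> real"
  assumes "analytic2_at f q"
  obtains H where "analytic2_at H (complex_point q)"
    "\<forall>\<^sub>F p in nhds q. H (complex_point p) = complex_of_real (f p)"
proof -
  obtain c r where c: "expansion c r f q" using assms by (auto simp: analytic2_at_iff_expansion)
  then obtain C where C: "\<And>i j. norm (c i j) * r ^ (i + j) \<le> C" and r: "r > 0"
    unfolding expansion_def by blast
  let ?c = "\<lambda>i j. complex_of_real (c i j)"
  let ?Q = "complex_point q"
  define H where "H z = infsum (\<lambda>(i, j). ?c i j * (fst z - fst ?Q) ^ i * (snd z - snd ?Q) ^ j) UNIV" for z
  have "expansion ?c r H ?Q"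
    by (rule expansionI[OF r, where C = C]) (use C in \<open>auto simp: H_def\<close>)
  moreover have "\<forall>\<^sub>F p in nhds q. H (complex_point p) = complex_of_real (f p)"
  proof (rule nhds_prodI[OF r])
    fix s t :: real assume st: "norm s < r" "norm t < r"
    have "((\<lambda>(i, j). c i j * s ^ i * t ^ j) has_sum f (fst q + s, snd q + t)) UNIV"
      using c st by (simp add: expansion_def)
    then have "((\<lambda>z. complex_of_real ((\<lambda>(i, j). c i j * s ^ i * t ^ j) z)) has_sum complex_of_real (f (fst q + s, snd q + t))) UNIV"
      by (rule has_sum_of_real)
    then have "infsum (\<lambda>(i, j). ?c i j * of_real s ^ i * of_real t ^ j) UNIV = complex_of_real (f (fst q + s, snd q + t))"
      by (intro infsumI) (simp add: case_prod_unfold)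
    then show "H (complex_point (fst q + s, snd q + t)) = complex_of_real (f (fst q + s, snd q + t))"
      by (simp add: H_def complex_point_def)
  qed
  ultimately show ?thesis by (intro that) (auto simp: analytic2_at_iff_expansion)
qed

section \<open>Reciprocals\<close>

text \<open>
  The coefficients of the reciprocal of a double series with constant term \<open>1\<close>, obtained by solving
  the Cauchy product for the coefficient of highest index.
\<close>

function recip_coeff :: "(nat \<Rightarrow> nat \<Rightarrow> 'k::comm_ring_1) \<Rightarrow> nat \<Rightarrow> nat \<Rightarrow> 'k" where
  "recip_coeff e m n =
     (if m = 0 \<and> n = 0 then 1
      else - (\<Sum>z\<in>({..m} \<times> {..n}) - {(0,0)}. e (fst z) (snd z) * recip_coeff e (m - fst z) (n - snd z)))"
  by pat_completeness auto
termination
  by (relation "Wellfounded.measure (\<lambda>(e, m, n). m + n)") auto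

declare recip_coeff.simps [simp del]

lemma recip_coeff_convolution:
  assumes "e 0 0 = 1"
  shows "(\<Sum>(i, j)\<in>{..m} \<times> {..n}. e i j * recip_coeff e (m - i) (n - j)) = (if m = 0 \<and> n = 0 then 1 else 0)"
proof -
  have "(\<Sum>(i, j)\<in>{..m} \<times> {..n}. e i j * recip_coeff e (m - i) (n - j))
      = recip_coeff e m n + (\<Sum>z\<in>({..m} \<times> {..n}) - {(0,0)}. e (fst z) (snd z) * recip_coeff e (m - fst z) (n - snd z))"
    using assms by (subst sum.remove[of _ "(0,0)"]) (auto simp: case_prod_unfold)
  also have "\<dots> = (if m = 0 \<and> n = 0 then 1 else 0)"
    by (subst recip_coeff.simps) auto
  finally show ?thesis .
qed

text \<open>
  If the non-constant coefficients have total weight at most \<open>1\<close> in radius \<open>\<rho>\<close>, then the recursion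
  expresses each new weighted coefficient as a combination of earlier ones with weights of sum at
  most \<open>1\<close>, so that the bound propagates.
\<close>

lemma recip_coeff_bound:
  fixes e :: "nat \<Rightarrow> nat \<Rightarrow> 'k::real_normed_field"
  assumes r: "\<rho> > 0"
    and small: "\<And>F. finite F \<Longrightarrow> (0, 0) \<notin> F \<Longrightarrow> (\<Sum>z\<in>F. norm (e (fst z) (snd z)) * \<rho> ^ (fst z + snd z)) \<le> 1"
  shows "norm (recip_coeff e m n) * \<rho> ^ (m + n) \<le> 1"
proof (induction "m + n" arbitrary: m n rule: less_induct)
  case less
  show ?case
  proof (cases "m = 0 \<and> n = 0")
    case True then show ?thesis by (simp add: recip_coeff.simps)
  next
    case False
    let ?F = "({..m} \<times> {..n}) - {(0,0)}"
    have "norm (recip_coeff e m n) * \<rho> ^ (m + n) \<le>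
       (\<Sum>z\<in>?F. norm (e (fst z) (snd z) * recip_coeff e (m - fst z) (n - snd z))) * \<rho> ^ (m + n)"
      using False r by (subst recip_coeff.simps) (auto intro!: mult_right_mono norm_sum)
    also have "\<dots> = (\<Sum>z\<in>?F. norm (e (fst z) (snd z)) * \<rho> ^ (fst z + snd z) *
        (norm (recip_coeff e (m - fst z) (n - snd z)) * \<rho> ^ ((m - fst z) + (n - snd z))))"
      unfolding sum_distrib_right
    proof (rule sum.cong[OF refl])
      fix z assume "z \<in> ?F"
      then have "m + n = (fst z + snd z) + ((m - fst z) + (n - snd z))" by auto
      then have "\<rho> ^ (m + n) = \<rho> ^ (fst z + snd z) * \<rho> ^ ((m - fst z) + (n - snd z))"
        by (metis power_add)
      then show "norm (e (fst z) (snd z) * recip_coeff e (m - fst z) (n - snd z)) * \<rho> ^ (m + n) =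
        norm (e (fst z) (snd z)) * \<rho> ^ (fst z + snd z) *
        (norm (recip_coeff e (m - fst z) (n - snd z)) * \<rho> ^ ((m - fst z) + (n - snd z)))"
        by (simp add: norm_mult)
    qed
    also have "\<dots> \<le> (\<Sum>z\<in>?F. norm (e (fst z) (snd z)) * \<rho> ^ (fst z + snd z) * 1)"
    proof (intro sum_mono mult_left_mono)
      fix z assume "z \<in> ?F"
      then have "(m - fst z) + (n - snd z) < m + n" by (cases z) auto
      then show "norm (recip_coeff e (m - fst z) (n - snd z)) * \<rho> ^ ((m - fst z) + (n - snd z)) \<le> 1"
        by (rule less)
    qed (use r in auto)
    also have "\<dots> \<le> 1" using small[of ?F] by simp
    finally show ?thesis .
  qed
qed

text \<open>
  Each non-constant monomial gains a factor when the radius shrinks from \<open>r\<close> to \<open>r x\<close>, so the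
  smallness that \<open>recip_coeff_bound\<close> requires can be achieved.
\<close>

lemma expansion_tail_small:
  fixes e :: "nat \<Rightarrow> nat \<Rightarrow> 'k::real_normed_field"
  assumes C: "\<And>i j. norm (e i j) * r ^ (i + j) \<le> C" and r: "r > 0"
  shows "\<exists>\<rho>>0. \<rho> \<le> r \<and> (\<forall>F. finite F \<and> (0, 0) \<notin> F \<longrightarrow>
     (\<Sum>z\<in>F. norm (e (fst z) (snd z)) * \<rho> ^ (fst z + snd z)) \<le> 1)"
proof -
  have C0: "C \<ge> 0" using C[of 0 0] by (simp add: order_trans[OF norm_ge_zero])
  \<comment> \<open>For \<open>x \<le> 1 / 8\<close> the tail of the double geometric series is at most \<open>8 x\<close>; the choice of \<open>x\<close>
    makes \<open>C\<close> times this at most \<open>1\<close>.\<close>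
  define x where "x = 1 / (8 * (C + 1))"
  have x: "0 < x" "x \<le> 1 / 8" "8 * (x * C) \<le> 1"
    using C0 by (auto simp: x_def field_simps)
  have "(\<Sum>z\<in>F. norm (e (fst z) (snd z)) * (r * x) ^ (fst z + snd z)) \<le> 1"
    if F: "finite F" "(0, 0) \<notin> F" for F
  proof -
    have g: "((\<lambda>z::nat \<times> nat. x ^ fst z * x ^ snd z) has_sum (1 / (1 - x) * (1 / (1 - x)))) UNIV"
      using geometric2_has_sum[of x x] x by (simp add: case_prod_unfold)
    have "(\<Sum>z\<in>F. norm (e (fst z) (snd z)) * (r * x) ^ (fst z + snd z))
        \<le> (\<Sum>z\<in>F. C * (x ^ fst z * x ^ snd z))"
    proof (rule sum_mono)
      fix z :: "nat \<times> nat"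
      have "norm (e (fst z) (snd z)) * (r * x) ^ (fst z + snd z)
          = norm (e (fst z) (snd z)) * r ^ (fst z + snd z) * (x ^ fst z * x ^ snd z)"
        by (simp add: power_mult_distrib power_add)
      also have "\<dots> \<le> C * (x ^ fst z * x ^ snd z)"
        using x by (intro mult_right_mono C) auto
      finally show "norm (e (fst z) (snd z)) * (r * x) ^ (fst z + snd z) \<le> C * (x ^ fst z * x ^ snd z)" .
    qed
    also have "\<dots> = C * ((\<Sum>z\<in>insert (0,0) F. x ^ fst z * x ^ snd z) - 1)"
      using F by (simp add: sum_distrib_left)
    also have "\<dots> \<le> C * (1 / (1 - x) * (1 / (1 - x)) - 1)"
      using C0 F x by (intro mult_left_mono diff_right_mono finite_sum_le_has_sum[OF g]) auto
    also have "\<dots> \<le> C * (8 * x)"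
    proof (rule mult_left_mono[OF _ C0])
      have "1 \<le> (1 + 8 * x) * ((1 - x) * (1 - x))"
      proof -
        have "(1 + 8 * x) * ((1 - x) * (1 - x)) - 1 = x * (6 - 15 * x + 8 * x * x)" by (simp add: algebra_simps)
        moreover have "x * (6 - 15 * x + 8 * x * x) \<ge> 0" using x by (intro mult_nonneg_nonneg) auto
        ultimately show ?thesis by linarith
      qed
      moreover have "0 < (1 - x) * (1 - x)" using x by simp
      ultimately have "1 / ((1 - x) * (1 - x)) \<le> 1 + 8 * x" by (simp only: pos_divide_le_eq)
      then show "1 / (1 - x) * (1 / (1 - x)) - 1 \<le> 8 * x" by simp
    qed
    also have "\<dots> \<le> 1" using x by (simp add: mult_ac)
    finally show ?thesis .
  qed
  moreover have "r * x \<le> r" "r * x > 0" using x r by auto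
  ultimately show ?thesis by (intro exI[of _ "r * x"]) auto
qed

text \<open>
  After division by \<open>f p\<close> the constant term is \<open>1\<close>, and the series with the reciprocal coefficients
  converges on a small polydisc by the two preceding bounds.
\<close>

lemma analytic2_at_reciprocal:
  fixes f :: "'k \<times> 'k \<Rightarrow> 'k::{real_normed_field,banach}"
  assumes "analytic2_at f p" "f p \<noteq> 0"
  obtains g where "analytic2_at g p" "\<forall>\<^sub>F z in nhds p. f z * g z = 1"
proof -
  have "analytic2_at (\<lambda>z. 1 / f p * f z) p"
    by (intro analytic2_at_mult analytic2_at_const assms)
  then obtain e r where e: "expansion e r (\<lambda>z. 1 / f p * f z) p" by (auto simp: analytic2_at_iff_expansion)
  have e1: "e 0 0 = 1" using expansion_center[OF e] assms by simp
  obtain C where C: "\<And>i j. norm (e i j) * r ^ (i + j) \<le> C" and r: "r > 0"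
    using e unfolding expansion_def by blast
  obtain \<rho> where \<rho>: "\<rho> > 0" "\<rho> \<le> r"
    and sm: "\<And>F. finite F \<Longrightarrow> (0, 0) \<notin> F \<Longrightarrow> (\<Sum>z\<in>F. norm (e (fst z) (snd z)) * \<rho> ^ (fst z + snd z)) \<le> 1"
    using expansion_tail_small[where e = e, OF C r] by blast
  define h where "h = (\<lambda>z. infsum (\<lambda>(i, j). recip_coeff e i j * (fst z - fst p) ^ i * (snd z - snd p) ^ j) UNIV)"
  have h: "expansion (recip_coeff e) \<rho> h p"
    by (rule expansionI[OF \<rho>(1) recip_coeff_bound[OF \<rho>(1) sm]]) (simp_all add: h_def)
  have e': "expansion e \<rho> (\<lambda>z. 1 / f p * f z) p" by (rule expansion_subradius[OF e \<rho>])
  have "f (fst p + s, snd p + t) * (1 / f p * h (fst p + s, snd p + t)) = 1"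
    if st: "norm s < \<rho>" "norm t < \<rho>" for s t
  proof -
    let ?S = "\<lambda>(m, n). (\<Sum>(i, j)\<in>{..m} \<times> {..n}. e i j * recip_coeff e (m - i) (n - j)) * s ^ m * t ^ n"
    have "(?S has_sum (1 / f p * f (fst p + s, snd p + t) * h (fst p + s, snd p + t))) UNIV"
      using expansion_mult[OF e' h] st by blast
    moreover have "(?S has_sum 1) UNIV"
      by (rule has_sum_finite_neutralI[of "{(0,0)}"]) (auto simp: recip_coeff_convolution[where e = e, OF e1] split: if_splits)
    ultimately have "1 / f p * f (fst p + s, snd p + t) * h (fst p + s, snd p + t) = 1"
      by (rule has_sum_unique)
    then show ?thesis by (simp add: mult_ac)
  qed
  then have "\<forall>\<^sub>F z in nhds p. f z * (1 / f p * h z) = 1"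
    by (rule nhds_prodI[OF \<rho>(1)])
  moreover have "analytic2_at h p" using h analytic2_at_iff_expansion by blast
  then have "analytic2_at (\<lambda>z. 1 / f p * h z) p"
    by (intro analytic2_at_mult analytic2_at_const)
  ultimately show ?thesis by (rule that[rotated])
qed

section \<open>Termwise differentiation\<close>

text \<open>
  Termwise differentiation of the slices. The radius is halved so that the factor \<open>i + 1\<close> is absorbed
  by \<open>2 ^ i\<close>.
\<close>

lemma expansion_partial_u:
  fixes f :: "real \<times> real \<Rightarrow> real"
  assumes c: "expansion c r f p"
  shows "expansion (\<lambda>i j. real (Suc i) * c (Suc i) j) (r / 2) (partial_u f) p"
    and "\<forall>\<^sub>F z in nhds p. ((\<lambda>s. f (s, snd z)) has_real_derivative partial_u f z) (at (fst z))"
proof -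
  obtain C where C: "\<And>i j. norm (c i j) * r ^ (i + j) \<le> C" and r: "r > 0"
    using c unfolding expansion_def by blast
  define d where "d = (\<lambda>i j. real (Suc i) * c (Suc i) j)"
  define g where "g = (\<lambda>z. infsum (\<lambda>(i, j). d i j * (fst z - fst p) ^ i * (snd z - snd p) ^ j) UNIV)"
  have C0: "C \<ge> 0" using C[of 0 0] by (simp add: order_trans[OF norm_ge_zero])
  have g: "expansion d (r / 2) g p"
  proof (rule expansionI[where C = "2 * C / r"])
    show "norm (d i j) * (r / 2) ^ (i + j) \<le> 2 * C / r" for i j
    proof -
      have "norm (d i j) * (r / 2) ^ (i + j) = real (Suc i) / 2 ^ (i + j) * (norm (c (Suc i) j) * r ^ (Suc i + j) / r)"
        using r by (simp add: d_def norm_mult abs_mult power_divide)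
      also have "\<dots> \<le> 2 * (C / r)"
      proof (rule mult_mono)
        have "Suc i < 2 ^ Suc i" by (rule less_exp)
        then have "real (Suc i) < real (2 ^ Suc i)" by (simp only: of_nat_less_iff)
        then have "real (Suc i) < 2 * 2 ^ i" by simp
        moreover have "(2::real) ^ i \<le> 2 ^ (i + j)" by (rule power_increasing) auto
        ultimately have "real (Suc i) \<le> 2 * 2 ^ (i + j)" by linarith
        then show "real (Suc i) / 2 ^ (i + j) \<le> 2" by (simp add: pos_divide_le_eq)
        show "norm (c (Suc i) j) * r ^ (Suc i + j) / r \<le> C / r"
          by (rule divide_right_mono[OF C]) (use r in simp)
      qed (use r in auto)
      finally show ?thesis by simp
    qed
  qed (use r in \<open>auto simp: g_def\<close>)
  have der: "((\<lambda>x. f (x, snd p + t)) has_real_derivative g (fst p + s, snd p + t)) (at (fst p + s))"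
    if s: "\<bar>s\<bar> < r / 2" and t: "\<bar>t\<bar> < r / 2" for s t
  proof -
    have t': "norm t < r" and t'': "norm t < r / 2" using t r by auto
    obtain a where a: "\<And>i. ((\<lambda>j. c i j * t ^ j) has_sum a i) UNIV"
      "\<And>s. norm s < r \<Longrightarrow> ((\<lambda>i. a i * s ^ i) has_sum f (fst p + s, snd p + t)) UNIV"
      using expansion_slice[OF c t'] by blast
    obtain b where b: "\<And>i. ((\<lambda>j. d i j * t ^ j) has_sum b i) UNIV"
      "\<And>s. norm s < r / 2 \<Longrightarrow> ((\<lambda>i. b i * s ^ i) has_sum g (fst p + s, snd p + t)) UNIV"
      using expansion_slice[OF g t''] by blast
    have "b i = real (Suc i) * a (Suc i)" for i
    proof (rule has_sum_unique[OF b(1)])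
      show "((\<lambda>j. d i j * t ^ j) has_sum real (Suc i) * a (Suc i)) UNIV"
        using has_sum_cmult_right[OF a(1)[of "Suc i"], of "real (Suc i)"] by (simp add: d_def mult_ac)
    qed
    then have ba: "b = diffs a" by (auto simp: diffs_def)
    have sums: "(\<lambda>i. a i * x ^ i) sums f (fst p + x, snd p + t)" if "norm x < r" for x
      by (rule has_sum_imp_sums[OF a(2)[OF that]])
    have "DERIV (\<lambda>x. \<Sum>n. a n * x^n) s :> (\<Sum>n. diffs a n * s^n)"
      by (rule termdiffs_strong'[of r]) (use sums s in \<open>auto simp: sums_iff\<close>)
    also have "(\<Sum>n. diffs a n * s^n) = g (fst p + s, snd p + t)"
      using has_sum_imp_sums[OF b(2)[of s]] s by (simp add: ba sums_iff)
    finally have dg: "DERIV (\<lambda>x. \<Sum>n. a n * x^n) s :> g (fst p + s, snd p + t)" .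
    have ev: "\<forall>\<^sub>F x in nhds s. (\<Sum>n. a n * x^n) = f (x + fst p, snd p + t)"
    proof (rule eventually_nhds_in_open[of "ball 0 r", THEN eventually_mono])
      show "s \<in> ball 0 r" using s r by auto
      show "(\<Sum>n. a n * x^n) = f (x + fst p, snd p + t)" if "x \<in> ball 0 r" for x
        using sums[of x] that by (simp add: sums_iff add.commute)
    qed auto
    have "DERIV (\<lambda>x. f (x + fst p, snd p + t)) s :> g (fst p + s, snd p + t)"
      by (rule iffD1[OF DERIV_cong_ev[OF refl ev refl] dg])
    then show ?thesis
      using DERIV_shift[of "\<lambda>x. f (x, snd p + t)" "g (fst p + s, snd p + t)" s "fst p"] by (simp add: add.commute)
  qed
  have eq: "partial_u f (fst p + s, snd p + t) = g (fst p + s, snd p + t)"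
    if "\<bar>s\<bar> < r / 2" "\<bar>t\<bar> < r / 2" for s t
    using der[OF that] unfolding partial_u_def
    by (simp add: has_real_derivative_iff_has_vector_derivative vector_derivative_at)
  show "expansion (\<lambda>i j. real (Suc i) * c (Suc i) j) (r / 2) (partial_u f) p"
    unfolding d_def[symmetric] by (rule expansion_cong[OF g]) (simp add: eq)
  show "\<forall>\<^sub>F z in nhds p. ((\<lambda>s. f (s, snd z)) has_real_derivative partial_u f z) (at (fst z))"
    by (rule nhds_prodI[of "r / 2"]) (use der r in \<open>auto simp: eq\<close>)
qed

text \<open>
  With \<open>partial_v_swap\<close>, this transfers statements about \<open>partial_u\<close> to \<open>partial_v\<close>.
\<close>

lemma expansion_swap:
  assumes "expansion c r f p"
  shows "expansion (\<lambda>i j. c j i) r (\<lambda>z. f (prod.swap z)) (prod.swap p)"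
  unfolding expansion_def
proof (intro conjI allI impI)
  obtain C where C: "\<And>i j. norm (c i j) * r ^ (i + j) \<le> C" and r: "r > 0"
    using assms unfolding expansion_def by blast
  show "r > 0" by fact
  show "\<exists>C. \<forall>i j. norm (c j i) * r ^ (i + j) \<le> C" using C by (metis add.commute)
  fix s t :: 'a assume st: "norm s < r \<and> norm t < r"
  have "((\<lambda>(i, j). c i j * t ^ i * s ^ j) has_sum f (fst p + t, snd p + s)) UNIV"
    using expansionD(2)[OF assms] st by blast
  then have "((\<lambda>(i, j). c i j * t ^ i * s ^ j) has_sum f (fst p + t, snd p + s)) (range prod.swap)"
    by simp
  then show "((\<lambda>(i, j). c j i * s ^ i * t ^ j) has_sum f (prod.swap (fst (prod.swap p) + s, snd (prod.swap p) + t))) UNIV"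
    by (subst (asm) has_sum_reindex) (auto simp: o_def case_prod_unfold mult_ac)
qed

lemma partial_v_swap: "partial_v f z = partial_u (\<lambda>z. f (prod.swap z)) (prod.swap z)"
  by (simp add: partial_u_def partial_v_def)

lemma filterlim_swap: "filterlim prod.swap (nhds (prod.swap p)) (nhds (p :: 'a::topological_space \<times> 'b::topological_space))"
proof -
  have "prod.swap = (\<lambda>z :: 'a \<times> 'b. (snd z, fst z))" by (auto simp: fun_eq_iff)
  then show ?thesis
    using tendsto_Pair[OF tendsto_snd[OF filterlim_ident] tendsto_fst[OF filterlim_ident], of p]
    by (cases p) simp
qed

lemma expansion_partial_v:
  fixes f :: "real \<times> real \<Rightarrow> real"
  assumes c: "expansion c r f p"
  shows "expansion (\<lambda>i j. real (Suc j) * c i (Suc j)) (r / 2) (partial_v f) p"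
    and "\<forall>\<^sub>F z in nhds p. ((\<lambda>t. f (fst z, t)) has_real_derivative partial_v f z) (at (snd z))"
proof -
  note s = expansion_swap[OF c]
  show "expansion (\<lambda>i j. real (Suc j) * c i (Suc j)) (r / 2) (partial_v f) p"
    using expansion_swap[OF expansion_partial_u(1)[OF s]] by (simp add: partial_v_swap[abs_def])
  have "\<forall>\<^sub>F z in nhds p. (\<lambda>z. ((\<lambda>s. f (prod.swap (s, snd z))) has_real_derivative
      partial_u (\<lambda>z. f (prod.swap z)) z) (at (fst z))) (prod.swap z)"
    by (rule eventually_compose_filterlim[OF expansion_partial_u(2)[OF s] filterlim_swap])
  then show "\<forall>\<^sub>F z in nhds p. ((\<lambda>t. f (fst z, t)) has_real_derivative partial_v f z) (at (snd z))"
    by (simp add: partial_v_swap)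
qed

lemma analytic2_at_partial_u:
  fixes f :: "real \<times> real \<Rightarrow> real"
  assumes "analytic2_at f p"
  shows "analytic2_at (partial_u f) p"
  using assms expansion_partial_u(1)[of _ _ f p] unfolding analytic2_at_iff_expansion by blast

lemma analytic2_at_partial_v:
  fixes f :: "real \<times> real \<Rightarrow> real"
  assumes "analytic2_at f p"
  shows "analytic2_at (partial_v f) p"
  using assms expansion_partial_v(1)[of _ _ f p] unfolding analytic2_at_iff_expansion by blast

lemma analytic2_at_has_partial_u:
  fixes f :: "real \<times> real \<Rightarrow> real"
  assumes "analytic2_at f p"
  shows "\<forall>\<^sub>F z in nhds p. ((\<lambda>s. f (s, snd z)) has_real_derivative partial_u f z) (at (fst z))"
  using assms expansion_partial_u(2)[of _ _ f p] unfolding analytic2_at_iff_expansion by blast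

lemma analytic2_at_has_partial_v:
  fixes f :: "real \<times> real \<Rightarrow> real"
  assumes "analytic2_at f p"
  shows "\<forall>\<^sub>F z in nhds p. ((\<lambda>t. f (fst z, t)) has_real_derivative partial_v f z) (at (snd z))"
  using assms expansion_partial_v(2)[of _ _ f p] unfolding analytic2_at_iff_expansion by blast

text \<open>
  Both mixed derivatives have the same coefficients.
\<close>

lemma analytic2_at_mixed_partials:
  fixes f :: "real \<times> real \<Rightarrow> real"
  assumes "analytic2_at f p"
  shows "\<forall>\<^sub>F z in nhds p. partial_u (partial_v f) z = partial_v (partial_u f) z"
proof -
  obtain c r where c: "expansion c r f p" using assms by (auto simp: analytic2_at_iff_expansion)
  note 1 = expansion_partial_v(1)[OF expansion_partial_u(1)[OF c]]
  note 2 = expansion_partial_u(1)[OF expansion_partial_v(1)[OF c]]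
  show ?thesis
    by (rule nhds_prodI[OF expansionD(1)[OF 1]], rule has_sum_unique[OF expansionD(2)[OF 2]])
       (use expansionD(2)[OF 1] in \<open>auto simp: mult_ac\<close>)
qed

section \<open>The ring of germs\<close>

lemma mem_germ_iff: "g \<in> germ Q f \<longleftrightarrow> (\<forall>\<^sub>F z in nhds Q. g z = f z)"
  by (simp add: germ_def)

lemma germ_self: "f \<in> germ Q f"
  by (simp add: mem_germ_iff)

lemma germ_eq_iff: "germ Q f = germ Q g \<longleftrightarrow> (\<forall>\<^sub>F z in nhds Q. f z = g z)"
proof
  assume "germ Q f = germ Q g"
  then show "\<forall>\<^sub>F z in nhds Q. f z = g z" using germ_self[of f Q] by (simp add: mem_germ_iff)
next
  assume eq: "\<forall>\<^sub>F z in nhds Q. f z = g z"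
  have "h \<in> germ Q f \<longleftrightarrow> h \<in> germ Q g" for h
    unfolding mem_germ_iff
  proof
    assume "\<forall>\<^sub>F z in nhds Q. h z = f z"
    with eq show "\<forall>\<^sub>F z in nhds Q. h z = g z" by eventually_elim simp
  next
    assume "\<forall>\<^sub>F z in nhds Q. h z = g z"
    with eq show "\<forall>\<^sub>F z in nhds Q. h z = f z" by eventually_elim simp
  qed
  then show "germ Q f = germ Q g" by blast
qed

text \<open>
  The ring operations are defined by choosing representatives; they can be computed on any
  representatives, since finitely many neighbourhoods can be intersected.
\<close>

lemma germ_mult: "germ Q f \<otimes>\<^bsub>germ_ring Q\<^esub> germ Q g = germ Q (\<lambda>z. f z * g z)"
proof -
  have "(\<exists>f'\<in>germ Q f. \<exists>g'\<in>germ Q g. \<forall>\<^sub>F z in nhds Q. h z = f' z * g' z)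
      \<longleftrightarrow> (\<forall>\<^sub>F z in nhds Q. h z = f z * g z)" (is "?L \<longleftrightarrow> ?R") for h
  proof
    assume ?L
    then obtain f' g' where "\<forall>\<^sub>F z in nhds Q. f' z = f z" "\<forall>\<^sub>F z in nhds Q. g' z = g z"
      "\<forall>\<^sub>F z in nhds Q. h z = f' z * g' z" by (auto simp: mem_germ_iff)
    then show ?R by eventually_elim simp
  qed (use germ_self in blast)
  then show ?thesis by (simp add: germ_ring_def germ_def[of Q "\<lambda>z. f z * g z"])
qed

lemma germ_add: "germ Q f \<oplus>\<^bsub>germ_ring Q\<^esub> germ Q g = germ Q (\<lambda>z. f z + g z)"
proof -
  have "(\<exists>f'\<in>germ Q f. \<exists>g'\<in>germ Q g. \<forall>\<^sub>F z in nhds Q. h z = f' z + g' z)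
      \<longleftrightarrow> (\<forall>\<^sub>F z in nhds Q. h z = f z + g z)" (is "?L \<longleftrightarrow> ?R") for h
  proof
    assume ?L
    then obtain f' g' where "\<forall>\<^sub>F z in nhds Q. f' z = f z" "\<forall>\<^sub>F z in nhds Q. g' z = g z"
      "\<forall>\<^sub>F z in nhds Q. h z = f' z + g' z" by (auto simp: mem_germ_iff)
    then show ?R by eventually_elim simp
  qed (use germ_self in blast)
  then show ?thesis by (simp add: germ_ring_def germ_def[of Q "\<lambda>z. f z + g z"])
qed

lemma germ_one: "\<one>\<^bsub>germ_ring Q\<^esub> = germ Q (\<lambda>_. 1)"
  and germ_zero: "\<zero>\<^bsub>germ_ring Q\<^esub> = germ Q (\<lambda>_. 0)"
  by (simp_all add: germ_ring_def)

lemma germ_in_carrier [simp]: "analytic2_at f Q \<Longrightarrow> germ Q f \<in> carrier (germ_ring Q)"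
  by (simp add: germ_ring_def)

lemma germ_carrierE:
  assumes "A \<in> carrier (germ_ring Q)"
  obtains f where "analytic2_at f Q" "A = germ Q f"
  using assms by (auto simp: germ_ring_def)

lemma germ_in_carrier_iff: "germ Q f \<in> carrier (germ_ring Q) \<longleftrightarrow> analytic2_at f Q"
proof
  assume "germ Q f \<in> carrier (germ_ring Q)"
  then obtain g where g: "analytic2_at g Q" "germ Q f = germ Q g" by (rule germ_carrierE)
  have "germ Q g = germ Q f" using g by simp
  then show "analytic2_at f Q" using analytic2_at_cong[OF g(1)] germ_eq_iff by blast
qed simp

lemmas germ_ops = germ_mult germ_add germ_one germ_zero germ_in_carrier_iff

lemma germ_ring_cring: "cring (germ_ring Q)"
proof (rule cringI)
  show "abelian_group (germ_ring Q)"
  proof (rule abelian_groupI)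
    fix A assume "A \<in> carrier (germ_ring Q)"
    then obtain f where f: "analytic2_at f Q" "A = germ Q f" by (rule germ_carrierE)
    have "germ Q (\<lambda>z. - f z) \<oplus>\<^bsub>germ_ring Q\<^esub> A = \<zero>\<^bsub>germ_ring Q\<^esub>"
      using f by (simp add: germ_ops)
    moreover have "germ Q (\<lambda>z. - f z) \<in> carrier (germ_ring Q)"
      using f by (simp add: analytic2_at_uminus)
    ultimately show "\<exists>B\<in>carrier (germ_ring Q). B \<oplus>\<^bsub>germ_ring Q\<^esub> A = \<zero>\<^bsub>germ_ring Q\<^esub>" by blast
  qed (auto elim!: germ_carrierE simp: germ_ops algebra_simps intro: analytic2_intros)
  show "comm_monoid (germ_ring Q)"
    by (rule comm_monoidI) (auto elim!: germ_carrierE simp: germ_ops algebra_simps intro: analytic2_intros)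
qed (auto elim!: germ_carrierE simp: germ_ops algebra_simps)

lemma germ_a_inv:
  assumes "analytic2_at f Q"
  shows "\<ominus>\<^bsub>germ_ring Q\<^esub> germ Q f = germ Q (\<lambda>z. - f z)"
proof -
  interpret cring "germ_ring Q" by (rule germ_ring_cring)
  show ?thesis
    by (rule minus_equality) (use assms in \<open>simp_all add: germ_ops analytic2_at_uminus\<close>)
qed

lemma (in cring) genideal_pair_iff:
  assumes a: "a \<in> carrier R" and b: "b \<in> carrier R"
  shows "f \<in> Idl {a, b} \<longleftrightarrow> (\<exists>x\<in>carrier R. \<exists>y\<in>carrier R. f = x \<otimes> a \<oplus> y \<otimes> b)"
proof -
  interpret I: ideal "Idl {a, b}" R by (rule genideal_ideal) (use a b in auto)
  let ?J = "set_add R (PIdl a) (PIdl b)"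
  have J: "f \<in> ?J \<longleftrightarrow> (\<exists>x\<in>carrier R. \<exists>y\<in>carrier R. f = x \<otimes> a \<oplus> y \<otimes> b)" for f
    by (auto simp: set_add_def' cgenideal_def)
  have "ideal ?J R" by (intro add_ideals cgenideal_ideal a b)
  moreover have "a \<in> ?J"
    unfolding J by (intro bexI[of _ \<one>] bexI[of _ \<zero>]) (use a b in auto)
  moreover have "b \<in> ?J"
    unfolding J by (intro bexI[of _ \<zero>] bexI[of _ \<one>]) (use a b in auto)
  ultimately have sub: "Idl {a, b} \<subseteq> ?J" by (intro genideal_minimal) auto
  have "a \<in> Idl {a, b}" "b \<in> Idl {a, b}" using genideal_self[of "{a, b}"] a b by auto
  then have "x \<otimes> a \<oplus> y \<otimes> b \<in> Idl {a, b}" if "x \<in> carrier R" "y \<in> carrier R" for x y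
    using that by (intro I.a_closed I.I_l_closed)
  then show ?thesis using sub J by blast
qed

lemma germ_in_genideal_iff:
  assumes "analytic2_at f Q" "analytic2_at h Q" "analytic2_at k Q"
  shows "germ Q f \<in> Idl\<^bsub>germ_ring Q\<^esub> {germ Q h, germ Q k} \<longleftrightarrow>
    (\<exists>\<alpha> \<beta>. analytic2_at \<alpha> Q \<and> analytic2_at \<beta> Q \<and> (\<forall>\<^sub>F z in nhds Q. f z = \<alpha> z * h z + \<beta> z * k z))"
proof -
  interpret cring "germ_ring Q" by (rule germ_ring_cring)
  have "germ Q f \<in> Idl\<^bsub>germ_ring Q\<^esub> {germ Q h, germ Q k} \<longleftrightarrow>
     (\<exists>x\<in>carrier (germ_ring Q). \<exists>y\<in>carrier (germ_ring Q).
        germ Q f = x \<otimes>\<^bsub>germ_ring Q\<^esub> germ Q h \<oplus>\<^bsub>germ_ring Q\<^esub> y \<otimes>\<^bsub>germ_ring Q\<^esub> germ Q k)"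
    by (rule genideal_pair_iff) (use assms in simp_all)
  also have "\<dots> \<longleftrightarrow> (\<exists>\<alpha> \<beta>. analytic2_at \<alpha> Q \<and> analytic2_at \<beta> Q \<and>
      germ Q f = germ Q \<alpha> \<otimes>\<^bsub>germ_ring Q\<^esub> germ Q h \<oplus>\<^bsub>germ_ring Q\<^esub> germ Q \<beta> \<otimes>\<^bsub>germ_ring Q\<^esub> germ Q k)"
    by (auto simp: germ_ring_def Bex_def)
  finally show ?thesis by (simp add: germ_mult germ_add germ_eq_iff)
qed

text \<open>
  The multiplicity depends only on the ideal that the two germs generate.
\<close>

lemma germ_multiplicity_eqI:
  assumes an: "analytic2_at h Q" "analytic2_at k Q" "analytic2_at h' Q" "analytic2_at k' Q"
    and "germ Q h \<in> Idl\<^bsub>germ_ring Q\<^esub> {germ Q h', germ Q k'}" "germ Q k \<in> Idl\<^bsub>germ_ring Q\<^esub> {germ Q h', germ Q k'}"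
    and "germ Q h' \<in> Idl\<^bsub>germ_ring Q\<^esub> {germ Q h, germ Q k}" "germ Q k' \<in> Idl\<^bsub>germ_ring Q\<^esub> {germ Q h, germ Q k}"
  shows "germ_multiplicity Q (germ Q h) (germ Q k) = germ_multiplicity Q (germ Q h') (germ Q k')"
proof -
  interpret cring "germ_ring Q" by (rule germ_ring_cring)
  have "Idl\<^bsub>germ_ring Q\<^esub> {germ Q h, germ Q k} = Idl\<^bsub>germ_ring Q\<^esub> {germ Q h', germ Q k'}"
    by (intro equalityI genideal_minimal genideal_ideal) (use assms in auto)
  then show ?thesis by (simp add: germ_multiplicity_def)
qed

section \<open>Ideals of colength one\<close>

lemma FactRing_zero: "\<zero>\<^bsub>R Quot I\<^esub> = I"
  by (simp add: FactRing_def)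

text \<open>
  Let \<open>I\<close> be an ideal of germs that vanish at \<open>Q\<close>. Then evaluation at \<open>Q\<close> is defined on the quotient,
  and the classes of the constants form a field over which its dimension is taken.
\<close>

locale vanishing_ideal =
  fixes Q :: "complex \<times> complex" and I
  assumes ideal_I: "ideal I (germ_ring Q)"
    and vanish: "\<And>f. analytic2_at f Q \<Longrightarrow> germ Q f \<in> I \<Longrightarrow> f Q = 0"
begin

abbreviation "R \<equiv> germ_ring Q"
abbreviation "A \<equiv> germ_ring Q Quot I"
abbreviation cls where "cls f \<equiv> I +>\<^bsub>R\<^esub> germ Q f"
abbreviation "C \<equiv> range (\<lambda>c. cls (\<lambda>_. c))"

interpretation R: cring R by (rule germ_ring_cring)
interpretation I: ideal I R by (rule ideal_I)
interpretation A: cring A by (rule I.quotient_is_cring[OF germ_ring_cring])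

lemma cls_hom: "ring_hom_ring R A ((+>\<^bsub>R\<^esub>) I)"
  by (rule I.rcos_ring_hom_ring)

interpretation h: ring_hom_ring R A "(+>\<^bsub>R\<^esub>) I" by (rule cls_hom)

lemma cls_add: "analytic2_at f Q \<Longrightarrow> analytic2_at g Q \<Longrightarrow> cls f \<oplus>\<^bsub>A\<^esub> cls g = cls (\<lambda>z. f z + g z)"
  using h.hom_add[of "germ Q f" "germ Q g"] by (simp add: germ_add)

lemma cls_mult: "analytic2_at f Q \<Longrightarrow> analytic2_at g Q \<Longrightarrow> cls f \<otimes>\<^bsub>A\<^esub> cls g = cls (\<lambda>z. f z * g z)"
  using h.hom_mult[of "germ Q f" "germ Q g"] by (simp add: germ_mult)

lemma cls_uminus: "analytic2_at f Q \<Longrightarrow> \<ominus>\<^bsub>A\<^esub> cls f = cls (\<lambda>z. - f z)"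
  using h.hom_a_inv[of "germ Q f"] by (simp add: germ_a_inv)

lemma cls_one: "\<one>\<^bsub>A\<^esub> = cls (\<lambda>_. 1)"
  using h.hom_one by (simp add: germ_one)

lemma cls_zero: "\<zero>\<^bsub>A\<^esub> = cls (\<lambda>_. 0)"
  using h.hom_zero by (simp add: germ_zero)

lemma cls_in_carrier: "analytic2_at f Q \<Longrightarrow> cls f \<in> carrier A"
  using h.hom_closed[of "germ Q f"] by simp

lemma cls_carrierE:
  assumes "x \<in> carrier A"
  obtains f where "analytic2_at f Q" "x = cls f"
proof -
  obtain y where y: "y \<in> carrier R" "x = I +>\<^bsub>R\<^esub> y"
    using assms unfolding FactRing_def A_RCOSETS_def' by auto
  obtain f where "analytic2_at f Q" "y = germ Q f" using y(1) by (rule germ_carrierE)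
  with y that show ?thesis by blast
qed

lemma cls_eq_zero_iff:
  assumes "analytic2_at f Q"
  shows "cls f = \<zero>\<^bsub>A\<^esub> \<longleftrightarrow> germ Q f \<in> I"
proof -
  show ?thesis
    unfolding FactRing_zero
    using R.a_rcos_zero[OF ideal_I, of "germ Q f"] I.rcos_const_imp_mem[OF germ_in_carrier[OF assms]]
    by blast
qed

lemma cls_eq_iff:
  assumes "analytic2_at f Q" "analytic2_at g Q"
  shows "cls f = cls g \<longleftrightarrow> germ Q (\<lambda>z. f z - g z) \<in> I"
proof -
  have "cls f = cls g \<longleftrightarrow> cls f \<oplus>\<^bsub>A\<^esub> \<ominus>\<^bsub>A\<^esub> cls g = \<zero>\<^bsub>A\<^esub>"
    using A.r_right_minus_eq[of "cls f" "cls g"] assms by (simp add: cls_in_carrier a_minus_def)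
  also have "cls f \<oplus>\<^bsub>A\<^esub> \<ominus>\<^bsub>A\<^esub> cls g = cls (\<lambda>z. f z - g z)"
    using assms by (simp add: cls_uminus cls_add analytic2_at_uminus)
  finally show ?thesis using assms by (simp add: cls_eq_zero_iff analytic2_at_diff)
qed

lemma const_cls_zero_iff: "cls (\<lambda>_. c) = \<zero>\<^bsub>A\<^esub> \<longleftrightarrow> c = 0"
proof
  assume "cls (\<lambda>_. c) = \<zero>\<^bsub>A\<^esub>"
  then show "c = 0" using vanish[OF analytic2_at_const] by (simp add: cls_eq_zero_iff analytic2_at_const)
qed (simp add: cls_zero)

lemma constants_subfield: "subfield C A"
proof (rule A.subfieldI)
  have ring: "subring C A"
    by (rule A.subringI)
       (auto simp: cls_in_carrier analytic2_at_const cls_one cls_uminus cls_mult cls_add)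
  show "subcring C A" by (rule A.subcringI'[OF ring])
  show "Units (A\<lparr>carrier := C\<rparr>) = C - {\<zero>\<^bsub>A\<^esub>}"
  proof (intro equalityI subsetI)
    fix x assume x: "x \<in> Units (A\<lparr>carrier := C\<rparr>)"
    have "x \<noteq> \<zero>\<^bsub>A\<^esub>"
    proof
      assume x0: "x = \<zero>\<^bsub>A\<^esub>"
      obtain y where y: "y \<in> C" "y \<otimes>\<^bsub>A\<^esub> x = \<one>\<^bsub>A\<^esub>" using x by (auto simp: Units_def)
      then have "y \<in> carrier A" by (auto simp: cls_in_carrier analytic2_at_const)
      then have "\<one>\<^bsub>A\<^esub> = \<zero>\<^bsub>A\<^esub>" using y x0 by simp
      then show False using const_cls_zero_iff[of 1] by (simp add: cls_one)
    qed
    then show "x \<in> C - {\<zero>\<^bsub>A\<^esub>}" using x by (auto simp: Units_def)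
  next
    fix x assume x: "x \<in> C - {\<zero>\<^bsub>A\<^esub>}"
    then obtain c where c: "x = cls (\<lambda>_. c)" "c \<noteq> 0" using const_cls_zero_iff by auto
    have "cls (\<lambda>_. inverse c) \<otimes>\<^bsub>A\<^esub> x = \<one>\<^bsub>A\<^esub>" "x \<otimes>\<^bsub>A\<^esub> cls (\<lambda>_. inverse c) = \<one>\<^bsub>A\<^esub>"
      using c by (simp_all add: cls_mult analytic2_at_const cls_one)
    then show "x \<in> Units (A\<lparr>carrier := C\<rparr>)" using x by (auto simp: Units_def)
  qed
qed

text \<open>
  If the quotient is spanned by the class of a single germ \<open>w\<close>, then every germ is a constant multiple
  of \<open>w\<close> modulo \<open>I\<close>. Applied to the constant \<open>1\<close> this shows \<open>w Q \<noteq> 0\<close>; applied to a germ \<open>f\<close> that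
  vanishes at \<open>Q\<close> it shows that the multiple is zero, that is, \<open>f\<close> lies in \<open>I\<close>. Conversely, if \<open>I\<close>
  contains all germs vanishing at \<open>Q\<close>, each germ is congruent to its value, so the quotient consists
  of constants.
\<close>

lemma dimension_one_iff:
  "A.dimension 1 C (carrier A) \<longleftrightarrow> (\<forall>f. analytic2_at f Q \<and> f Q = 0 \<longrightarrow> germ Q f \<in> I)"
proof
  assume dim: "A.dimension 1 C (carrier A)"
  then have dim': "A.dimension (Suc 0) C (carrier A)" by simp
  obtain v E where v: "v \<in> carrier A" "A.dimension 0 C E" "carrier A = A.line_extension C v E"
    using A.dimension_backwards[OF constants_subfield dim'] by blast
  have E: "E = {\<zero>\<^bsub>A\<^esub>}" using A.dimension_zero[OF constants_subfield v(2)] .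
  obtain w where w: "analytic2_at w Q" "v = cls w" using v(1) by (rule cls_carrierE)
  have rep: "\<exists>c. germ Q (\<lambda>z. f z - c * w z) \<in> I" if f: "analytic2_at f Q" for f
  proof -
    have "cls f \<in> A.line_extension C v E" using cls_in_carrier[OF f] v(3) by simp
    then obtain c where "cls f = cls (\<lambda>_. c) \<otimes>\<^bsub>A\<^esub> v \<oplus>\<^bsub>A\<^esub> \<zero>\<^bsub>A\<^esub>"
      unfolding A.line_extension_mem_iff E by auto
    also have "\<dots> = cls (\<lambda>z. c * w z)"
      using w by (simp add: cls_mult analytic2_at_const cls_in_carrier analytic2_at_mult)
    finally show ?thesis using cls_eq_iff f w by (blast intro: analytic2_intros)
  qed
  obtain c1 where c1: "germ Q (\<lambda>z. 1 - c1 * w z) \<in> I"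
    using rep[OF analytic2_at_const] by blast
  have "1 - c1 * w Q = 0"
    by (rule vanish[OF _ c1]) (intro analytic2_intros w)
  then have w0: "w Q \<noteq> 0" by auto
  show "\<forall>f. analytic2_at f Q \<and> f Q = 0 \<longrightarrow> germ Q f \<in> I"
  proof (intro allI impI)
    fix f assume f: "analytic2_at f Q \<and> f Q = 0"
    then obtain c where c: "germ Q (\<lambda>z. f z - c * w z) \<in> I" using rep by blast
    have "f Q - c * w Q = 0"
      by (rule vanish[OF _ c]) (use f w in \<open>intro analytic2_intros; simp\<close>)
    then have "c = 0" using f w0 by simp
    then show "germ Q f \<in> I" using c by simp
  qed
next
  assume max: "\<forall>f. analytic2_at f Q \<and> f Q = 0 \<longrightarrow> germ Q f \<in> I"
  have "cls f \<in> C" if f: "analytic2_at f Q" for f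
  proof -
    have "analytic2_at (\<lambda>z. f z - f Q) Q" by (intro analytic2_intros f)
    then have "germ Q (\<lambda>z. f z - f Q) \<in> I" using max by simp
    then have "cls f = cls (\<lambda>_. f Q)" using cls_eq_iff[OF f analytic2_at_const] by simp
    then show ?thesis by blast
  qed
  then have "carrier A = C"
    by (auto elim!: cls_carrierE simp: cls_in_carrier analytic2_at_const)
  then show "A.dimension 1 C (carrier A)"
    using A.dimension_one[OF constants_subfield] by simp
qed

lemma multiplicity_one_iff:
  "(if A.finite_dimension C (carrier A) then enat (A.dim C (carrier A)) else \<infinity>) = 1
     \<longleftrightarrow> (\<forall>f. analytic2_at f Q \<and> f Q = 0 \<longrightarrow> germ Q f \<in> I)"
proof -
  have "(A.finite_dimension C (carrier A) \<and> A.dim C (carrier A) = 1) \<longleftrightarrow> A.dimension 1 C (carrier A)"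
  proof
    assume "A.finite_dimension C (carrier A) \<and> A.dim C (carrier A) = 1"
    then show "A.dimension 1 C (carrier A)"
      using A.finite_dimensionE[OF constants_subfield, of "carrier A"] unfolding over_def by metis
  next
    assume "A.dimension 1 C (carrier A)"
    then show "A.finite_dimension C (carrier A) \<and> A.dim C (carrier A) = 1"
      using A.dimI[OF constants_subfield, of 1 "carrier A"] A.finite_dimensionI[of 1 C "carrier A"]
      unfolding over_def by blast
  qed
  then show ?thesis unfolding dimension_one_iff[symmetric] by (auto simp: one_enat_def)
qed

end

lemma germ_multiplicity_eq_1_iff:
  assumes h: "analytic2_at h Q" "h Q = 0" and k: "analytic2_at k Q" "k Q = 0"
  shows "germ_multiplicity Q (germ Q h) (germ Q k) = 1 \<longleftrightarrow>
    (\<forall>f. analytic2_at f Q \<and> f Q = 0 \<longrightarrow> germ Q f \<in> Idl\<^bsub>germ_ring Q\<^esub> {germ Q h, germ Q k})"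
proof -
  interpret R: cring "germ_ring Q" by (rule germ_ring_cring)
  interpret vanishing_ideal Q "Idl\<^bsub>germ_ring Q\<^esub> {germ Q h, germ Q k}"
  proof (rule vanishing_ideal.intro)
    show "ideal (Idl\<^bsub>germ_ring Q\<^esub> {germ Q h, germ Q k}) (germ_ring Q)"
      by (rule R.genideal_ideal) (use h k in simp)
    fix f assume f: "analytic2_at f Q" "germ Q f \<in> Idl\<^bsub>germ_ring Q\<^esub> {germ Q h, germ Q k}"
    then obtain \<alpha> \<beta> where "\<forall>\<^sub>F z in nhds Q. f z = \<alpha> z * h z + \<beta> z * k z"
      using germ_in_genideal_iff[OF f(1) h(1) k(1)] by blast
    from eventually_nhds_x_imp_x[OF this] show "f Q = 0" using h k by simp
  qed
  show ?thesis unfolding germ_multiplicity_def Let_def by (rule multiplicity_one_iff)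
qed

section \<open>Rules for partial derivatives\<close>

lemma partial_u_cong:
  assumes "\<forall>\<^sub>F z in nhds p. f z = g z"
  shows "partial_u f p = partial_u g p"
proof -
  have "((\<lambda>s. (s, snd p)) \<longlongrightarrow> p) (nhds (fst p))"
    using tendsto_Pair[OF filterlim_ident[of "nhds (fst p)"] tendsto_const[of "snd p"]] by simp
  from eventually_compose_filterlim[OF assms this]
  have "\<forall>\<^sub>F s in nhds (fst p). f (s, snd p) = g (s, snd p)" .
  then show ?thesis unfolding partial_u_def by (intro vector_derivative_cong_eq) auto
qed

lemma partial_v_cong:
  assumes "\<forall>\<^sub>F z in nhds p. f z = g z"
  shows "partial_v f p = partial_v g p"
proof -
  have "((\<lambda>s. (fst p, s)) \<longlongrightarrow> p) (nhds (snd p))"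
    using tendsto_Pair[OF tendsto_const[of "fst p"] filterlim_ident[of "nhds (snd p)"]] by simp
  from eventually_compose_filterlim[OF assms this]
  have "\<forall>\<^sub>F s in nhds (snd p). f (fst p, s) = g (fst p, s)" .
  then show ?thesis unfolding partial_v_def by (intro vector_derivative_cong_eq) auto
qed

lemma partial_u_eqI:
  "((\<lambda>s. f (s, snd p)) has_real_derivative D) (at (fst p)) \<Longrightarrow> partial_u f p = D"
  by (simp add: partial_u_def has_real_derivative_iff_has_vector_derivative vector_derivative_at)

lemma partial_v_eqI:
  "((\<lambda>t. f (fst p, t)) has_real_derivative D) (at (snd p)) \<Longrightarrow> partial_v f p = D"
  by (simp add: partial_v_def has_real_derivative_iff_has_vector_derivative vector_derivative_at)

lemma partial_const [simp]: "partial_u (\<lambda>_. k :: real) p = 0" "partial_v (\<lambda>_. k :: real) p = 0"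
  by (auto intro!: partial_u_eqI partial_v_eqI derivative_eq_intros)

lemma partial_fst [simp]: "partial_u fst p = (1 :: real)" "partial_v fst p = (0 :: real)"
  by (auto intro!: partial_u_eqI partial_v_eqI derivative_eq_intros)

lemma partial_snd [simp]: "partial_u snd p = (0 :: real)" "partial_v snd p = (1 :: real)"
  by (auto intro!: partial_u_eqI partial_v_eqI derivative_eq_intros)

context
  fixes f g :: "real \<times> real \<Rightarrow> real" and p :: "real \<times> real"
  assumes f: "analytic2_at f p" and g: "analytic2_at g p"
begin

private lemmas fu = eventually_nhds_x_imp_x[OF analytic2_at_has_partial_u[OF f]]
private lemmas fv = eventually_nhds_x_imp_x[OF analytic2_at_has_partial_v[OF f]]
private lemmas gu = eventually_nhds_x_imp_x[OF analytic2_at_has_partial_u[OF g]]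
private lemmas gv = eventually_nhds_x_imp_x[OF analytic2_at_has_partial_v[OF g]]

lemma partial_u_add: "partial_u (\<lambda>z. f z + g z) p = partial_u f p + partial_u g p"
  by (rule partial_u_eqI) (rule DERIV_add[OF fu gu])

lemma partial_v_add: "partial_v (\<lambda>z. f z + g z) p = partial_v f p + partial_v g p"
  by (rule partial_v_eqI) (rule DERIV_add[OF fv gv])

lemma partial_u_diff: "partial_u (\<lambda>z. f z - g z) p = partial_u f p - partial_u g p"
  by (rule partial_u_eqI) (rule DERIV_diff[OF fu gu])

lemma partial_v_diff: "partial_v (\<lambda>z. f z - g z) p = partial_v f p - partial_v g p"
  by (rule partial_v_eqI) (rule DERIV_diff[OF fv gv])

lemma partial_u_mult: "partial_u (\<lambda>z. f z * g z) p = partial_u f p * g p + f p * partial_u g p"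
  by (rule partial_u_eqI) (use DERIV_mult[OF fu gu] in \<open>simp add: mult.commute\<close>)

lemma partial_v_mult: "partial_v (\<lambda>z. f z * g z) p = partial_v f p * g p + f p * partial_v g p"
  by (rule partial_v_eqI) (use DERIV_mult[OF fv gv] in \<open>simp add: mult.commute\<close>)

end

lemma partial_u_uminus: "analytic2_at f p \<Longrightarrow> partial_u (\<lambda>z. - f z) p = - partial_u (f :: _ \<Rightarrow> real) p"
  using partial_u_mult[OF analytic2_at_const[of "-1"], of f] by simp

lemma partial_v_uminus: "analytic2_at f p \<Longrightarrow> partial_v (\<lambda>z. - f z) p = - partial_v (f :: _ \<Rightarrow> real) p"
  using partial_v_mult[OF analytic2_at_const[of "-1"], of f] by simp

lemma Hadamard_partials:
  fixes f :: "real \<times> real \<Rightarrow> real"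
  assumes "analytic2_at f q" "f q = 0"
  obtains A B where "analytic2_at A q" "analytic2_at B q" "A q = partial_u f q" "B q = partial_v f q"
    "\<forall>\<^sub>F z in nhds q. f z = (fst z - fst q) * A z + (snd z - snd q) * B z"
proof -
  obtain A B where AB: "analytic2_at A q" "analytic2_at B q"
    and eq: "\<forall>\<^sub>F z in nhds q. f z = f q + (fst z - fst q) * A z + (snd z - snd q) * B z"
    using analytic2_at_Hadamard[OF assms(1)] .
  have eq': "\<forall>\<^sub>F z in nhds q. f z = (fst z - fst q) * A z + (snd z - snd q) * B z"
    using eq assms(2) by simp
  have an: "analytic2_at (\<lambda>z. (fst z - fst q) * A z) q" "analytic2_at (\<lambda>z. (snd z - snd q) * B z) q"
    "analytic2_at (\<lambda>z. fst z - fst q) q" "analytic2_at (\<lambda>z. snd z - snd q) q"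
    by (intro analytic2_intros AB)+
  have "partial_u f q = A q"
    unfolding partial_u_cong[OF eq'] partial_u_add[OF an(1,2)] partial_u_mult[OF an(3) AB(1)]
      partial_u_mult[OF an(4) AB(2)] partial_u_diff[OF analytic2_at_fst analytic2_at_const]
      partial_u_diff[OF analytic2_at_snd analytic2_at_const] by simp
  moreover have "partial_v f q = B q"
    unfolding partial_v_cong[OF eq'] partial_v_add[OF an(1,2)] partial_v_mult[OF an(3) AB(1)]
      partial_v_mult[OF an(4) AB(2)] partial_v_diff[OF analytic2_at_fst analytic2_at_const]
      partial_v_diff[OF analytic2_at_snd analytic2_at_const] by simp
  ultimately show ?thesis using AB eq' by (intro that[of A B]) simp_all
qed

section \<open>Complexification\<close>

text \<open>
  The complexified germ is defined by a unique description. This relation between a real function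
  and a representing holomorphic function is compatible with the ring operations, which makes it
  possible to transfer identities.
\<close>

definition complexification :: "(real \<times> real \<Rightarrow> real) \<Rightarrow> real \<times> real \<Rightarrow> (complex \<times> complex \<Rightarrow> complex) \<Rightarrow> bool" where
  "complexification f q H \<longleftrightarrow> analytic2_at H (complex_point q) \<and>
     (\<forall>\<^sub>F p in nhds q. H (complex_point p) = complex_of_real (f p))"

lemma complexificationE:
  assumes "analytic2_at f q"
  obtains H where "complexification f q H"
  using complexification_exists[OF assms] unfolding complexification_def by blast

lemma complexification_analytic: "complexification f q H \<Longrightarrow> analytic2_at H (complex_point q)"
  by (simp add: complexification_def)

lemma complexification_at: "complexification f q H \<Longrightarrow> H (complex_point q) = complex_of_real (f q)"
  unfolding complexification_def by (blast dest: eventually_nhds_x_imp_x)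

text \<open>
  The difference vanishes at the real points near \<open>q\<close>, so the identity theorem applies.
\<close>

lemma complexification_eq:
  assumes "complexification f q H" "complexification g q K" "\<forall>\<^sub>F p in nhds q. f p = g p"
  shows "\<forall>\<^sub>F z in nhds (complex_point q). H z = K z"
proof -
  have "\<forall>\<^sub>F z in nhds (complex_point q). H z - K z = 0"
  proof (rule analytic2_at_identity)
    show "analytic2_at (\<lambda>z. H z - K z) (complex_point q)"
      using assms by (intro analytic2_at_diff complexification_analytic)
    have "\<forall>\<^sub>F p in nhds q. H (complex_point p) = complex_of_real (f p)"
      "\<forall>\<^sub>F p in nhds q. K (complex_point p) = complex_of_real (g p)"
      using assms by (simp_all add: complexification_def)
    with assms(3) show "\<forall>\<^sub>F p in nhds q. H (complex_point p) - K (complex_point p) = 0"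
      by eventually_elim simp
  qed
  then show ?thesis by simp
qed

lemma complexify_eq_germ:
  assumes H: "complexification f q H"
  shows "complexify f q = germ (complex_point q) H"
  unfolding complexify_def
proof (rule the_equality)
  show "germ (complex_point q) H \<in> carrier (germ_ring (complex_point q)) \<and>
    (\<exists>H\<in>germ (complex_point q) H. \<forall>\<^sub>F p in nhds q. H (complex_point p) = complex_of_real (f p))"
    using H germ_self[of H "complex_point q"] unfolding complexification_def by auto
  fix A assume A: "A \<in> carrier (germ_ring (complex_point q)) \<and>
     (\<exists>H\<in>A. \<forall>\<^sub>F p in nhds q. H (complex_point p) = complex_of_real (f p))"
  then obtain K where K: "K \<in> A" "\<forall>\<^sub>F p in nhds q. K (complex_point p) = complex_of_real (f p)"
    by blast
  obtain g where g: "analytic2_at g (complex_point q)" "A = germ (complex_point q) g"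
    using A germ_carrierE by blast
  have Kg: "\<forall>\<^sub>F z in nhds (complex_point q). K z = g z" using K g by (simp add: mem_germ_iff)
  then have gK: "\<forall>\<^sub>F z in nhds (complex_point q). g z = K z" by eventually_elim simp
  have "complexification f q K"
    unfolding complexification_def using K(2) analytic2_at_cong[OF g(1) gK] by blast
  from complexification_eq[OF this H] have "germ (complex_point q) K = germ (complex_point q) H"
    by (simp add: germ_eq_iff)
  moreover have "germ (complex_point q) K = germ (complex_point q) g" using Kg by (simp add: germ_eq_iff)
  ultimately show "A = germ (complex_point q) H" using g by simp
qed

lemma complexification_const: "complexification (\<lambda>_. k) q (\<lambda>_. complex_of_real k)"
  by (simp add: complexification_def analytic2_at_const)

lemma complexification_fst: "complexification fst q fst"
  by (simp add: complexification_def analytic2_at_fst complex_point_def)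

lemma complexification_snd: "complexification snd q snd"
  by (simp add: complexification_def analytic2_at_snd complex_point_def)

lemma complexification_add:
  assumes "complexification f q H" "complexification g q K"
  shows "complexification (\<lambda>z. f z + g z) q (\<lambda>z. H z + K z)"
  using assms unfolding complexification_def by (auto intro: analytic2_at_add elim: eventually_elim2)

lemma complexification_diff:
  assumes "complexification f q H" "complexification g q K"
  shows "complexification (\<lambda>z. f z - g z) q (\<lambda>z. H z - K z)"
  using assms unfolding complexification_def by (auto intro: analytic2_at_diff elim: eventually_elim2)

lemma complexification_mult:
  assumes "complexification f q H" "complexification g q K"
  shows "complexification (\<lambda>z. f z * g z) q (\<lambda>z. H z * K z)"
  using assms unfolding complexification_def by (auto intro: analytic2_at_mult elim: eventually_elim2)

lemmas complexification_intros = complexification_const complexification_fst complexification_snd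
  complexification_add complexification_diff complexification_mult

section \<open>Multiplicity\<close>

lemma multiplicity2_commute: "multiplicity2 f g q = multiplicity2 g f q"
  by (simp add: multiplicity2_def germ_multiplicity_def insert_commute)

text \<open>
  A linear relation can be solved for any germ whose coefficient is a unit.
\<close>

lemma germ_in_genideal_if_relation:
  assumes an: "analytic2_at f Q" "analytic2_at g Q" "analytic2_at h Q" "analytic2_at P Q" "analytic2_at S Q" "analytic2_at T Q"
    and rel: "\<forall>\<^sub>F z in nhds Q. P z * f z + S z * g z + T z * h z = 0" and P: "P Q \<noteq> 0"
  shows "germ Q f \<in> Idl\<^bsub>germ_ring Q\<^esub> {germ Q g, germ Q h}"
proof -
  obtain W where W: "analytic2_at W Q" "\<forall>\<^sub>F z in nhds Q. P z * W z = 1"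
    using analytic2_at_reciprocal[OF an(4) P] .
  have "\<forall>\<^sub>F z in nhds Q. f z = - (W z * S z) * g z + - (W z * T z) * h z"
    using rel W(2)
  proof eventually_elim
    fix z assume r: "P z * f z + S z * g z + T z * h z = 0" and w: "P z * W z = 1"
    have "f z = (P z * W z) * f z" using w by simp
    also have "\<dots> = W z * (P z * f z)" by simp
    also have "P z * f z = - (S z * g z + T z * h z)"
      by (rule minus_unique[symmetric]) (use r in \<open>simp add: ac_simps\<close>)
    finally show "f z = - (W z * S z) * g z + - (W z * T z) * h z" by (simp add: algebra_simps)
  qed
  moreover have "analytic2_at (\<lambda>z. - (W z * S z)) Q" "analytic2_at (\<lambda>z. - (W z * T z)) Q"
    using W an by (auto intro: analytic2_intros)
  ultimately show ?thesis using germ_in_genideal_iff[OF an(1,2,3)] by blast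
qed

text \<open>
  Two functions related by \<open>P f + S g + T h = 0\<close> with \<open>P\<close> and \<open>S\<close> units generate the same ideal
  together with \<open>h\<close>. This makes the three cases in the definition of the multiplicity of an umbilic
  point agree where they overlap.
\<close>

lemma multiplicity2_eq_if_relation:
  assumes an: "analytic2_at f q" "analytic2_at g q" "analytic2_at h q" "analytic2_at P q" "analytic2_at S q" "analytic2_at T q"
    and rel: "\<forall>\<^sub>F z in nhds q. P z * f z + S z * g z + T z * h z = 0" and P: "P q \<noteq> 0" and S: "S q \<noteq> 0"
  shows "multiplicity2 f h q = multiplicity2 g h q"
proof -
  let ?Q = "complex_point q"
  obtain f' where f': "complexification f q f'" using complexificationE[OF an(1)] .
  obtain g' where g': "complexification g q g'" using complexificationE[OF an(2)] .
  obtain h' where h': "complexification h q h'" using complexificationE[OF an(3)] .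
  obtain P' where P': "complexification P q P'" using complexificationE[OF an(4)] .
  obtain S' where S': "complexification S q S'" using complexificationE[OF an(5)] .
  obtain T' where T': "complexification T q T'" using complexificationE[OF an(6)] .
  note an' = f'[THEN complexification_analytic] g'[THEN complexification_analytic] h'[THEN complexification_analytic]
    P'[THEN complexification_analytic] S'[THEN complexification_analytic] T'[THEN complexification_analytic]
  have rel1: "\<forall>\<^sub>F z in nhds ?Q. P' z * f' z + S' z * g' z + T' z * h' z = complex_of_real 0"
    by (rule complexification_eq[OF _ complexification_const rel])
       (intro complexification_intros f' g' h' P' S' T')
  then have rel2: "\<forall>\<^sub>F z in nhds ?Q. S' z * g' z + P' z * f' z + T' z * h' z = complex_of_real 0"
    by eventually_elim (simp add: add.commute)
  have f: "germ ?Q f' \<in> Idl\<^bsub>germ_ring ?Q\<^esub> {germ ?Q g', germ ?Q h'}"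
    by (rule germ_in_genideal_if_relation[where P = P' and S = S' and T = T'])
       (use an' rel1 P complexification_at[OF P'] in simp_all)
  have g: "germ ?Q g' \<in> Idl\<^bsub>germ_ring ?Q\<^esub> {germ ?Q f', germ ?Q h'}"
    by (rule germ_in_genideal_if_relation[where P = S' and S = P' and T = T'])
       (use an' rel2 S complexification_at[OF S'] in simp_all)
  interpret cring "germ_ring ?Q" by (rule germ_ring_cring)
  have "germ_multiplicity ?Q (germ ?Q f') (germ ?Q h') = germ_multiplicity ?Q (germ ?Q g') (germ ?Q h')"
    by (rule germ_multiplicity_eqI) (use f g an' genideal_self[of "{germ ?Q f', germ ?Q h'}"]
      genideal_self[of "{germ ?Q g', germ ?Q h'}"] in simp_all)
  then show ?thesis
    by (simp add: multiplicity2_def complexify_eq_germ[OF f'] complexify_eq_germ[OF g'] complexify_eq_germ[OF h'])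
qed

text \<open>
  Restrict the relation to the two coordinate lines through \<open>Q\<close>, cancel the coordinate off \<open>Q\<close>, and
  use continuity.
\<close>

lemma linear_relation_at_center:
  fixes P S :: "'k \<times> 'k \<Rightarrow> 'k::{real_normed_field,banach,perfect_space}"
  assumes P: "analytic2_at P Q" and S: "analytic2_at S Q"
    and rel: "\<forall>\<^sub>F z in nhds Q. (fst z - fst Q) * P z + (snd z - snd Q) * S z = 0"
  shows "P Q = 0" "S Q = 0"
proof -
  have 1: "filterlim (\<lambda>s. (s, snd Q)) (nhds Q) (at (fst Q))"
    using tendsto_Pair[OF tendsto_ident_at[of "fst Q" UNIV] tendsto_const[of "snd Q"]] by simp
  have 2: "filterlim (\<lambda>s. (fst Q, s)) (nhds Q) (at (snd Q))"
    using tendsto_Pair[OF tendsto_const[of "fst Q"] tendsto_ident_at[of "snd Q" UNIV]] by simp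
  have "\<forall>\<^sub>F s in at (fst Q). s \<noteq> fst Q" "\<forall>\<^sub>F s in at (snd Q). s \<noteq> snd Q"
    by (simp_all add: eventually_at_filter)
  then have "\<forall>\<^sub>F s in at (fst Q). P (s, snd Q) = 0" "\<forall>\<^sub>F s in at (snd Q). S (fst Q, s) = 0"
    using eventually_compose_filterlim[OF rel 1] eventually_compose_filterlim[OF rel 2]
    by (auto elim: eventually_elim2)
  then have "((\<lambda>s. P (s, snd Q)) \<longlongrightarrow> 0) (at (fst Q))" "((\<lambda>s. S (fst Q, s)) \<longlongrightarrow> 0) (at (snd Q))"
    by (auto intro: tendsto_eventually)
  moreover have "((\<lambda>s. P (s, snd Q)) \<longlongrightarrow> P Q) (at (fst Q))" "((\<lambda>s. S (fst Q, s)) \<longlongrightarrow> S Q) (at (snd Q))"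
    by (rule filterlim_compose[OF analytic2_at_tendsto[OF P] 1], rule filterlim_compose[OF analytic2_at_tendsto[OF S] 2])
  ultimately show "P Q = 0" "S Q = 0"
    by (simp_all add: tendsto_unique[OF trivial_limit_at])
qed

text \<open>
  By Hadamard's lemma the pair \<open>(f, g)\<close> is a matrix of germs applied to the coordinates
  \<open>(z\<^sub>1 - Q\<^sub>1, z\<^sub>2 - Q\<^sub>2)\<close>, and the value of the matrix at the point is the Jacobian matrix. If its
  determinant does not vanish there, the determinant is a unit and Cramer's rule expresses the
  coordinates through \<open>f\<close> and \<open>g\<close>; hence the two functions generate the maximal ideal. If they
  generate it, then comparing first-order terms in the expressions of the two coordinates yields a
  left inverse of the Jacobian matrix.
\<close>

theorem multiplicity2_eq_1_iff_Jacobian: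
  assumes f: "analytic2_at f q" "f q = 0" and g: "analytic2_at g q" "g q = 0"
  shows "multiplicity2 f g q = 1 \<longleftrightarrow>
    partial_u f q * partial_v g q - partial_v f q * partial_u g q \<noteq> 0"
proof -
  define Q where "Q = complex_point q"
  have Q: "fst Q = complex_of_real (fst q)" "snd Q = complex_of_real (snd q)"
    by (simp_all add: Q_def complex_point_def)
  obtain A B where AB: "analytic2_at A q" "analytic2_at B q" "A q = partial_u f q" "B q = partial_v f q"
    and fAB: "\<forall>\<^sub>F z in nhds q. f z = (fst z - fst q) * A z + (snd z - snd q) * B z"
    using Hadamard_partials[OF f] .
  obtain A2 B2 where AB2: "analytic2_at A2 q" "analytic2_at B2 q" "A2 q = partial_u g q" "B2 q = partial_v g q"
    and gAB: "\<forall>\<^sub>F z in nhds q. g z = (fst z - fst q) * A2 z + (snd z - snd q) * B2 z"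
    using Hadamard_partials[OF g] .
  obtain H where H: "complexification f q H" using complexificationE[OF f(1)] .
  obtain K where K: "complexification g q K" using complexificationE[OF g(1)] .
  obtain HA where HA: "complexification A q HA" using complexificationE[OF AB(1)] .
  obtain HB where HB: "complexification B q HB" using complexificationE[OF AB(2)] .
  obtain KA where KA: "complexification A2 q KA" using complexificationE[OF AB2(1)] .
  obtain KB where KB: "complexification B2 q KB" using complexificationE[OF AB2(2)] .
  have Heq: "\<forall>\<^sub>F z in nhds Q. H z = (fst z - fst Q) * HA z + (snd z - snd Q) * HB z"
    unfolding Q unfolding Q_def by (rule complexification_eq[OF H _ fAB]) (intro complexification_intros HA HB)
  have Keq: "\<forall>\<^sub>F z in nhds Q. K z = (fst z - fst Q) * KA z + (snd z - snd Q) * KB z"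
    unfolding Q unfolding Q_def by (rule complexification_eq[OF K _ gAB]) (intro complexification_intros KA KB)
  have an: "analytic2_at H Q" "analytic2_at K Q" "analytic2_at HA Q" "analytic2_at HB Q"
    "analytic2_at KA Q" "analytic2_at KB Q"
    using H K HA HB KA KB by (auto simp: Q_def intro: complexification_analytic)
  have val: "H Q = 0" "K Q = 0" "HA Q = partial_u f q" "HB Q = partial_v f q" "KA Q = partial_u g q" "KB Q = partial_v g q"
    using complexification_at[OF H] complexification_at[OF K] complexification_at[OF HA] complexification_at[OF HB]
      complexification_at[OF KA] complexification_at[OF KB] f g AB AB2 by (auto simp: Q_def)
  define J where "J = (\<lambda>z. HA z * KB z - HB z * KA z)"
  have anJ: "analytic2_at J Q" unfolding J_def by (intro analytic2_intros an)
  have JQ: "J Q = complex_of_real (partial_u f q * partial_v g q - partial_v f q * partial_u g q)"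
    by (simp add: J_def val)
  let ?I = "Idl\<^bsub>germ_ring Q\<^esub> {germ Q H, germ Q K}"
  have "multiplicity2 f g q = 1 \<longleftrightarrow> (\<forall>f. analytic2_at f Q \<and> f Q = 0 \<longrightarrow> germ Q f \<in> ?I)"
    unfolding multiplicity2_def complexify_eq_germ[OF H] complexify_eq_germ[OF K] Q_def[symmetric]
    by (rule germ_multiplicity_eq_1_iff) (simp_all add: an val)
  also have "\<dots> \<longleftrightarrow> J Q \<noteq> 0"
  proof
    assume max: "\<forall>f. analytic2_at f Q \<and> f Q = 0 \<longrightarrow> germ Q f \<in> ?I"
    \<comment> \<open>An arbitrary linear form lies in the ideal; its coefficients are a combination of the rows
      of the Jacobian matrix.\<close>
    have ex: "\<exists>\<alpha> \<beta>. \<alpha> * HA Q + \<beta> * KA Q = k \<and> \<alpha> * HB Q + \<beta> * KB Q = l" for k l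
    proof -
      let ?f = "\<lambda>z. k * (fst z - fst Q) + l * (snd z - snd Q)"
      have anf: "analytic2_at ?f Q" by (intro analytic2_intros)
      with max have "germ Q ?f \<in> ?I" by simp
      then obtain \<alpha> \<beta> where ab: "analytic2_at \<alpha> Q" "analytic2_at \<beta> Q"
        "\<forall>\<^sub>F z in nhds Q. ?f z = \<alpha> z * H z + \<beta> z * K z"
        using germ_in_genideal_iff[OF anf an(1,2)] by blast
      have rel: "\<forall>\<^sub>F z in nhds Q. (fst z - fst Q) * (\<alpha> z * HA z + \<beta> z * KA z - k)
          + (snd z - snd Q) * (\<alpha> z * HB z + \<beta> z * KB z - l) = 0"
        using ab(3) Heq Keq
      proof eventually_elim
        fix z assume z: "?f z = \<alpha> z * H z + \<beta> z * K z"
          "H z = (fst z - fst Q) * HA z + (snd z - snd Q) * HB z"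
          "K z = (fst z - fst Q) * KA z + (snd z - snd Q) * KB z"
        have "(fst z - fst Q) * (\<alpha> z * HA z + \<beta> z * KA z - k) + (snd z - snd Q) * (\<alpha> z * HB z + \<beta> z * KB z - l)
            = (\<alpha> z * H z + \<beta> z * K z) - ?f z"
          unfolding z(2,3) by (simp add: algebra_simps)
        also have "\<dots> = 0" unfolding z(1) by simp
        finally show "(fst z - fst Q) * (\<alpha> z * HA z + \<beta> z * KA z - k)
            + (snd z - snd Q) * (\<alpha> z * HB z + \<beta> z * KB z - l) = 0" .
      qed
      have "analytic2_at (\<lambda>z. \<alpha> z * HA z + \<beta> z * KA z - k) Q" "analytic2_at (\<lambda>z. \<alpha> z * HB z + \<beta> z * KB z - l) Q"
        by (intro analytic2_intros an ab)+
      from linear_relation_at_center[OF this rel] show ?thesis by auto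
    qed
    obtain \<alpha> \<beta> where 1: "\<alpha> * HA Q + \<beta> * KA Q = 1" "\<alpha> * HB Q + \<beta> * KB Q = 0" using ex by blast
    obtain \<gamma> \<delta> where 2: "\<gamma> * HA Q + \<delta> * KA Q = 0" "\<gamma> * HB Q + \<delta> * KB Q = 1" using ex by blast
    have "(\<alpha> * \<delta> - \<beta> * \<gamma>) * J Q = (\<alpha> * HA Q + \<beta> * KA Q) * (\<gamma> * HB Q + \<delta> * KB Q)
        - (\<alpha> * HB Q + \<beta> * KB Q) * (\<gamma> * HA Q + \<delta> * KA Q)"
      unfolding J_def by (simp add: algebra_simps)
    also have "\<dots> = 1" unfolding 1 2 by simp
    finally show "J Q \<noteq> 0" by auto
  next
    assume J: "J Q \<noteq> 0"
    obtain W where W: "analytic2_at W Q" "\<forall>\<^sub>F z in nhds Q. J z * W z = 1"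
      using analytic2_at_reciprocal[OF anJ J] .
    show "\<forall>f. analytic2_at f Q \<and> f Q = 0 \<longrightarrow> germ Q f \<in> ?I"
    proof (intro allI impI)
      fix k assume k: "analytic2_at k Q \<and> k Q = 0"
      then obtain P S where PS: "analytic2_at P Q" "analytic2_at S Q"
        "\<forall>\<^sub>F z in nhds Q. k z = k Q + (fst z - fst Q) * P z + (snd z - snd Q) * S z"
        using analytic2_at_Hadamard[of k Q] by blast
      have "\<forall>\<^sub>F z in nhds Q. k z = W z * (P z * KB z - S z * KA z) * H z + W z * (S z * HA z - P z * HB z) * K z"
        using PS(3) W(2) Heq Keq
      proof eventually_elim
        fix z assume z: "k z = k Q + (fst z - fst Q) * P z + (snd z - snd Q) * S z" "J z * W z = 1"
          "H z = (fst z - fst Q) * HA z + (snd z - snd Q) * HB z"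
          "K z = (fst z - fst Q) * KA z + (snd z - snd Q) * KB z"
        have "W z * (P z * KB z - S z * KA z) * H z + W z * (S z * HA z - P z * HB z) * K z
           = (J z * W z) * ((fst z - fst Q) * P z + (snd z - snd Q) * S z)"
          unfolding z(3,4) J_def by (simp add: algebra_simps)
        also have "\<dots> = k z" unfolding z(2) using z(1) k by simp
        finally show "k z = W z * (P z * KB z - S z * KA z) * H z + W z * (S z * HA z - P z * HB z) * K z" by simp
      qed
      moreover have "analytic2_at (\<lambda>z. W z * (P z * KB z - S z * KA z)) Q" "analytic2_at (\<lambda>z. W z * (S z * HA z - P z * HB z)) Q"
        by (intro analytic2_intros W PS an)+
      moreover have "analytic2_at k Q" using k by simp
      ultimately show "germ Q k \<in> ?I" using germ_in_genideal_iff[OF _ an(1,2)] by blast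
    qed
  qed
  finally show ?thesis unfolding JQ of_real_eq_0_iff .
qed

section \<open>Vector-valued analytic functions\<close>

definition vanalytic :: "(real \<times> real \<Rightarrow> real^'n) \<Rightarrow> real \<times> real \<Rightarrow> bool" where
  "vanalytic f p \<longleftrightarrow> (\<forall>i. analytic2_at (\<lambda>z. f z $ i) p)"

lemma has_vector_derivative_vecI:
  fixes f :: "real \<Rightarrow> real^'n"
  assumes "\<And>i. ((\<lambda>s. f s $ i) has_real_derivative d $ i) (at s)"
  shows "(f has_vector_derivative d) (at s)"
  unfolding has_vector_derivative_def
  using assms
  by (subst has_derivative_componentwise_within)
     (auto simp: Basis_vec_def inner_axis has_field_derivative_def mult_commute_abs)

lemma partial_u_nth:
  fixes f :: "real \<times> real \<Rightarrow> real^'n"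
  assumes "vanalytic f p"
  shows "\<forall>\<^sub>F z in nhds p. \<forall>i. partial_u f z $ i = partial_u (\<lambda>z. f z $ i) z"
proof -
  have "\<forall>\<^sub>F z in nhds p. \<forall>i. ((\<lambda>s. f (s, snd z) $ i) has_real_derivative partial_u (\<lambda>z. f z $ i) z) (at (fst z))"
    using analytic2_at_has_partial_u assms unfolding vanalytic_def by (intro eventually_all_finite) blast
  then show ?thesis
  proof eventually_elim
    fix z assume "\<forall>i. ((\<lambda>s. f (s, snd z) $ i) has_real_derivative partial_u (\<lambda>z. f z $ i) z) (at (fst z))"
    then have "((\<lambda>s. f (s, snd z)) has_vector_derivative (\<chi> i. partial_u (\<lambda>z. f z $ i) z)) (at (fst z))"
      by (intro has_vector_derivative_vecI) simp
    then have "partial_u f z = (\<chi> i. partial_u (\<lambda>z. f z $ i) z)"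
      by (simp add: partial_u_def[of f] vector_derivative_at)
    then show "\<forall>i. partial_u f z $ i = partial_u (\<lambda>z. f z $ i) z" by simp
  qed
qed

lemma partial_v_nth:
  fixes f :: "real \<times> real \<Rightarrow> real^'n"
  assumes "vanalytic f p"
  shows "\<forall>\<^sub>F z in nhds p. \<forall>i. partial_v f z $ i = partial_v (\<lambda>z. f z $ i) z"
proof -
  have "\<forall>\<^sub>F z in nhds p. \<forall>i. ((\<lambda>t. f (fst z, t) $ i) has_real_derivative partial_v (\<lambda>z. f z $ i) z) (at (snd z))"
    using analytic2_at_has_partial_v assms unfolding vanalytic_def by (intro eventually_all_finite) blast
  then show ?thesis
  proof eventually_elim
    fix z assume "\<forall>i. ((\<lambda>t. f (fst z, t) $ i) has_real_derivative partial_v (\<lambda>z. f z $ i) z) (at (snd z))"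
    then have "((\<lambda>t. f (fst z, t)) has_vector_derivative (\<chi> i. partial_v (\<lambda>z. f z $ i) z)) (at (snd z))"
      by (intro has_vector_derivative_vecI) simp
    then have "partial_v f z = (\<chi> i. partial_v (\<lambda>z. f z $ i) z)"
      by (simp add: partial_v_def[of f] vector_derivative_at)
    then show "\<forall>i. partial_v f z $ i = partial_v (\<lambda>z. f z $ i) z" by simp
  qed
qed

lemma partial_u_nth_at: "vanalytic f p \<Longrightarrow> partial_u f p $ i = partial_u (\<lambda>z. f z $ i) p"
  using eventually_nhds_x_imp_x[OF partial_u_nth] by blast

lemma partial_v_nth_at: "vanalytic f p \<Longrightarrow> partial_v f p $ i = partial_v (\<lambda>z. f z $ i) p"
  using eventually_nhds_x_imp_x[OF partial_v_nth] by blast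

lemma vanalytic_partial_u:
  assumes "vanalytic f p" shows "vanalytic (partial_u f) p"
  unfolding vanalytic_def
proof
  fix i
  have "\<forall>\<^sub>F z in nhds p. partial_u (\<lambda>z. f z $ i) z = partial_u f z $ i"
    using partial_u_nth[OF assms] by eventually_elim simp
  moreover have "analytic2_at (\<lambda>z. f z $ i) p" using assms by (simp add: vanalytic_def)
  ultimately show "analytic2_at (\<lambda>z. partial_u f z $ i) p"
    by (rule analytic2_at_cong[OF analytic2_at_partial_u, rotated])
qed

lemma vanalytic_partial_v:
  assumes "vanalytic f p" shows "vanalytic (partial_v f) p"
  unfolding vanalytic_def
proof
  fix i
  have "\<forall>\<^sub>F z in nhds p. partial_v (\<lambda>z. f z $ i) z = partial_v f z $ i"
    using partial_v_nth[OF assms] by eventually_elim simp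
  moreover have "analytic2_at (\<lambda>z. f z $ i) p" using assms by (simp add: vanalytic_def)
  ultimately show "analytic2_at (\<lambda>z. partial_v f z $ i) p"
    by (rule analytic2_at_cong[OF analytic2_at_partial_v, rotated])
qed

lemma vec_mixed_partials:
  fixes f :: "real \<times> real \<Rightarrow> real^'n"
  assumes f: "vanalytic f p"
  shows "partial_u (partial_v f) p = partial_v (partial_u f) p"
proof (rule vec_eq_iff[THEN iffD2], rule allI)
  fix i
  have "partial_u (partial_v f) p $ i = partial_u (partial_v (\<lambda>z. f z $ i)) p"
    unfolding partial_u_nth_at[OF vanalytic_partial_v[OF f]]
    by (rule partial_u_cong) (use partial_v_nth[OF f] in \<open>eventually_elim, simp\<close>)
  also have "\<dots> = partial_v (partial_u (\<lambda>z. f z $ i)) p"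
    by (rule eventually_nhds_x_imp_x[OF analytic2_at_mixed_partials]) (use f in \<open>simp add: vanalytic_def\<close>)
  also have "\<dots> = partial_v (partial_u f) p $ i"
    unfolding partial_v_nth_at[OF vanalytic_partial_u[OF f]]
    by (rule partial_v_cong) (use partial_u_nth[OF f] in \<open>eventually_elim, simp\<close>)
  finally show "partial_u (partial_v f) p $ i = partial_v (partial_u f) p $ i" .
qed

lemma vanalytic_const: "vanalytic (\<lambda>_. e) p"
  by (simp add: vanalytic_def analytic2_at_const)

lemma vanalytic_add: "vanalytic f p \<Longrightarrow> vanalytic g p \<Longrightarrow> vanalytic (\<lambda>z. f z + g z) p"
  by (simp add: vanalytic_def analytic2_at_add)

lemma mink_cross_nth:
  "mink_cross u v $ 1 = u $ 2 * v $ 3 - u $ 3 * v $ 2"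
  "mink_cross u v $ 2 = u $ 3 * v $ 1 - u $ 1 * v $ 3"
  "mink_cross u v $ 3 = - (u $ 1 * v $ 2 - u $ 2 * v $ 1)"
  by (simp_all add: mink_cross_def)

lemma vanalytic_cross: "vanalytic f p \<Longrightarrow> vanalytic g p \<Longrightarrow> vanalytic (\<lambda>z. mink_cross (f z) (g z)) p"
  unfolding vanalytic_def forall_3 mink_cross_nth
  by (intro conjI analytic2_intros) auto

lemma analytic2_at_mink: "vanalytic f p \<Longrightarrow> vanalytic g p \<Longrightarrow> analytic2_at (\<lambda>z. mink (f z) (g z)) p"
  unfolding vanalytic_def mink_def by (intro analytic2_intros) auto

lemma partial_u_mink:
  assumes f: "vanalytic f p" and g: "vanalytic g p"
  shows "partial_u (\<lambda>z. mink (f z) (g z)) p = mink (partial_u f p) (g p) + mink (f p) (partial_u g p)"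
proof -
  have an: "analytic2_at (\<lambda>z. f z $ i) p" "analytic2_at (\<lambda>z. g z $ i) p" for i
    using f g by (auto simp: vanalytic_def)
  show ?thesis
    unfolding mink_def partial_u_nth_at[OF f] partial_u_nth_at[OF g]
    by (simp add: partial_u_add partial_u_diff partial_u_mult an analytic2_at_mult analytic2_at_add)
qed

lemma partial_v_mink:
  assumes f: "vanalytic f p" and g: "vanalytic g p"
  shows "partial_v (\<lambda>z. mink (f z) (g z)) p = mink (partial_v f p) (g p) + mink (f p) (partial_v g p)"
proof -
  have an: "analytic2_at (\<lambda>z. f z $ i) p" "analytic2_at (\<lambda>z. g z $ i) p" for i
    using f g by (auto simp: vanalytic_def)
  show ?thesis
    unfolding mink_def partial_v_nth_at[OF f] partial_v_nth_at[OF g]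
    by (simp add: partial_v_add partial_v_diff partial_v_mult an analytic2_at_mult analytic2_at_add)
qed

section \<open>Identities in Minkowski space\<close>

lemma mink_commute: "mink u v = mink v u"
  by (simp add: mink_def mult.commute)

lemma mink_cross_self: "mink (mink_cross u v) u = 0" "mink (mink_cross u v) v = 0"
  by (simp_all add: mink_def mink_cross_nth algebra_simps)

lemma mink_Lagrange: "mink (mink_cross u v) (mink_cross u v) = (mink u v)\<^sup>2 - mink u u * mink v v"
  by (simp add: mink_def mink_cross_nth power2_eq_square algebra_simps)

lemma mink_Lagrange_polarised:
  "mink (mink_cross u v) (mink_cross s t) = mink u t * mink v s - mink u s * mink v t"
  by (simp add: mink_def mink_cross_nth algebra_simps)

text \<open>
  Cramer's rule for \<open>N\<close> in the frame \<open>P, R, e\<close>, paired with \<open>w\<close>: the determinant of the frame is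
  \<open>\<langle>N, e\<rangle>\<close>, and the coefficient of \<open>e\<close> is \<open>det (P, R, N) = \<langle>N, N\<rangle>\<close>. So for
  independent \<open>P, R\<close> the vector \<open>N\<close> is tangent exactly where the metric degenerates.
\<close>

lemma mink_Cramer:
  fixes P R e w :: "real^3"
  defines "N \<equiv> mink_cross P R"
  shows "mink N e * mink N w =
     mink (mink_cross N R) e * mink P w + mink (mink_cross P N) e * mink R w + mink N N * mink e w"
  unfolding N_def by (simp add: mink_def mink_cross_nth algebra_simps)

text \<open>
  Here \<open>dP, dR\<close> stand for derivatives of \<open>P, R\<close> in some direction, and the second factor on the left
  is the derivative of \<open>\<langle>P, R\<rangle>\<^sup>2 - \<langle>P, P\<rangle>\<langle>R, R\<rangle> = \<langle>N, N\<rangle>\<close>, that is, \<open>2 \<langle>N, dN\<rangle>\<close>. Cramer's rule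
  replaces \<open>N\<close> by a tangent vector up to a multiple of \<open>\<langle>N, N\<rangle>\<close>, and \<open>\<langle>P, dN\<rangle> = - \<langle>N, dP\<rangle>\<close>
  because \<open>\<langle>P, N\<rangle> = 0\<close>. This relates the derivative of the metric discriminant to the second
  fundamental form.
\<close>

lemma metric_discriminant_derivative:
  fixes P R dP dR e :: "real^3"
  defines "N \<equiv> mink_cross P R" and "dN \<equiv> mink_cross dP R + mink_cross P dR"
  shows "mink N e * (2 * mink P R * (mink dP R + mink P dR)
       - (2 * mink P dP * mink R R + mink P P * (2 * mink R dR)))
     = - 2 * (mink (mink_cross N R) e * mink N dP + mink (mink_cross P N) e * mink N dR)
       + 2 * mink N N * mink e dN"
proof -
  have mink_add: "mink u (v + w) = mink u v + mink u w" for u v w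
    by (simp add: mink_def algebra_simps)
  have 1: "2 * mink P R * (mink dP R + mink P dR)
       - (2 * mink P dP * mink R R + mink P P * (2 * mink R dR)) = 2 * mink N dN"
    unfolding N_def dN_def mink_add mink_Lagrange_polarised
    by (simp add: mink_commute algebra_simps)
  have 2: "mink P dN = - mink N dP" "mink R dN = - mink N dR"
    unfolding N_def dN_def mink_add by (simp_all add: mink_def mink_cross_nth algebra_simps)
  have "mink N e * (2 * mink N dN) = 2 * (mink N e * mink N dN)" by simp
  also have "\<dots> = 2 * (mink (mink_cross N R) e * mink P dN + mink (mink_cross P N) e * mink R dN + mink N N * mink e dN)"
    using mink_Cramer[of P R e dN] unfolding N_def by simp
  finally show ?thesis unfolding 1 2 by (simp add: algebra_simps)
qed

lemma mink_cross_eq_0_imp_dependent: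
  assumes "mink_cross P R = 0"
  shows "\<exists>\<alpha> \<beta>. (\<alpha> \<noteq> 0 \<or> \<beta> \<noteq> 0) \<and> \<alpha> *\<^sub>R P + \<beta> *\<^sub>R R = 0"
proof (cases "P = 0")
  case True
  then show ?thesis by (intro exI[of _ 1] exI[of _ 0]) simp
next
  case False
  then obtain i where i: "P $ i \<noteq> 0" by (auto simp: vec_eq_iff)
  have "P $ 2 * R $ 3 = P $ 3 * R $ 2" "P $ 3 * R $ 1 = P $ 1 * R $ 3" "P $ 1 * R $ 2 = P $ 2 * R $ 1"
    using assms by (simp_all add: vec_eq_iff forall_3 mink_cross_nth)
  then have minors: "P $ j * R $ k = P $ k * R $ j" for j k
    using exhaust_3[of j] exhaust_3[of k] by auto
  have "R $ i *\<^sub>R P + (- P $ i) *\<^sub>R R = 0"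
    by (simp add: vec_eq_iff) (metis minors mult.commute)
  then show ?thesis using i by (intro exI[of _ "R $ i"] exI[of _ "- P $ i"]) simp
qed

section \<open>The Hessians at an umbilic point\<close>

text \<open>
  The vectors \<open>(a\<^sub>i, b\<^sub>i, c\<^sub>i)\<close> are both orthogonal to \<open>(E, -F, G)\<close>. Hence their minors
  \<open>X, Y, Z\<close>, taken from \<open>(b, c), (a, c), (a, b)\<close>, are \<open>\<tau> E, \<tau> F, \<tau> G\<close> for a common factor \<open>\<tau>\<close>, while
  \<open>h = 16 (Z X - Y\<^sup>2)\<close>. So
  \<open>h = 16 \<tau>\<^sup>2 (E G - F\<^sup>2)\<close>, and any of the three minors whose factor \<open>E, F\<close> or \<open>G\<close> is nonzero
  detects \<open>\<tau>\<close>. The number \<open>h\<close> is the Hessian determinant of \<open>b\<^sup>2 - 4 a c\<close> at a common zero of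
  \<open>a, b, c\<close> whose derivatives in the two directions are \<open>(a\<^sub>i, b\<^sub>i, c\<^sub>i)\<close>.
\<close>

lemma nondegenerate_umbilic_Hessian:
  fixes E F G a1 a2 b1 b2 c1 c2 :: real
  assumes 1: "E * a1 - F * b1 + G * c1 = 0" and 2: "E * a2 - F * b2 + G * c2 = 0" and nd: "F\<^sup>2 - E * G \<noteq> 0"
  defines "h \<equiv> (2 * b1\<^sup>2 - 8 * a1 * c1) * (2 * b2\<^sup>2 - 8 * a2 * c2) - (2 * b1 * b2 - 4 * (a1 * c2 + a2 * c1))\<^sup>2"
  shows "E \<noteq> 0 \<Longrightarrow> h \<noteq> 0 \<longleftrightarrow> b1 * c2 - b2 * c1 \<noteq> 0"
    and "F \<noteq> 0 \<Longrightarrow> h \<noteq> 0 \<longleftrightarrow> a1 * c2 - a2 * c1 \<noteq> 0"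
    and "G \<noteq> 0 \<Longrightarrow> h \<noteq> 0 \<longleftrightarrow> a1 * b2 - a2 * b1 \<noteq> 0"
proof -
  define X Y Z where XYZ: "X = b1 * c2 - b2 * c1" "Y = a1 * c2 - a2 * c1" "Z = a1 * b2 - a2 * b1"
  have h: "h = 16 * (Z * X - Y * Y)"
    unfolding h_def XYZ by (simp add: power2_eq_square algebra_simps)
  have Ea: "E * a1 = F * b1 - G * c1" "E * a2 = F * b2 - G * c2"
    and Fb: "F * b1 = E * a1 + G * c1" "F * b2 = E * a2 + G * c2"
    using 1 2 by simp_all
  have "E * Y = (E * a1) * c2 - (E * a2) * c1" unfolding XYZ by (simp add: algebra_simps)
  also have "\<dots> = F * X" unfolding Ea XYZ by (simp add: algebra_simps)
  finally have EY: "E * Y = F * X" .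
  have "E * Z = (E * a1) * b2 - (E * a2) * b1" unfolding XYZ by (simp add: algebra_simps)
  also have "\<dots> = G * X" unfolding Ea XYZ by (simp add: algebra_simps)
  finally have EZ: "E * Z = G * X" .
  have "F * Z = a1 * (F * b2) - a2 * (F * b1)" unfolding XYZ by (simp add: algebra_simps)
  also have "\<dots> = G * Y" unfolding Fb XYZ by (simp add: algebra_simps)
  finally have FZ: "F * Z = G * Y" .
  have "E\<^sup>2 * h = 16 * (E * (E * Z) * X - (E * Y) * (E * Y))"
    unfolding h by (simp add: power2_eq_square algebra_simps)
  also have "\<dots> = 16 * X\<^sup>2 * (E * G - F\<^sup>2)"
    unfolding EY EZ by (simp add: power2_eq_square algebra_simps)
  finally have e1: "E\<^sup>2 * h = 16 * X\<^sup>2 * (E * G - F\<^sup>2)" .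
  have "F\<^sup>2 * h = 16 * ((F * Z) * (F * X) - F * F * Y * Y)"
    unfolding h by (simp add: power2_eq_square algebra_simps)
  also have "\<dots> = 16 * Y\<^sup>2 * (E * G - F\<^sup>2)"
    unfolding FZ EY[symmetric] by (simp add: power2_eq_square algebra_simps)
  finally have e2: "F\<^sup>2 * h = 16 * Y\<^sup>2 * (E * G - F\<^sup>2)" .
  have "G\<^sup>2 * h = 16 * (G * Z * (G * X) - (G * Y) * (G * Y))"
    unfolding h by (simp add: power2_eq_square algebra_simps)
  also have "\<dots> = 16 * Z\<^sup>2 * (E * G - F\<^sup>2)"
    unfolding FZ[symmetric] EZ[symmetric] by (simp add: power2_eq_square algebra_simps)
  finally have e3: "G\<^sup>2 * h = 16 * Z\<^sup>2 * (E * G - F\<^sup>2)" .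
  have nd': "E * G - F\<^sup>2 \<noteq> 0" using nd by simp
  have *: "h \<noteq> 0 \<longleftrightarrow> T \<noteq> 0" if "S\<^sup>2 * h = 16 * T\<^sup>2 * (E * G - F\<^sup>2)" "S \<noteq> 0" for S T
  proof -
    from that(1) have "S\<^sup>2 * h = 0 \<longleftrightarrow> 16 * T\<^sup>2 * (E * G - F\<^sup>2) = 0" by simp
    then show ?thesis using that(2) nd' by simp
  qed
  show "E \<noteq> 0 \<Longrightarrow> h \<noteq> 0 \<longleftrightarrow> b1 * c2 - b2 * c1 \<noteq> 0" using *[OF e1] by (simp add: XYZ)
  show "F \<noteq> 0 \<Longrightarrow> h \<noteq> 0 \<longleftrightarrow> a1 * c2 - a2 * c1 \<noteq> 0" using *[OF e2] by (simp add: XYZ)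
  show "G \<noteq> 0 \<Longrightarrow> h \<noteq> 0 \<longleftrightarrow> a1 * b2 - a2 * b1 \<noteq> 0" using *[OF e3] by (simp add: XYZ)
qed

text \<open>
  The vector \<open>(A, B)\<close> spans the kernel of the degenerate form \<open>(E, F; F, G)\<close>, so it is proportional
  to \<open>(-F, E)\<close>. Up to nonzero factors the four second derivatives are therefore
  \<open>E M\<^sub>i - F L\<^sub>i\<close> and \<open>E N\<^sub>i - F M\<^sub>i\<close>, and the latter combine \<open>E N\<^sub>i - G L\<^sub>i\<close> with the former. The
  expressions on the right are the derivatives of \<open>b\<close> and \<open>c\<close>, see \<open>bde_partials_proportional\<close>.
\<close>

lemma lightlike_umbilic_Hessian:
  fixes E F G A B D :: real
  assumes E: "E \<noteq> 0" and D: "D \<noteq> 0" and AB: "A \<noteq> 0 \<or> B \<noteq> 0"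
    and deg: "F * F = E * G" and ker: "A * E + B * F = 0"
    and H: "D * uu = - 2 * (A * L1 + B * M1)" "D * uv = - 2 * (A * L2 + B * M2)"
      "D * vu = - 2 * (A * M1 + B * N1)" "D * vv = - 2 * (A * M2 + B * N2)"
  shows "uu * vv - uv * vu \<noteq> 0 \<longleftrightarrow>
     (E * N1 - G * L1) * (E * M2 - F * L2) - (E * N2 - G * L2) * (E * M1 - F * L1) \<noteq> 0"
proof -
  have "B \<noteq> 0" using ker E AB by auto
  define c1 c2 b1 b2 where cb: "c1 = E * M1 - F * L1" "c2 = E * M2 - F * L2"
    "b1 = E * N1 - G * L1" "b2 = E * N2 - G * L2"
  have AE: "A * E = - (B * F)" using ker by simp
  have *: "E * (- 2 * (A * L + B * M)) = - 2 * B * (E * M - F * L)" for L M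
  proof -
    have "E * (- 2 * (A * L + B * M)) = - 2 * ((A * E) * L + B * E * M)" by (simp add: algebra_simps)
    also have "\<dots> = - 2 * B * (E * M - F * L)" unfolding AE by (simp add: algebra_simps)
    finally show ?thesis .
  qed
  have 1: "E * (D * uu) = - 2 * B * c1" "E * (D * uv) = - 2 * B * c2"
    unfolding H cb by (rule *)+
  have 2: "E * (D * vu) = - 2 * B * (E * N1 - F * M1)" "E * (D * vv) = - 2 * B * (E * N2 - F * M2)"
    unfolding H by (rule *)+
  have 3: "E * (E * N - F * M) = E * (E * N - G * L) - F * (E * M - F * L)" for L M N
  proof -
    have "E * (E * N - G * L) - F * (E * M - F * L) = E * (E * N - F * M) + (F * F - E * G) * L"
      by (simp add: algebra_simps)
    then show ?thesis using deg by simp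
  qed
  have "E * E * E * D * D * (uu * vv - uv * vu)
      = E * ((E * (D * uu)) * (E * (D * vv)) - (E * (D * uv)) * (E * (D * vu)))"
    by (simp add: algebra_simps)
  also have "\<dots> = 4 * B * B * (c1 * (E * (E * N2 - F * M2)) - c2 * (E * (E * N1 - F * M1)))"
    unfolding 1 2 by (simp add: algebra_simps)
  also have "\<dots> = - 4 * E * B * B * (b1 * c2 - b2 * c1)"
    unfolding 3[of N2 M2 L2] 3[of N1 M1 L1] unfolding cb by (simp add: algebra_simps)
  finally have eq: "E * E * E * D * D * (uu * vv - uv * vu) = - 4 * E * B * B * (b1 * c2 - b2 * c1)" .
  have "E * E * E * D * D * (uu * vv - uv * vu) = 0 \<longleftrightarrow> - 4 * E * B * B * (b1 * c2 - b2 * c1) = 0"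
    unfolding eq ..
  then have "uu * vv - uv * vu = 0 \<longleftrightarrow> b1 * c2 - b2 * c1 = 0"
    using E D \<open>B \<noteq> 0\<close> by simp
  then show ?thesis unfolding cb by simp
qed

section \<open>Differentiating along either coordinate\<close>

text \<open>
  Second derivatives in two independent directions occur below. Quantifying over the two coordinate
  derivations avoids four copies of each computation.
\<close>

definition coordinate_partial :: "((real \<times> real \<Rightarrow> real) \<Rightarrow> real \<times> real \<Rightarrow> real) \<Rightarrow> bool" where
  "coordinate_partial d \<longleftrightarrow> d = partial_u \<or> d = partial_v"

lemma coordinate_partial_uv [simp]: "coordinate_partial partial_u" "coordinate_partial partial_v"
  by (simp_all add: coordinate_partial_def)

context
  fixes d assumes d: "coordinate_partial d"
begin

lemma partial_cong: "\<forall>\<^sub>F z in nhds p. f z = g z \<Longrightarrow> d f p = d g p"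
  using d partial_u_cong partial_v_cong unfolding coordinate_partial_def by blast

lemma analytic2_at_partial: "analytic2_at f p \<Longrightarrow> analytic2_at (d f) p"
  using d analytic2_at_partial_u analytic2_at_partial_v unfolding coordinate_partial_def by blast

lemma partial_constant: "d (\<lambda>_. k) p = 0"
  using d unfolding coordinate_partial_def by auto

lemma partial_add: "analytic2_at f p \<Longrightarrow> analytic2_at g p \<Longrightarrow> d (\<lambda>z. f z + g z) p = d f p + d g p"
  using d by (auto simp: coordinate_partial_def partial_u_add partial_v_add)

lemma partial_diff: "analytic2_at f p \<Longrightarrow> analytic2_at g p \<Longrightarrow> d (\<lambda>z. f z - g z) p = d f p - d g p"
  using d by (auto simp: coordinate_partial_def partial_u_diff partial_v_diff)

lemma partial_mult: "analytic2_at f p \<Longrightarrow> analytic2_at g p \<Longrightarrow> d (\<lambda>z. f z * g z) p = d f p * g p + f p * d g p"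
  using d by (auto simp: coordinate_partial_def partial_u_mult partial_v_mult)

lemma partial_uminus: "analytic2_at f p \<Longrightarrow> d (\<lambda>z. - f z) p = - d f p"
  using d by (auto simp: coordinate_partial_def partial_u_uminus partial_v_uminus)

lemmas partial_rules = partial_constant partial_uminus partial_add partial_diff partial_mult

end

lemma morse_singularity_iff:
  "morse_singularity f q \<longleftrightarrow> partial_u f q = 0 \<and> partial_v f q = 0 \<and>
     partial_u (partial_u f) q * partial_v (partial_v f) q
       - partial_v (partial_u f) q * partial_u (partial_v f) q \<noteq> 0"
  by (simp add: morse_singularity_def det_2)

section \<open>The fundamental forms of an analytic patch\<close>

context
  fixes x :: "real \<times> real \<Rightarrow> real^3" and z :: "real \<times> real"
  assumes x: "vanalytic x z"
begin

lemmas vanalytic_derivatives =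
  vanalytic_partial_u[OF x] vanalytic_partial_v[OF x]
  vanalytic_partial_u[OF vanalytic_partial_u[OF x]] vanalytic_partial_v[OF vanalytic_partial_u[OF x]]
  vanalytic_partial_u[OF vanalytic_partial_v[OF x]] vanalytic_partial_v[OF vanalytic_partial_v[OF x]]

lemma fundamental_forms_analytic:
  "analytic2_at (coeff_E x) z" "analytic2_at (coeff_F x) z" "analytic2_at (coeff_G x) z"
  "analytic2_at (coeff_l x) z" "analytic2_at (coeff_m x) z" "analytic2_at (coeff_n x) z"
  unfolding coeff_E_def[abs_def] coeff_F_def[abs_def] coeff_G_def[abs_def]
    coeff_l_def[abs_def] coeff_m_def[abs_def] coeff_n_def[abs_def]
  by (intro analytic2_at_mink vanalytic_cross vanalytic_derivatives)+

lemma bde_analytic: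
  "analytic2_at (bde_a x) z" "analytic2_at (bde_b x) z" "analytic2_at (bde_c x) z"
  unfolding bde_a_def[abs_def] bde_b_def[abs_def] bde_c_def[abs_def]
  by (intro analytic2_intros fundamental_forms_analytic)+

lemma LD_fun_analytic: "analytic2_at (LD_fun x) z"
  unfolding LD_fun_def[abs_def] by (intro analytic2_intros fundamental_forms_analytic)

end

text \<open>
  The triple \<open>(a, -b, c)\<close> is the Euclidean cross product of \<open>(E, F, G)\<close> and
  \<open>(l, m, n)\<close>.
\<close>

lemma bde_relation: "coeff_E x z * bde_a x z - coeff_F x z * bde_b x z + coeff_G x z * bde_c x z = 0"
  by (simp add: bde_a_def bde_b_def bde_c_def algebra_simps)

text \<open>
  By \<open>bde_relation\<close> any two of the three pairs generate the same ideal if both of the corresponding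
  coefficients \<open>E, F, G\<close> are nonzero. So the conditions in the definition are consistent and determine
  a number.
\<close>

lemma umbilic_multiplicity_eq:
  assumes x: "vanalytic x q"
  shows "coeff_E x q \<noteq> 0 \<Longrightarrow> umbilic_multiplicity x q = multiplicity2 (bde_b x) (bde_c x) q"
    and "coeff_F x q \<noteq> 0 \<Longrightarrow> umbilic_multiplicity x q = multiplicity2 (bde_a x) (bde_c x) q"
    and "coeff_G x q \<noteq> 0 \<Longrightarrow> umbilic_multiplicity x q = multiplicity2 (bde_a x) (bde_b x) q"
proof -
  note an = fundamental_forms_analytic[OF x] bde_analytic[OF x]
  have mF: "analytic2_at (\<lambda>z. - coeff_F x z) q" by (intro analytic2_intros an)
  have EF: "multiplicity2 (bde_a x) (bde_c x) q = multiplicity2 (bde_b x) (bde_c x) q"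
    if "coeff_E x q \<noteq> 0" "coeff_F x q \<noteq> 0"
    by (rule multiplicity2_eq_if_relation[OF an(7,8,9) an(1) mF an(3)])
       (use that bde_relation[of x] in \<open>simp_all add: algebra_simps\<close>)
  have EG: "multiplicity2 (bde_a x) (bde_b x) q = multiplicity2 (bde_c x) (bde_b x) q"
    if "coeff_E x q \<noteq> 0" "coeff_G x q \<noteq> 0"
    by (rule multiplicity2_eq_if_relation[OF an(7,9,8) an(1,3) mF])
       (use that bde_relation[of x] in \<open>simp_all add: algebra_simps\<close>)
  have FG: "multiplicity2 (bde_b x) (bde_a x) q = multiplicity2 (bde_c x) (bde_a x) q"
    if "coeff_F x q \<noteq> 0" "coeff_G x q \<noteq> 0"
    by (rule multiplicity2_eq_if_relation[OF an(8,9,7) mF an(3,1)])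
       (use that bde_relation[of x] in \<open>simp_all add: algebra_simps\<close>)
  note comm = multiplicity2_commute[of "bde_c x"] multiplicity2_commute[of "bde_b x" "bde_a x"]
  show "coeff_E x q \<noteq> 0 \<Longrightarrow> umbilic_multiplicity x q = multiplicity2 (bde_b x) (bde_c x) q"
    unfolding umbilic_multiplicity_def by (rule the_equality) (use EF EG FG comm in auto)
  show "coeff_F x q \<noteq> 0 \<Longrightarrow> umbilic_multiplicity x q = multiplicity2 (bde_a x) (bde_c x) q"
    unfolding umbilic_multiplicity_def by (rule the_equality) (use EF EG FG comm in auto)
  show "coeff_G x q \<noteq> 0 \<Longrightarrow> umbilic_multiplicity x q = multiplicity2 (bde_a x) (bde_b x) q"
    unfolding umbilic_multiplicity_def by (rule the_equality) (use EF EG FG comm in auto)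
qed

lemma umbilic_multiplicity_eq_1_iff:
  assumes x: "vanalytic x q" and um: "umbilic x q"
  shows "coeff_E x q \<noteq> 0 \<Longrightarrow> umbilic_multiplicity x q = 1 \<longleftrightarrow>
      partial_u (bde_b x) q * partial_v (bde_c x) q - partial_v (bde_b x) q * partial_u (bde_c x) q \<noteq> 0"
    and "coeff_F x q \<noteq> 0 \<Longrightarrow> umbilic_multiplicity x q = 1 \<longleftrightarrow>
      partial_u (bde_a x) q * partial_v (bde_c x) q - partial_v (bde_a x) q * partial_u (bde_c x) q \<noteq> 0"
    and "coeff_G x q \<noteq> 0 \<Longrightarrow> umbilic_multiplicity x q = 1 \<longleftrightarrow>
      partial_u (bde_a x) q * partial_v (bde_b x) q - partial_v (bde_a x) q * partial_u (bde_b x) q \<noteq> 0"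
proof -
  have 0: "bde_a x q = 0" "bde_b x q = 0" "bde_c x q = 0" using um by (simp_all add: umbilic_def)
  note an = bde_analytic[OF x]
  note iff = multiplicity2_eq_1_iff_Jacobian
  show "coeff_E x q \<noteq> 0 \<Longrightarrow> umbilic_multiplicity x q = 1 \<longleftrightarrow>
      partial_u (bde_b x) q * partial_v (bde_c x) q - partial_v (bde_b x) q * partial_u (bde_c x) q \<noteq> 0"
    by (subst umbilic_multiplicity_eq(1)[OF x], assumption, rule iff[OF an(2) 0(2) an(3) 0(3)])
  show "coeff_F x q \<noteq> 0 \<Longrightarrow> umbilic_multiplicity x q = 1 \<longleftrightarrow>
      partial_u (bde_a x) q * partial_v (bde_c x) q - partial_v (bde_a x) q * partial_u (bde_c x) q \<noteq> 0"
    by (subst umbilic_multiplicity_eq(2)[OF x], assumption, rule iff[OF an(1) 0(1) an(3) 0(3)])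
  show "coeff_G x q \<noteq> 0 \<Longrightarrow> umbilic_multiplicity x q = 1 \<longleftrightarrow>
      partial_u (bde_a x) q * partial_v (bde_b x) q - partial_v (bde_a x) q * partial_u (bde_b x) q \<noteq> 0"
    by (subst umbilic_multiplicity_eq(3)[OF x], assumption, rule iff[OF an(1) 0(1) an(2) 0(2)])
qed

section \<open>Spacelike and timelike umbilic points\<close>

lemma discriminant_partial:
  assumes d: "coordinate_partial d" and x: "vanalytic x z"
  shows "d (discriminant_fun x) z =
    2 * bde_b x z * d (bde_b x) z - 4 * (d (bde_a x) z * bde_c x z + bde_a x z * d (bde_c x) z)"
proof -
  note an = bde_analytic[OF x]
  have "discriminant_fun x = (\<lambda>z. bde_b x z * bde_b x z - 4 * (bde_a x z * bde_c x z))"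
    by (simp add: fun_eq_iff discriminant_fun_def power2_eq_square)
  then show ?thesis
    by (simp add: partial_rules[OF d] an analytic2_at_mult analytic2_at_const)
qed

text \<open>
  All terms that contain an undifferentiated factor vanish at an umbilic point.
\<close>

lemma discriminant_second_partial:
  assumes d: "coordinate_partial d" and d': "coordinate_partial d'"
    and x: "\<forall>\<^sub>F z in nhds q. vanalytic x z" and um: "umbilic x q"
  shows "d' (d (discriminant_fun x)) q = 2 * d' (bde_b x) q * d (bde_b x) q
     - 4 * (d (bde_a x) q * d' (bde_c x) q + d' (bde_a x) q * d (bde_c x) q)"
proof -
  note an = bde_analytic[OF eventually_nhds_x_imp_x[OF x]]
  have "\<forall>\<^sub>F z in nhds q. d (discriminant_fun x) z =
    2 * (bde_b x z * d (bde_b x) z) - 4 * (d (bde_a x) z * bde_c x z + bde_a x z * d (bde_c x) z)"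
    using x by eventually_elim (simp add: discriminant_partial[OF d])
  from partial_cong[OF d' this] show ?thesis
    using um by (simp add: umbilic_def partial_rules[OF d'] an analytic2_at_partial[OF d]
      analytic2_at_mult analytic2_at_add analytic2_at_const)
qed

lemma bde_relation_partial:
  assumes d: "coordinate_partial d" and x: "vanalytic x q" and um: "umbilic x q"
  shows "coeff_E x q * d (bde_a x) q - coeff_F x q * d (bde_b x) q + coeff_G x q * d (bde_c x) q = 0"
proof -
  note an = bde_analytic[OF x] fundamental_forms_analytic[OF x]
  have "d (\<lambda>z. coeff_E x z * bde_a x z - coeff_F x z * bde_b x z + coeff_G x z * bde_c x z) q = 0"
    by (simp add: bde_relation partial_constant[OF d])
  then show ?thesis
    using um by (simp add: umbilic_def partial_rules[OF d] an analytic2_at_mult analytic2_at_diff)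
qed

text \<open>
  The differentiated relation \<open>bde_relation_partial\<close> is the hypothesis of the algebraic lemma
  \<open>nondegenerate_umbilic_Hessian\<close>. One of \<open>E, F\<close> is nonzero since \<open>F\<^sup>2 - E G\<close> is.
\<close>

theorem nondegenerate_umbilic_multiplicity:
  assumes x: "\<forall>\<^sub>F z in nhds q. vanalytic x z" and um: "umbilic x q" and nd: "LD_fun x q \<noteq> 0"
  shows "umbilic_multiplicity x q = 1 \<longleftrightarrow> morse_singularity (discriminant_fun x) q"
proof -
  note xq = eventually_nhds_x_imp_x[OF x]
  define h where "h = (2 * (partial_u (bde_b x) q)\<^sup>2 - 8 * partial_u (bde_a x) q * partial_u (bde_c x) q)
     * (2 * (partial_v (bde_b x) q)\<^sup>2 - 8 * partial_v (bde_a x) q * partial_v (bde_c x) q)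
     - (2 * partial_u (bde_b x) q * partial_v (bde_b x) q
        - 4 * (partial_u (bde_a x) q * partial_v (bde_c x) q + partial_v (bde_a x) q * partial_u (bde_c x) q))\<^sup>2"
  have grad: "partial_u (discriminant_fun x) q = 0" "partial_v (discriminant_fun x) q = 0"
    using um by (simp_all add: discriminant_partial xq umbilic_def)
  have "morse_singularity (discriminant_fun x) q \<longleftrightarrow> h \<noteq> 0"
    unfolding morse_singularity_iff grad h_def
    by (simp add: discriminant_second_partial[OF _ _ x um] power2_eq_square algebra_simps)
  moreover have "(coeff_F x q)\<^sup>2 - coeff_E x q * coeff_G x q \<noteq> 0" using nd by (simp add: LD_fun_def)
  note H = nondegenerate_umbilic_Hessian[OF bde_relation_partial[OF coordinate_partial_uv(1) xq um]
      bde_relation_partial[OF coordinate_partial_uv(2) xq um] this, folded h_def]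
  consider (E) "coeff_E x q \<noteq> 0" | (F) "coeff_F x q \<noteq> 0"
    using \<open>(coeff_F x q)\<^sup>2 - coeff_E x q * coeff_G x q \<noteq> 0\<close> by fastforce
  then have "umbilic_multiplicity x q = 1 \<longleftrightarrow> h \<noteq> 0"
  proof cases
    case E
    show ?thesis unfolding umbilic_multiplicity_eq_1_iff(1)[OF xq um E] H(1)[OF E] ..
  next
    case F
    show ?thesis unfolding umbilic_multiplicity_eq_1_iff(2)[OF xq um F] H(2)[OF F] ..
  qed
  ultimately show ?thesis by simp
qed

section \<open>Lightlike umbilic points\<close>

text \<open>
  The identity \<open>metric_discriminant_derivative\<close> for the two parameter directions, see also
  \<open>LD_fun_partial_v\<close>: up to terms that contain the discriminant \<open>F\<^sup>2 - E G\<close>, its gradient is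
  \<open>- 2 / \<langle>N, e\<rangle>\<close> times the second fundamental form applied to the tangential part of
  \<open>\<langle>N, e\<rangle> N\<close> in the frame \<open>x\<^sub>u, x\<^sub>v, e\<close>.
\<close>

lemma LD_fun_partial_u:
  fixes x z e
  defines "P \<equiv> partial_u x z" and "R \<equiv> partial_v x z"
  defines "N \<equiv> mink_cross P R"
  assumes x: "vanalytic x z"
  shows "mink N e * partial_u (LD_fun x) z =
     - 2 * (mink (mink_cross N R) e * coeff_l x z + mink (mink_cross P N) e * coeff_m x z)
     + 2 * LD_fun x z * mink e (mink_cross (partial_u (partial_u x) z) R + mink_cross P (partial_u (partial_v x) z))"
proof -
  note an = fundamental_forms_analytic[OF x] and van = vanalytic_derivatives[OF x]
  have LD: "LD_fun x = (\<lambda>z. coeff_F x z * coeff_F x z - coeff_E x z * coeff_G x z)"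
    by (simp add: fun_eq_iff LD_fun_def power2_eq_square)
  have E: "partial_u (coeff_E x) z = 2 * mink P (partial_u (partial_u x) z)"
    unfolding coeff_E_def[abs_def] partial_u_mink[OF van(1,1)] P_def by (simp add: mink_commute)
  have F: "partial_u (coeff_F x) z = mink (partial_u (partial_u x) z) R + mink P (partial_u (partial_v x) z)"
    unfolding coeff_F_def[abs_def] partial_u_mink[OF van(1,2)] P_def R_def by simp
  have G: "partial_u (coeff_G x) z = 2 * mink R (partial_u (partial_v x) z)"
    unfolding coeff_G_def[abs_def] partial_u_mink[OF van(2,2)] R_def by (simp add: mink_commute)
  have "partial_u (LD_fun x) z = 2 * mink P R * (mink (partial_u (partial_u x) z) R + mink P (partial_u (partial_v x) z))
     - (2 * mink P (partial_u (partial_u x) z) * mink R R + mink P P * (2 * mink R (partial_u (partial_v x) z)))"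
    unfolding LD
    by (simp add: partial_u_diff partial_u_mult an analytic2_at_mult E F G)
       (simp add: coeff_E_def coeff_F_def coeff_G_def P_def R_def algebra_simps)
  moreover have "mink N (partial_u (partial_u x) z) = coeff_l x z"
    by (simp add: coeff_l_def N_def P_def R_def)
  moreover have "mink N (partial_u (partial_v x) z) = coeff_m x z"
    by (simp add: coeff_m_def N_def P_def R_def vec_mixed_partials[OF x])
  moreover have "mink N N = LD_fun x z"
    by (simp add: N_def P_def R_def mink_Lagrange LD_fun_def coeff_E_def coeff_F_def coeff_G_def)
  ultimately show ?thesis
    using metric_discriminant_derivative[of P R e "partial_u (partial_u x) z" "partial_u (partial_v x) z"]
    by (simp add: N_def)
qed

lemma LD_fun_partial_v:
  fixes x z e
  defines "P \<equiv> partial_u x z" and "R \<equiv> partial_v x z"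
  defines "N \<equiv> mink_cross P R"
  assumes x: "vanalytic x z"
  shows "mink N e * partial_v (LD_fun x) z =
     - 2 * (mink (mink_cross N R) e * coeff_m x z + mink (mink_cross P N) e * coeff_n x z)
     + 2 * LD_fun x z * mink e (mink_cross (partial_v (partial_u x) z) R + mink_cross P (partial_v (partial_v x) z))"
proof -
  note an = fundamental_forms_analytic[OF x] and van = vanalytic_derivatives[OF x]
  have LD: "LD_fun x = (\<lambda>z. coeff_F x z * coeff_F x z - coeff_E x z * coeff_G x z)"
    by (simp add: fun_eq_iff LD_fun_def power2_eq_square)
  have E: "partial_v (coeff_E x) z = 2 * mink P (partial_v (partial_u x) z)"
    unfolding coeff_E_def[abs_def] partial_v_mink[OF van(1,1)] P_def by (simp add: mink_commute)
  have F: "partial_v (coeff_F x) z = mink (partial_v (partial_u x) z) R + mink P (partial_v (partial_v x) z)"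
    unfolding coeff_F_def[abs_def] partial_v_mink[OF van(1,2)] P_def R_def by simp
  have G: "partial_v (coeff_G x) z = 2 * mink R (partial_v (partial_v x) z)"
    unfolding coeff_G_def[abs_def] partial_v_mink[OF van(2,2)] R_def by (simp add: mink_commute)
  have "partial_v (LD_fun x) z = 2 * mink P R * (mink (partial_v (partial_u x) z) R + mink P (partial_v (partial_v x) z))
     - (2 * mink P (partial_v (partial_u x) z) * mink R R + mink P P * (2 * mink R (partial_v (partial_v x) z)))"
    unfolding LD
    by (simp add: partial_v_diff partial_v_mult an analytic2_at_mult E F G)
       (simp add: coeff_E_def coeff_F_def coeff_G_def P_def R_def algebra_simps)
  moreover have "mink N (partial_v (partial_u x) z) = coeff_m x z"
    by (simp add: coeff_m_def N_def P_def R_def)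
  moreover have "mink N (partial_v (partial_v x) z) = coeff_n x z"
    by (simp add: coeff_n_def N_def P_def R_def)
  moreover have "mink N N = LD_fun x z"
    by (simp add: N_def P_def R_def mink_Lagrange LD_fun_def coeff_E_def coeff_F_def coeff_G_def)
  ultimately show ?thesis
    using metric_discriminant_derivative[of P R e "partial_v (partial_u x) z" "partial_v (partial_v x) z"]
    by (simp add: N_def)
qed

text \<open>
  Here \<open>Z\<close> stands for a first derivative of \<open>\<delta>\<close>, and \<open>(l, m)\<close> and \<open>(E, F)\<close> for a row of the second and
  of the first fundamental form. At a point where \<open>\<delta>\<close> is critical with value zero, the error terms
  disappear from the derivatives of both relations; because the rows are proportional at the point,
  the second relation eliminates the derivatives of \<open>A\<close> and \<open>B\<close>.
\<close>

lemma differentiated_relation: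
  fixes D Z A B l m \<delta> S E F T :: "real \<times> real \<Rightarrow> real"
  assumes d: "coordinate_partial d"
    and an: "analytic2_at D q" "analytic2_at Z q" "analytic2_at A q" "analytic2_at B q" "analytic2_at l q"
      "analytic2_at m q" "analytic2_at \<delta> q" "analytic2_at S q" "analytic2_at E q" "analytic2_at F q" "analytic2_at T q"
    and rel: "\<forall>\<^sub>F z in nhds q. D z * Z z = - 2 * (A z * l z + B z * m z) + 2 * \<delta> z * S z"
    and ker: "\<forall>\<^sub>F z in nhds q. A z * E z + B z * F z + \<delta> z * T z = 0"
    and lm: "l q = k * E q" "m q = k * F q"
    and 0: "\<delta> q = 0" "d \<delta> q = 0" "Z q = 0"
  shows "D q * d Z q = - 2 * (A q * (d l q - k * d E q) + B q * (d m q - k * d F q))"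
proof -
  have 1: "D q * d Z q = - 2 * (d A q * l q + A q * d l q + (d B q * m q + B q * d m q))"
    using partial_cong[OF d rel] 0
    by (simp add: partial_rules[OF d] an analytic2_at_mult analytic2_at_add analytic2_at_const
      analytic2_at_uminus analytic2_at_diff)
  have 2: "d A q * E q + A q * d E q + (d B q * F q + B q * d F q) = 0"
    using partial_cong[OF d ker] 0
    by (simp add: partial_rules[OF d] an analytic2_at_mult analytic2_at_add analytic2_at_const)
  have "D q * d Z q = - 2 * (A q * (d l q - k * d E q) + B q * (d m q - k * d F q)
      + k * (d A q * E q + A q * d E q + (d B q * F q + B q * d F q)))"
    unfolding 1 lm by (simp add: algebra_simps)
  then show ?thesis unfolding 2 by simp
qed

text \<open>
  The Minkowski space contains no totally isotropic plane. So the metric of a surface never vanishes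
  altogether.
\<close>

lemma isotropic_plane_cross_zero:
  assumes "mink P P = 0" "mink P R = 0" "mink R R = 0"
  shows "mink_cross P R = 0"
proof -
  have e: "P $ 1 * P $ 1 + P $ 2 * P $ 2 = P $ 3 * P $ 3" "R $ 1 * R $ 1 + R $ 2 * R $ 2 = R $ 3 * R $ 3"
    "P $ 1 * R $ 1 + P $ 2 * R $ 2 = P $ 3 * R $ 3"
    using assms by (simp_all add: mink_def)
  let ?N = "mink_cross P R"
  have "?N $ 3 * ?N $ 3 = (P $ 1 * P $ 1 + P $ 2 * P $ 2) * (R $ 1 * R $ 1 + R $ 2 * R $ 2)
      - (P $ 1 * R $ 1 + P $ 2 * R $ 2) * (P $ 1 * R $ 1 + P $ 2 * R $ 2)"
    by (simp add: mink_cross_nth algebra_simps)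
  also have "\<dots> = 0" unfolding e by simp
  finally have 3: "?N $ 3 = 0" by simp
  have "mink ?N ?N = 0" by (simp add: mink_Lagrange assms)
  then have "(?N $ 1)\<^sup>2 + (?N $ 2)\<^sup>2 = 0" using 3 by (simp add: mink_def power2_eq_square)
  then have "?N $ 1 = 0" "?N $ 2 = 0" by (simp_all add: sum_power2_eq_zero_iff)
  with 3 show ?thesis by (simp add: vec_eq_iff forall_3)
qed

text \<open>
  The equations \<open>a = b = c = 0\<close> say that the cross product of \<open>(E, F, G)\<close> and \<open>(l, m, n)\<close> vanishes.
\<close>

lemma umbilic_proportional:
  assumes "umbilic x q" "coeff_E x q \<noteq> 0 \<or> coeff_G x q \<noteq> 0"
  obtains k where "coeff_l x q = k * coeff_E x q" "coeff_m x q = k * coeff_F x q" "coeff_n x q = k * coeff_G x q"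
proof (cases "coeff_E x q = 0")
  case False
  with assms show ?thesis
    by (intro that[of "coeff_l x q / coeff_E x q"])
       (auto simp: umbilic_def bde_a_def bde_b_def bde_c_def field_simps)
next
  case True
  with assms show ?thesis
    by (intro that[of "coeff_n x q / coeff_G x q"])
       (auto simp: umbilic_def bde_a_def bde_b_def bde_c_def field_simps)
qed

lemma bde_partials_proportional:
  assumes d: "coordinate_partial d" and x: "vanalytic x q"
    and k: "coeff_l x q = k * coeff_E x q" "coeff_m x q = k * coeff_F x q" "coeff_n x q = k * coeff_G x q"
  defines "L \<equiv> d (coeff_l x) q - k * d (coeff_E x) q"
    and "M \<equiv> d (coeff_m x) q - k * d (coeff_F x) q"
    and "N \<equiv> d (coeff_n x) q - k * d (coeff_G x) q"
  shows "d (bde_a x) q = coeff_F x q * N - coeff_G x q * M"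
    and "d (bde_b x) q = coeff_E x q * N - coeff_G x q * L"
    and "d (bde_c x) q = coeff_E x q * M - coeff_F x q * L"
  unfolding bde_a_def[abs_def] bde_b_def[abs_def] bde_c_def[abs_def] L_def M_def N_def
  by (simp_all add: partial_rules[OF d] fundamental_forms_analytic[OF x] analytic2_at_mult k algebra_simps)

text \<open>
  The gradient of \<open>\<delta> = F\<^sup>2 - E G\<close> is \<open>- 2 / D\<close> times the second fundamental form applied to \<open>(A, B)\<close>,
  up to multiples of \<open>\<delta>\<close>. At the umbilic point the second form is proportional to the first, whose
  kernel contains \<open>(A, B)\<close>; so \<open>\<delta>\<close> is critical, and its Hessian is obtained by differentiating once
  more. The vector \<open>e\<close> only serves to complete \<open>x\<^sub>u, x\<^sub>v\<close> to a basis at \<open>q\<close>.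
\<close>

theorem lightlike_umbilic_multiplicity:
  assumes x: "\<forall>\<^sub>F z in nhds q. vanalytic x z" and um: "umbilic x q" and deg: "LD_fun x q = 0"
    and imm: "\<And>\<alpha> \<beta>. \<alpha> *\<^sub>R partial_u x q + \<beta> *\<^sub>R partial_v x q = 0 \<Longrightarrow> \<alpha> = 0 \<and> \<beta> = 0"
  shows "umbilic_multiplicity x q = 1 \<longleftrightarrow> morse_singularity (LD_fun x) q"
proof -
  note xq = eventually_nhds_x_imp_x[OF x]
  define N where "N = (\<lambda>z. mink_cross (partial_u x z) (partial_v x z))"
  have N0: "N q \<noteq> 0"
    using mink_cross_eq_0_imp_dependent[of "partial_u x q" "partial_v x q"] imm unfolding N_def by blast
  \<comment> \<open>With the sign of the last coordinate reversed, \<open>N q\<close> pairs with itself as in Euclidean space.\<close>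
  obtain e where e: "mink (N q) e \<noteq> 0"
  proof
    let ?e = "vector [N q $ 1, N q $ 2, - N q $ 3] :: real^3"
    have "mink (N q) ?e = (N q $ 1)\<^sup>2 + (N q $ 2)\<^sup>2 + (N q $ 3)\<^sup>2"
      by (simp add: mink_def power2_eq_square)
    moreover have "\<dots> \<noteq> 0"
      using N0 by (auto simp: vec_eq_iff forall_3 add_nonneg_eq_0_iff)
    ultimately show "mink (N q) ?e \<noteq> 0" by simp
  qed
  define D where "D = (\<lambda>z. mink (N z) e)"
  define A where "A = (\<lambda>z. mink (mink_cross (N z) (partial_v x z)) e)"
  define B where "B = (\<lambda>z. mink (mink_cross (partial_u x z) (N z)) e)"
  define T1 where "T1 = (\<lambda>z. mink e (partial_u x z))"
  define T2 where "T2 = (\<lambda>z. mink e (partial_v x z))"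
  define S1 where "S1 = (\<lambda>z. mink e (mink_cross (partial_u (partial_u x) z) (partial_v x z)
      + mink_cross (partial_u x z) (partial_u (partial_v x) z)))"
  define S2 where "S2 = (\<lambda>z. mink e (mink_cross (partial_v (partial_u x) z) (partial_v x z)
      + mink_cross (partial_u x z) (partial_v (partial_v x) z)))"
  have an: "analytic2_at D q" "analytic2_at A q" "analytic2_at B q" "analytic2_at T1 q" "analytic2_at T2 q"
    "analytic2_at S1 q" "analytic2_at S2 q"
    unfolding D_def A_def B_def T1_def T2_def S1_def S2_def N_def
    by (intro analytic2_at_mink vanalytic_cross vanalytic_add vanalytic_const vanalytic_derivatives[OF xq])+
  note an' = fundamental_forms_analytic[OF xq] LD_fun_analytic[OF xq]
  have rel_u: "\<forall>\<^sub>F z in nhds q. D z * partial_u (LD_fun x) z =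
      - 2 * (A z * coeff_l x z + B z * coeff_m x z) + 2 * LD_fun x z * S1 z"
    using x unfolding D_def A_def B_def S1_def N_def by eventually_elim (rule LD_fun_partial_u)
  have rel_v: "\<forall>\<^sub>F z in nhds q. D z * partial_v (LD_fun x) z =
      - 2 * (A z * coeff_m x z + B z * coeff_n x z) + 2 * LD_fun x z * S2 z"
    using x unfolding D_def A_def B_def S2_def N_def by eventually_elim (rule LD_fun_partial_v)
  have NN: "mink (N z) (N z) = LD_fun x z" for z
    by (simp add: N_def mink_Lagrange LD_fun_def coeff_E_def coeff_F_def coeff_G_def)
  have Cramer: "D z * mink (N z) w = A z * mink (partial_u x z) w + B z * mink (partial_v x z) w + LD_fun x z * mink e w" for z w
    using mink_Cramer[of "partial_u x z" "partial_v x z" e w] NN[of z] by (simp add: D_def A_def B_def N_def)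
  have ker1: "A z * coeff_E x z + B z * coeff_F x z + LD_fun x z * T1 z = 0" for z
    using Cramer[of z "partial_u x z"]
    by (simp add: N_def mink_cross_self T1_def coeff_E_def coeff_F_def mink_commute[of "partial_v x z" "partial_u x z"])
  have ker2: "A z * coeff_F x z + B z * coeff_G x z + LD_fun x z * T2 z = 0" for z
    using Cramer[of z "partial_v x z"]
    by (simp add: N_def mink_cross_self T2_def coeff_F_def coeff_G_def)
  have Dq: "D q \<noteq> 0" using e by (simp add: D_def)
  have AB: "A q \<noteq> 0 \<or> B q \<noteq> 0"
  proof (rule ccontr)
    assume "\<not> ?thesis"
    then have "mink (N q) w = 0" for w using Cramer[of q w] Dq deg by simp
    then show False using e by simp
  qed
  have kerq: "A q * coeff_E x q + B q * coeff_F x q = 0" "A q * coeff_F x q + B q * coeff_G x q = 0"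
    using ker1[of q] ker2[of q] deg by simp_all
  have FF: "coeff_F x q * coeff_F x q = coeff_E x q * coeff_G x q"
    using deg by (simp add: LD_fun_def power2_eq_square)
  have EG: "coeff_E x q \<noteq> 0 \<or> coeff_G x q \<noteq> 0"
  proof (rule ccontr)
    assume "\<not> ?thesis"
    with FF have "mink (partial_u x q) (partial_u x q) = 0" "mink (partial_u x q) (partial_v x q) = 0"
      "mink (partial_v x q) (partial_v x q) = 0"
      by (simp_all add: coeff_E_def coeff_F_def coeff_G_def)
    from isotropic_plane_cross_zero[OF this] N0 show False by (simp add: N_def)
  qed
  obtain k where k: "coeff_l x q = k * coeff_E x q" "coeff_m x q = k * coeff_F x q" "coeff_n x q = k * coeff_G x q"
    using umbilic_proportional[OF um EG] .
  have "D q * partial_u (LD_fun x) q = - 2 * (k * (A q * coeff_E x q + B q * coeff_F x q))"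
    using eventually_nhds_x_imp_x[OF rel_u] deg k by (simp add: algebra_simps)
  then have grad_u: "partial_u (LD_fun x) q = 0" using kerq Dq by simp
  have "D q * partial_v (LD_fun x) q = - 2 * (k * (A q * coeff_F x q + B q * coeff_G x q))"
    using eventually_nhds_x_imp_x[OF rel_v] deg k by (simp add: algebra_simps)
  then have grad_v: "partial_v (LD_fun x) q = 0" using kerq Dq by simp
  define L where "L d = d (coeff_l x) q - k * d (coeff_E x) q" for d :: "(real \<times> real \<Rightarrow> real) \<Rightarrow> real \<times> real \<Rightarrow> real"
  define M where "M d = d (coeff_m x) q - k * d (coeff_F x) q" for d :: "(real \<times> real \<Rightarrow> real) \<Rightarrow> real \<times> real \<Rightarrow> real"
  define K where "K d = d (coeff_n x) q - k * d (coeff_G x) q" for d :: "(real \<times> real \<Rightarrow> real) \<Rightarrow> real \<times> real \<Rightarrow> real"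
  have Hu: "D q * d (partial_u (LD_fun x)) q = - 2 * (A q * L d + B q * M d)"
    and Hv: "D q * d (partial_v (LD_fun x)) q = - 2 * (A q * M d + B q * K d)"
    if d: "coordinate_partial d" for d
  proof -
    have g: "d (LD_fun x) q = 0" using d grad_u grad_v by (auto simp: coordinate_partial_def)
    show "D q * d (partial_u (LD_fun x)) q = - 2 * (A q * L d + B q * M d)"
      unfolding L_def M_def
      by (rule differentiated_relation[OF d _ _ _ _ _ _ _ _ _ _ _ rel_u always_eventually[OF allI[OF ker1]] k(1,2) deg g grad_u])
         (intro an an' analytic2_at_partial_u)+
    show "D q * d (partial_v (LD_fun x)) q = - 2 * (A q * M d + B q * K d)"
      unfolding M_def K_def
      by (rule differentiated_relation[OF d _ _ _ _ _ _ _ _ _ _ _ rel_v always_eventually[OF allI[OF ker2]] k(2,3) deg g grad_v])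
         (intro an an' analytic2_at_partial_v)+
  qed
  note bde = bde_partials_proportional[OF _ xq k, folded L_def M_def K_def]
  note H = Hu[OF coordinate_partial_uv(1)] Hu[OF coordinate_partial_uv(2)] Hv[OF coordinate_partial_uv(1)] Hv[OF coordinate_partial_uv(2)]
  have morse: "morse_singularity (LD_fun x) q \<longleftrightarrow>
     partial_u (partial_u (LD_fun x)) q * partial_v (partial_v (LD_fun x)) q
     - partial_v (partial_u (LD_fun x)) q * partial_u (partial_v (LD_fun x)) q \<noteq> 0"
    by (simp add: morse_singularity_iff grad_u grad_v)
  show ?thesis
  proof (cases "coeff_E x q = 0")
    case False
    show ?thesis
      unfolding morse umbilic_multiplicity_eq_1_iff(1)[OF xq um False]
        lightlike_umbilic_Hessian[OF False Dq AB FF kerq(1) H] bde[OF coordinate_partial_uv(1)] bde[OF coordinate_partial_uv(2)] ..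
  next
    case True
    then have G: "coeff_G x q \<noteq> 0" using EG by simp
    \<comment> \<open>Exchanging \<open>u\<close> and \<open>v\<close> exchanges \<open>E\<close> with \<open>G\<close>, \<open>l\<close> with \<open>n\<close> and \<open>A\<close> with \<open>B\<close>, and leads back to the
      algebra of the previous case.\<close>
    have "partial_v (partial_v (LD_fun x)) q * partial_u (partial_u (LD_fun x)) q
       - partial_u (partial_v (LD_fun x)) q * partial_v (partial_u (LD_fun x)) q \<noteq> 0 \<longleftrightarrow>
      (coeff_G x q * L partial_v - coeff_E x q * K partial_v) * (coeff_G x q * M partial_u - coeff_F x q * K partial_u)
      - (coeff_G x q * L partial_u - coeff_E x q * K partial_u) * (coeff_G x q * M partial_v - coeff_F x q * K partial_v) \<noteq> 0"
      by (rule lightlike_umbilic_Hessian[OF G Dq, where A = "B q" and B = "A q"])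
         (use AB FF kerq H in \<open>auto simp: algebra_simps\<close>)
    then show ?thesis
      unfolding morse umbilic_multiplicity_eq_1_iff(3)[OF xq um G] bde[OF coordinate_partial_uv(1)] bde[OF coordinate_partial_uv(2)]
      by (simp add: algebra_simps)
  qed
qed

theorem theorem3p11:
  fixes M :: "(real^3) set" and U :: "(real \<times> real) set"
    and x :: "real \<times> real \<Rightarrow> real^3" and p :: "real^3" and q :: "real \<times> real"
  assumes "regular_analytic_surface M"
    and "p \<in> M"
    and "local_parametrisation M U x"
    and "q \<in> U" and "p = x q"
  shows "(spacelike_umbilic x q \<or> timelike_umbilic x q \<longrightarrow>
            (umbilic_multiplicity x q = 1 \<longleftrightarrow> morse_singularity (discriminant_fun x) q)) \<and>
         (lightlike_umbilic x q \<longrightarrow>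
            (umbilic_multiplicity x q = 1 \<longleftrightarrow> morse_singularity (LD_fun x) q))"
proof -
  have "open U" and an: "\<And>z. z \<in> U \<Longrightarrow> vanalytic x z"
    and imm: "\<And>\<alpha> \<beta>. \<alpha> *\<^sub>R partial_u x q + \<beta> *\<^sub>R partial_v x q = 0 \<Longrightarrow> \<alpha> = 0 \<and> \<beta> = 0"
    using assms(3,4) by (auto simp: local_parametrisation_def vanalytic_def)
  have "\<forall>\<^sub>F z in nhds q. z \<in> U" using \<open>open U\<close> assms(4) by (rule eventually_nhds_in_open)
  then have x: "\<forall>\<^sub>F z in nhds q. vanalytic x z" by eventually_elim (rule an)
  show ?thesis
    using nondegenerate_umbilic_multiplicity[OF x] lightlike_umbilic_multiplicity[OF x _ _ imm]
    by (auto simp: spacelike_umbilic_def timelike_umbilic_def lightlike_umbilic_def)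
qed

end
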